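(* Let $\mathcal{A}=C^\infty(\mathbb{T}^2_\theta)$ ($\theta$ irrational), let $\mathcal{A}^o$ be its copy in the commutant of $\mathcal{A}$, let $k\in\mathcal{A}^o$ be positive and invertible, and consider the conformally rescaled spectral triple $(\mathcal{A},D_k=kDk,\mathcal{H}\otimes\mathbb{C}^2)$, where $\mathcal{H}=L^2(\mathbb{T}^2_\theta,\tau)$ and $$D=\begin{pmatrix}0&\delta_2-i\delta_1\\\delta_2+i\delta_1&0\end{pmatrix}$$ is the flat Dirac operator. For one-forms $v=k^2V^a\sigma^a$ and $w=k^2W^a\sigma^a$ with $V^a,W^a\in\mathcal{A}$, $a=1,2$ ($\sigma^a$ Pauli matrices, repeated indices summed), the metric functional reads $$\mathcal{g}_{D_k}(v,w)=\tau(V^aW^a),$$ whereas the spectral Einstein functional vanishes identically, $$\mathcal{G}_{D_k}(v,w)=0.$$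
   Context: The functionals are $\mathcal{g}_{D_k}(v,w)=\mathcal{W}(vw|D_k|^{-n})$ and $\mathcal{G}_{D_k}(v,w)=\mathcal{W}(v\{D_k,w\}D_k|D_k|^{-n})$ with $n=2$ and $\{D_k,w\}=D_kw+wD_k$. $\mathbb{T}^2_\theta$ is the noncommutative torus with standard trace $\tau$ and GNS space $\mathcal{H}$; $\delta_1,\delta_2$ are the basic derivations of $\mathcal{A}$ ($\delta_a(U_b)=\delta_{ab}U_b$ on the unitary generators), implemented on $\mathcal{H}$, and extended to the algebra $\hat{\mathcal{A}}$ generated by $\mathcal{A}$ and $\mathcal{A}^o$ (the copy of $\mathcal{A}$ acting on $\mathcal{H}$ in the commutant of $\mathcal{A}$, e.g. $\mathcal{A}^o=J\mathcal{A}J$). On $\hat{\mathcal{A}}$ one has the factorized trace $\tau^\otimes(ab^o)=\tau(a)\tau(b^o)$. Pseudodifferential operators have symbols that are functions of $\xi\in\mathbb{R}^2$ with values in $\hat{\mathcal{A}}\otimes M_2(\mathbb{C})$; $\delta_a$ has symbol $\xi_a$, elements of $\hat{\mathcal{A}}$ are their own symbols, and $\sigma(PQ)=\sum_\beta\frac1{\beta!}\partial^\beta_\xi\sigma(P)\,\delta^\beta\sigma(Q)$. The tracial Wodzicki residue is $\mathcal{W}(P)=N\,\tau^\otimes\big(\int_{\|\xi\|=1}\mathrm{tr}\,\sigma_{-2}(P)(\xi)\,d\xi\big)$, with $\mathrm{tr}$ the matrix trace and normalisation constant $N=\frac{1}{4\pi}=\frac1{2\cdot2\pi}$. Inverses are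 understood up to the finite-dimensional kernel. The bimodule of one-forms generated by the commutators $[D_k,a]$, $a\in\mathcal{A}$, is a free left $\mathcal{A}$-module generated by $k^2\sigma^1,k^2\sigma^2$. *)

theory Defs
  imports "HOL-Analysis.Analysis"
begin

section \<open>The smooth noncommutative torus\<close>

definition emb :: "int^2 \<Rightarrow> real^2" where
  "emb n = (\<chi> a. real_of_int (n $ a))"

definition wt :: "int^2 \<Rightarrow> real" where
  "wt n = 1 + norm (emb n)"

typedef nct = "{a :: int^2 \<Rightarrow> complex. \<forall>s::nat. \<exists>C. \<forall>n. wt n ^ s * norm (a n) \<le> C}"
  morphisms coeff Abs_nct
  by (rule exI[of _ "\<lambda>_. 0"]) auto

text \<open>
  An element of \<^type>\<open>nct\<close> is the rapidly decreasing coefficient sequence of a series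
  \<open>\<Sum>n. a n U\<^sub>n\<close>, where \<open>U\<^sub>n = exp (- i \<pi> \<theta> n\<^sub>1 n\<^sub>2) (U\<^sub>1 to the n\<^sub>1) (U\<^sub>2 to the n\<^sub>2)\<close> are the Weyl
  ordered monomials in the two unitary generators, which satisfy
  \<open>U\<^sub>1 U\<^sub>2 = exp (2 \<pi> i \<theta>) U\<^sub>2 U\<^sub>1\<close>. Only the product depends on \<open>\<theta>\<close>. The same type
  serves as the algebra of smooth elements and as the dense subspace of smooth vectors of its
  GNS space; it is an invariant core for all operators considered, and operators on the GNS
  space are represented by their restriction to it.
\<close>

setup_lifting type_definition_nct

lemma wt_ge_1: "1 \<le> wt n"
  by (simp add: wt_def)

lemma wt_add: "wt (m + n) \<le> wt m * wt n"
proof -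
  have "emb (m + n) = emb m + emb n"
    by (simp add: emb_def vec_eq_iff)
  then have "wt (m + n) \<le> 1 + (norm (emb m) + norm (emb n))"
    unfolding wt_def using norm_triangle_ineq[of "emb m" "emb n"] by simp
  also have "\<dots> \<le> wt m * wt n"
    by (simp add: wt_def algebra_simps)
  finally show ?thesis .
qed

lemma wt_uminus: "wt (- n) = wt n"
proof -
  have "emb (- n) = - emb n"
    by (simp add: emb_def vec_eq_iff)
  then show ?thesis by (simp add: wt_def)
qed

lemma wt_summable: "(\<lambda>n. 1 / wt n ^ 4) summable_on UNIV"
proof -
  define h where "h = (\<lambda>i::int. 1 / (1 + \<bar>real_of_int i\<bar>)^2)"
  have h: "h summable_on UNIV"
  proof -
    have "summable (\<lambda>i. inverse ((real (Suc i))^2))"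
      using inverse_power_summable[of 2, where ?'a=real] by (subst summable_Suc_iff) auto
    then have nat: "(\<lambda>i. 1 / (1 + real i)^2) summable_on UNIV"
      by (subst summable_on_UNIV_nonneg_real_iff) (auto simp: field_simps)
    have "h summable_on range int" "h summable_on range (\<lambda>i. - int i)"
      by (subst summable_on_reindex; auto simp: o_def nat h_def inj_def)+
    then have "h summable_on (range int \<union> range (\<lambda>i. - int i))"
      by (rule summable_on_union)
    moreover have "i \<in> range int \<union> range (\<lambda>i. - int i)" for i
      by (cases i rule: int_cases2) auto
    then have "range int \<union> range (\<lambda>i. - int i) = UNIV" by blast
    ultimately show ?thesis by simp
  qed
  have "(\<lambda>(i, j). h i * h j) summable_on UNIV \<times> UNIV"
  proof (rule summable_on_SigmaI[where g = "\<lambda>i. h i * infsum h UNIV"])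
    show "((\<lambda>j. case (i, j) of (i, j) \<Rightarrow> h i * h j) has_sum h i * infsum h UNIV) UNIV" for i
      using has_sum_cmult_right[OF has_sum_infsum[OF h], of "h i"] by simp
    show "(\<lambda>i. h i * infsum h UNIV) summable_on UNIV"
      using h by (rule summable_on_cmult_left)
  qed (auto simp: h_def)
  then have "(\<lambda>n::int^2. h (n $ 1) * h (n $ 2)) summable_on UNIV"
  proof (subst (asm) summable_on_reindex_bij_betw[symmetric, where g = "\<lambda>n::int^2. (n $ 1, n $ 2)" and A = UNIV])
    show "bij_betw (\<lambda>n::int^2. (n $ 1, n $ 2)) UNIV (UNIV \<times> UNIV)"
      by (rule bij_betwI[where g = "\<lambda>(i, j). vector [i, j]"]) (auto simp: vec_eq_iff forall_2)
  qed auto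
  then show ?thesis
  proof (rule summable_on_comparison_test)
    fix n :: "int^2"
    have "1 + \<bar>real_of_int (n $ a)\<bar> \<le> wt n" for a
      using component_le_norm_cart[of "emb n" a] by (simp add: wt_def emb_def)
    then have "(1 + \<bar>real_of_int (n $ a)\<bar>)^2 \<le> wt n ^ 2" for a
      by (intro power_mono) auto
    then have "(1 + \<bar>real_of_int (n $ 1)\<bar>)^2 * (1 + \<bar>real_of_int (n $ 2)\<bar>)^2 \<le> wt n ^ 2 * wt n ^ 2"
      by (intro mult_mono) auto
    also have "\<dots> = wt n ^ 4"
      by (simp flip: power_add)
    finally have "1 / wt n ^ 4 \<le> 1 / ((1 + \<bar>real_of_int (n $ 1)\<bar>)^2 * (1 + \<bar>real_of_int (n $ 2)\<bar>)^2)"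
      by (intro divide_left_mono) (use wt_ge_1[of n] in \<open>auto intro!: mult_pos_pos zero_less_power\<close>)
    then show "1 / wt n ^ 4 \<le> h (n $ 1) * h (n $ 2)"
      by (simp add: h_def)
    show "0 \<le> 1 / wt n ^ 4"
      using wt_ge_1[of n] by simp
  qed
qed

instantiation nct :: ab_group_add
begin

lift_definition zero_nct :: nct is "\<lambda>_. 0"
  by auto

lift_definition plus_nct :: "nct \<Rightarrow> nct \<Rightarrow> nct" is "\<lambda>a b n. a n + b n"
proof -
  fix a b :: "int^2 \<Rightarrow> complex" and s :: nat
  assume "\<And>s. \<exists>C. \<forall>n. wt n ^ s * norm (a n) \<le> C" "\<And>s. \<exists>C. \<forall>n. wt n ^ s * norm (b n) \<le> C"
  then obtain C1 C2 where C: "\<And>n. wt n ^ s * norm (a n) \<le> C1" "\<And>n. wt n ^ s * norm (b n) \<le> C2"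
    by meson
  have "wt n ^ s * norm (a n + b n) \<le> C1 + C2" for n
  proof -
    have "wt n ^ s * norm (a n + b n) \<le> wt n ^ s * (norm (a n) + norm (b n))"
      using wt_ge_1[of n] by (intro mult_left_mono norm_triangle_ineq) auto
    with C[of n] show ?thesis by (simp add: algebra_simps)
  qed
  then show "\<exists>C. \<forall>n. wt n ^ s * norm (a n + b n) \<le> C" by blast
qed

lift_definition uminus_nct :: "nct \<Rightarrow> nct" is "\<lambda>a n. - a n"
  by simp

definition minus_nct :: "nct \<Rightarrow> nct \<Rightarrow> nct" where
  "minus_nct a b = a + (- b)"

instance
  by standard (unfold minus_nct_def, (transfer; auto simp: fun_eq_iff)+)

end

lift_definition cscale :: "complex \<Rightarrow> nct \<Rightarrow> nct" is "\<lambda>c a n. c * a n"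
proof -
  fix c :: complex and a :: "int^2 \<Rightarrow> complex" and s :: nat
  assume "\<And>s. \<exists>C. \<forall>n. wt n ^ s * norm (a n) \<le> C"
  then obtain C where C: "\<And>n. wt n ^ s * norm (a n) \<le> C" by meson
  have "wt n ^ s * norm (c * a n) \<le> norm c * C" for n
    using mult_left_mono[OF C[of n], of "norm c"] by (simp add: norm_mult algebra_simps)
  then show "\<exists>C. \<forall>n. wt n ^ s * norm (c * a n) \<le> C" by blast
qed

lift_definition U :: "int^2 \<Rightarrow> nct" is "\<lambda>m n. if n = m then 1 else 0"
proof -
  fix m :: "int^2" and s :: nat
  have "wt n ^ s * norm (if n = m then 1 else 0 :: complex) \<le> wt m ^ s" for n
    using wt_ge_1[of m] by auto
  then show "\<exists>C. \<forall>n. wt n ^ s * norm (if n = m then 1 else 0 :: complex) \<le> C" by blast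
qed

definition cocycle :: "real \<Rightarrow> int^2 \<Rightarrow> int^2 \<Rightarrow> complex" where
  "cocycle \<theta> m n = cis (pi * \<theta> * real_of_int (m $ 1 * n $ 2 - m $ 2 * n $ 1))"

lift_definition tmult :: "real \<Rightarrow> nct \<Rightarrow> nct \<Rightarrow> nct" is
  "\<lambda>\<theta> a b n. \<Sum>\<^sub>\<infinity>m. cocycle \<theta> m (n - m) * a m * b (n - m)"
proof -
  fix \<theta> :: real and a b :: "int^2 \<Rightarrow> complex" and s :: nat
  assume a: "\<And>s. \<exists>C. \<forall>n. wt n ^ s * norm (a n) \<le> C"
    and b: "\<And>s. \<exists>C. \<forall>n. wt n ^ s * norm (b n) \<le> C"
  obtain A where A: "\<And>n. wt n ^ (s + 4) * norm (a n) \<le> A" using a by meson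
  obtain B where B: "\<And>n. wt n ^ s * norm (b n) \<le> B" using b by meson
  have w: "0 < wt n" for n using wt_ge_1[of n] by simp
  let ?f = "\<lambda>n m. cocycle \<theta> m (n - m) * a m * b (n - m)"
  have bound: "wt n ^ s * norm (?f n m) \<le> A * B * (1 / wt m ^ 4)" for n m
  proof -
    have "wt n ^ s \<le> (wt m * wt (n - m)) ^ s"
      using wt_add[of m "n - m"] w[of n] by (intro power_mono) auto
    then have "wt n ^ s * norm (?f n m) \<le> (wt m * wt (n - m)) ^ s * norm (?f n m)"
      by (rule mult_right_mono) simp
    also have "\<dots> = (wt m ^ s * norm (a m)) * (wt (n - m) ^ s * norm (b (n - m)))"
      by (simp add: norm_mult cocycle_def power_mult_distrib)
    also have "\<dots> \<le> (A * (1 / wt m ^ 4)) * B"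
    proof (rule mult_mono)
      show A': "wt m ^ s * norm (a m) \<le> A * (1 / wt m ^ 4)"
        using A[of m] w[of m] by (simp add: field_simps power_add)
      show "0 \<le> A * (1 / wt m ^ 4)"
        by (rule order_trans[OF _ A']) (use w[of m] in simp)
      show "wt (n - m) ^ s * norm (b (n - m)) \<le> B"
        by (rule B)
      show "0 \<le> wt (n - m) ^ s * norm (b (n - m))"
        using w[of "n - m"] by simp
    qed
    finally show ?thesis by (simp add: algebra_simps)
  qed
  have "wt n ^ s * norm (infsum (?f n) UNIV) \<le> (\<Sum>\<^sub>\<infinity>m. A * B * (1 / wt m ^ 4))" for n
  proof -
    have le: "norm (wt n ^ s *\<^sub>R ?f n m) \<le> A * B * (1 / wt m ^ 4)" for m
      using bound[of n m] w[of n] by simp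
    have sm: "(\<lambda>m. A * B * (1 / wt m ^ 4)) summable_on UNIV"
      using wt_summable by (rule summable_on_cmult_right)
    have abs: "(\<lambda>m. norm (wt n ^ s *\<^sub>R ?f n m)) summable_on UNIV"
      by (rule summable_on_comparison_test[OF sm]) (use le in auto)
    have "wt n ^ s * norm (infsum (?f n) UNIV) = norm (wt n ^ s *\<^sub>R infsum (?f n) UNIV)"
      using w[of n] by simp
    also have "\<dots> = norm (\<Sum>\<^sub>\<infinity>m. wt n ^ s *\<^sub>R ?f n m)"
      by (simp only: infsum_scaleR_right)
    also have "\<dots> \<le> (\<Sum>\<^sub>\<infinity>m. norm (wt n ^ s *\<^sub>R ?f n m))"
      using abs by (rule norm_infsum_bound)
    also have "\<dots> \<le> (\<Sum>\<^sub>\<infinity>m. A * B * (1 / wt m ^ 4))"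
      using abs sm le by (intro infsum_mono) auto
    finally show ?thesis .
  qed
  then show "\<exists>C. \<forall>n. wt n ^ s * norm (infsum (?f n) UNIV) \<le> C"
    by (intro exI allI)
qed

lift_definition star :: "nct \<Rightarrow> nct" is "\<lambda>a n. cnj (a (- n))"
proof -
  fix a :: "int^2 \<Rightarrow> complex" and s :: nat
  assume "\<And>s. \<exists>C. \<forall>n. wt n ^ s * norm (a n) \<le> C"
  then obtain C where C: "\<And>n. wt n ^ s * norm (a n) \<le> C" by meson
  have "wt n ^ s * norm (cnj (a (- n))) \<le> C" for n
    using C[of "- n"] by (simp add: wt_uminus)
  then show "\<exists>C. \<forall>n. wt n ^ s * norm (cnj (a (- n))) \<le> C" by blast
qed

definition tau :: "nct \<Rightarrow> complex" where
  "tau a = coeff a 0"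

lift_definition delta :: "2 \<Rightarrow> nct \<Rightarrow> nct" is "\<lambda>i a n. of_int (n $ i) * a n"
proof -
  fix i :: 2 and a :: "int^2 \<Rightarrow> complex" and s :: nat
  assume "\<And>s. \<exists>C. \<forall>n. wt n ^ s * norm (a n) \<le> C"
  then obtain C where C: "\<And>n. wt n ^ Suc s * norm (a n) \<le> C" by meson
  have "wt n ^ s * norm (of_int (n $ i) * a n) \<le> C" for n
  proof -
    have "\<bar>real_of_int (n $ i)\<bar> \<le> wt n"
      using component_le_norm_cart[of "emb n" i] by (simp add: wt_def emb_def)
    then have "\<bar>real_of_int (n $ i)\<bar> * (wt n ^ s * norm (a n)) \<le> wt n * (wt n ^ s * norm (a n))"
      using wt_ge_1[of n] by (intro mult_right_mono) auto
    with C[of n] show ?thesis by (simp add: norm_mult algebra_simps)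
  qed
  then show "\<exists>C. \<forall>n. wt n ^ s * norm (of_int (n $ i) * a n) \<le> C" by blast
qed

lemma tmult_U: "tmult \<theta> (U m) (U n) = cscale (cocycle \<theta> m n) (U (m + n))"
proof -
  have "(\<Sum>\<^sub>\<infinity>q. cocycle \<theta> q (p - q) * coeff (U m) q * coeff (U n) (p - q))
      = cocycle \<theta> m n * coeff (U (m + n)) p" for p
  proof -
    have "(\<Sum>\<^sub>\<infinity>q. cocycle \<theta> q (p - q) * coeff (U m) q * coeff (U n) (p - q))
        = (\<Sum>\<^sub>\<infinity>q\<in>{m}. cocycle \<theta> q (p - q) * coeff (U m) q * coeff (U n) (p - q))"
      by (rule infsum_cong_neutral) (auto simp: U.rep_eq)
    then show ?thesis by (auto simp: U.rep_eq algebra_simps)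
  qed
  then show ?thesis
    by (simp add: coeff_inject[symmetric] fun_eq_iff tmult.rep_eq cscale.rep_eq)
qed


section \<open>Operators on smooth vectors\<close>

definition Lmul :: "real \<Rightarrow> nct \<Rightarrow> nct \<Rightarrow> nct" where
  "Lmul \<theta> a = (\<lambda>\<psi>. tmult \<theta> a \<psi>)"

definition Rmul :: "real \<Rightarrow> nct \<Rightarrow> nct \<Rightarrow> nct" where
  "Rmul \<theta> b = (\<lambda>\<psi>. tmult \<theta> \<psi> b)"

text \<open>With \<open>J \<psi> = \<psi>\<^sup>*\<close> one has \<open>J b J = Rmul \<theta> (star b)\<close>.\<close>

definition Aop :: "real \<Rightarrow> (nct \<Rightarrow> nct) set" where
  "Aop \<theta> = range (Rmul \<theta>)"

definition gns_inner :: "real \<Rightarrow> nct \<Rightarrow> nct \<Rightarrow> complex" where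
  "gns_inner \<theta> \<phi> \<psi> = tau (tmult \<theta> (star \<phi>) \<psi>)"

definition positive_op :: "real \<Rightarrow> (nct \<Rightarrow> nct) \<Rightarrow> bool" where
  "positive_op \<theta> T \<longleftrightarrow> (\<forall>\<psi>. \<exists>r\<ge>0. gns_inner \<theta> \<psi> (T \<psi>) = complex_of_real r)"

inductive_set Ahat :: "real \<Rightarrow> (nct \<Rightarrow> nct) set" for \<theta> :: real where
  Ahat_A: "Lmul \<theta> a \<in> Ahat \<theta>"
| Ahat_Aop: "T \<in> Aop \<theta> \<Longrightarrow> T \<in> Ahat \<theta>"
| Ahat_add: "S \<in> Ahat \<theta> \<Longrightarrow> T \<in> Ahat \<theta> \<Longrightarrow> (\<lambda>\<psi>. S \<psi> + T \<psi>) \<in> Ahat \<theta>"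
| Ahat_scale: "T \<in> Ahat \<theta> \<Longrightarrow> (\<lambda>\<psi>. cscale c (T \<psi>)) \<in> Ahat \<theta>"
| Ahat_comp: "S \<in> Ahat \<theta> \<Longrightarrow> T \<in> Ahat \<theta> \<Longrightarrow> S \<circ> T \<in> Ahat \<theta>"

text \<open>
  As \<open>\<A>\<close> and \<open>\<A>\<^sup>o\<close> commute, every element of \<^term>\<open>Ahat \<theta>\<close> is a finite sum of
  products \<open>a b\<^sup>o\<close>; for irrational \<open>\<theta>\<close> the value below does not depend on the decomposition.
\<close>

definition tau_ot :: "real \<Rightarrow> (nct \<Rightarrow> nct) \<Rightarrow> complex" where
  "tau_ot \<theta> T = (THE c. \<exists>N a b. T = (\<lambda>\<psi>. \<Sum>i<(N::nat). Lmul \<theta> (a i) (Rmul \<theta> (b i) \<psi>)) \<and>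
     c = (\<Sum>i<N. tau (a i) * tau (b i)))"


section \<open>Spinors and the rescaled Dirac operator\<close>

definition spinor_inner :: "real \<Rightarrow> nct^2 \<Rightarrow> nct^2 \<Rightarrow> complex" where
  "spinor_inner \<theta> \<phi> \<psi> = (\<Sum>i\<in>UNIV. gns_inner \<theta> (\<phi> $ i) (\<psi> $ i))"

definition diag_op :: "(nct \<Rightarrow> nct) \<Rightarrow> nct^2 \<Rightarrow> nct^2" where
  "diag_op T \<psi> = (\<chi> i. T (\<psi> $ i))"

definition M2Ahat :: "real \<Rightarrow> (nct^2 \<Rightarrow> nct^2) set" where
  "M2Ahat \<theta> = {(\<lambda>\<psi>. \<chi> i. \<Sum>j\<in>UNIV. M i j (\<psi> $ j)) | M. \<forall>i j. M i j \<in> Ahat \<theta>}"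

definition mtrace :: "(nct^2 \<Rightarrow> nct^2) \<Rightarrow> nct \<Rightarrow> nct" where
  "mtrace T \<psi> = (\<Sum>i\<in>UNIV. T (axis i \<psi>) $ i)"

definition pauli :: "2 \<Rightarrow> complex^2^2" where
  "pauli a = (if a = 1 then vector [vector [0, 1], vector [1, 0]]
                       else vector [vector [0, - \<i>], vector [\<i>, 0]])"

definition clifford :: "real \<Rightarrow> (2 \<Rightarrow> nct) \<Rightarrow> nct^2 \<Rightarrow> nct^2" where
  "clifford \<theta> V \<psi> = (\<chi> i. \<Sum>a\<in>UNIV. \<Sum>j\<in>UNIV. cscale (pauli a $ i $ j) (Lmul \<theta> (V a) (\<psi> $ j)))"

definition dirac :: "nct^2 \<Rightarrow> nct^2" where
  "dirac \<psi> = vector [delta 2 (\<psi> $ 2) - cscale \<i> (delta 1 (\<psi> $ 2)),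
                     delta 2 (\<psi> $ 1) + cscale \<i> (delta 1 (\<psi> $ 1))]"

definition dirac_k :: "(nct \<Rightarrow> nct) \<Rightarrow> nct^2 \<Rightarrow> nct^2" where
  "dirac_k k = diag_op k \<circ> dirac \<circ> diag_op k"

definition one_form :: "real \<Rightarrow> (nct \<Rightarrow> nct) \<Rightarrow> (2 \<Rightarrow> nct) \<Rightarrow> nct^2 \<Rightarrow> nct^2" where
  "one_form \<theta> k V = diag_op k \<circ> diag_op k \<circ> clifford \<theta> V"

text \<open>
  For a symmetric operator \<open>T\<close>, for which \<open>|T|\<^sup>2 = T\<^sup>2\<close>, this is \<open>|T|\<close> to the power \<open>-2\<close>: the
  inverse of \<open>T\<^sup>2\<close> on the orthogonal complement of the kernel of \<open>T\<close>, and zero on the kernel.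
\<close>

definition abs_inv_sq :: "real \<Rightarrow> (nct^2 \<Rightarrow> nct^2) \<Rightarrow> nct^2 \<Rightarrow> nct^2" where
  "abs_inv_sq \<theta> T \<psi> =
     (THE \<phi>. (\<forall>\<eta>. T \<eta> = 0 \<longrightarrow> spinor_inner \<theta> \<eta> \<phi> = 0) \<and> T (\<psi> - T (T \<phi>)) = 0)"


section \<open>Pseudodifferential operators and the Wodzicki residue\<close>

definition pd :: "2 \<Rightarrow> (real^2 \<Rightarrow> complex) \<Rightarrow> real^2 \<Rightarrow> complex" where
  "pd a f \<xi> = vector_derivative (\<lambda>t. f (\<xi> + t *\<^sub>R axis a 1)) (at 0)"

definition smooth_off_zero :: "(real^2 \<Rightarrow> complex) \<Rightarrow> bool" where
  "smooth_off_zero f \<longleftrightarrow> (\<forall>as. foldr pd as f differentiable_on (- {0}))"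

text \<open>
  Smooth functions with values in the algebra \<open>Ahat \<otimes> M\<^sub>2\<close> (which is generated algebraically,
  without completion) are the elements of the algebraic tensor product of the smooth scalar
  functions with that algebra. Values at \<open>\<xi> = 0\<close> are irrelevant throughout.
\<close>

definition homogeneous_symbol ::
    "real \<Rightarrow> int \<Rightarrow> (real^2 \<Rightarrow> nct^2 \<Rightarrow> nct^2) \<Rightarrow> bool" where
  "homogeneous_symbol \<theta> d s \<longleftrightarrow>
     (\<exists>N f T. (\<forall>l<(N::nat). smooth_off_zero (f l) \<and> T l \<in> M2Ahat \<theta>) \<and>
        (\<forall>\<xi>. \<xi> \<noteq> 0 \<longrightarrow> (\<forall>\<psi> i. s \<xi> \<psi> $ i = (\<Sum>l<N. cscale (f l \<xi>) (T l \<psi> $ i))))) \<and>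
     (\<forall>\<xi> t. \<xi> \<noteq> 0 \<longrightarrow> 0 < t \<longrightarrow>
        (\<forall>\<psi> i. s (t *\<^sub>R \<xi>) \<psi> $ i = cscale (of_real (t powi d)) (s \<xi> \<psi> $ i)))"

text \<open>
  The operator with full symbol \<open>\<rho>\<close> maps \<open>\<Sum>n. \<psi> n U\<^sub>n\<close> to \<open>\<Sum>n. \<psi> n \<rho>(n) U\<^sub>n\<close>, i.e. it is
  the integral \<open>\<psi> \<mapsto> (2\<pi>)\<^sup>-\<^sup>2 \<integral>\<integral> e\<^sup>-\<^sup>i\<^sup>s\<^sup>\<xi> \<rho>(\<xi>) \<alpha>\<^sub>s(\<psi>) ds d\<xi>\<close> with \<open>\<alpha>\<^sub>s(U\<^sub>n) = e\<^sup>i\<^sup>s\<^sup>n U\<^sub>n\<close>. In this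
  quantisation \<open>\<delta>\<^sub>a\<close> has symbol \<open>\<xi>\<^sub>a\<close>, elements of the algebra \<open>Ahat \<otimes> M\<^sub>2\<close> are their own
  symbols, and Taylor expansion of \<open>\<sigma>(P)(n + r)\<close> in \<open>r\<close>, with \<open>r\<close> turning into \<open>\<delta>\<close> acting on
  \<open>\<sigma>(Q)\<close>, gives \<open>\<sigma>(PQ) = \<Sum>\<beta>. 1/\<beta>! \<partial>\<^sup>\<beta>\<sigma>(P) \<delta>\<^sup>\<beta>\<sigma>(Q)\<close>.

  \<open>has_symbol \<theta> P \<sigma>\<close> states that \<open>\<rho>\<close> is classical with homogeneous components \<open>\<sigma> d\<close> of degree
  \<open>d \<le> m\<close>: the remainder after the components of degree at least \<open>N\<close> is \<open>O(|n|\<^sup>N\<^sup>-\<^sup>1)\<close> together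
  with all its derivatives \<open>\<delta>\<^sup>\<beta>\<close>, that is, with rapid decay of the matrix elements away from
  the diagonal. (Estimates of \<open>\<xi>\<close>-differences follow, as \<open>N\<close> is arbitrary.)
\<close>

definition has_symbol ::
    "real \<Rightarrow> (nct^2 \<Rightarrow> nct^2) \<Rightarrow> (int \<Rightarrow> real^2 \<Rightarrow> nct^2 \<Rightarrow> nct^2) \<Rightarrow> bool" where
  "has_symbol \<theta> P \<sigma> \<longleftrightarrow>
     (\<forall>\<psi> i p. ((\<lambda>(n, j). coeff (\<psi> $ j) n * coeff (P (axis j (U n)) $ i) p)
         has_sum coeff (P \<psi> $ i) p) UNIV) \<and>
     (\<forall>d. homogeneous_symbol \<theta> d (\<sigma> d)) \<and>
     (\<exists>m. (\<forall>d>m. \<forall>\<xi>. \<xi> \<noteq> 0 \<longrightarrow> (\<forall>\<psi>. \<sigma> d \<xi> \<psi> = 0)) \<and>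
       (\<forall>N. \<forall>s::nat. \<exists>C. \<forall>n i j p. n \<noteq> 0 \<longrightarrow>
          wt (p - n) ^ s *
            norm (coeff ((P (axis j (U n)) - (\<Sum>d=N..m. \<sigma> d (emb n) (axis j (U n)))) $ i) p)
          \<le> C * norm (emb n) powi (N - 1)))"

text \<open>For irrational \<open>\<theta>\<close> the components are determined by \<open>P\<close> away from \<open>\<xi> = 0\<close>.\<close>

definition symbol_of ::
    "real \<Rightarrow> (nct^2 \<Rightarrow> nct^2) \<Rightarrow> int \<Rightarrow> real^2 \<Rightarrow> nct^2 \<Rightarrow> nct^2" where
  "symbol_of \<theta> P = (SOME \<sigma>. has_symbol \<theta> P \<sigma>)"

definition circle_integral :: "(real^2 \<Rightarrow> nct \<Rightarrow> nct) \<Rightarrow> nct \<Rightarrow> nct" where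
  "circle_integral F \<psi> =
     Abs_nct (\<lambda>n. integral {0..2*pi} (\<lambda>t. coeff (F (vector [cos t, sin t]) \<psi>) n))"

definition wodzicki :: "real \<Rightarrow> (nct^2 \<Rightarrow> nct^2) \<Rightarrow> complex" where
  "wodzicki \<theta> P = 1 / (4 * pi) * tau_ot \<theta> (circle_integral (\<lambda>\<xi>. mtrace (symbol_of \<theta> P (-2) \<xi>)))"

definition metric_functional ::
    "real \<Rightarrow> (nct^2 \<Rightarrow> nct^2) \<Rightarrow> (nct^2 \<Rightarrow> nct^2) \<Rightarrow> (nct^2 \<Rightarrow> nct^2) \<Rightarrow> complex" where
  "metric_functional \<theta> T v w = wodzicki \<theta> (v \<circ> w \<circ> abs_inv_sq \<theta> T)"

definition anticomm :: "(nct^2 \<Rightarrow> nct^2) \<Rightarrow> (nct^2 \<Rightarrow> nct^2) \<Rightarrow> nct^2 \<Rightarrow> nct^2" where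
  "anticomm S T = (\<lambda>\<psi>. S (T \<psi>) + T (S \<psi>))"

definition einstein_functional ::
    "real \<Rightarrow> (nct^2 \<Rightarrow> nct^2) \<Rightarrow> (nct^2 \<Rightarrow> nct^2) \<Rightarrow> (nct^2 \<Rightarrow> nct^2) \<Rightarrow> complex" where
  "einstein_functional \<theta> T v w = wodzicki \<theta> (v \<circ> anticomm T w \<circ> T \<circ> abs_inv_sq \<theta> T)"

end

theory Submission
  imports Defs
begin

text \<open>
  Write \<open>z = \<xi>\<^sub>2 + \<i> \<xi>\<^sub>1\<close>, so that the two entries of the flat Dirac operator are the derivations \<open>dz\<close>
  with symbol \<open>z\<close> or its conjugate, whose inverses are Fourier multipliers. With \<open>l = k\<^sup>-\<^sup>1\<close> and up to
  rank one smoothing operators, which account for the kernel of \<open>D\<^sub>k\<close> and are invisible in symbols,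
  \<open>|D\<^sub>k|\<^sup>-\<^sup>2\<close> is diagonal with entries \<open>l dz\<^sup>-\<^sup>1 l\<^sup>2 dz\<^sup>-\<^sup>1 l\<close>, where one of the two inverses belongs to \<open>z\<close>
  and the other to its conjugate (\<open>abs_inv_sq_eq\<close>, \<open>smoothing_Q\<close>).

  The symbol of \<open>dz\<^sup>-\<^sup>1 X\<close>, for \<open>X\<close> in the algebra generated by \<open>\<A>\<close> and \<open>\<A>\<^sup>o\<close>, is a geometric series
  in the commutator \<open>ad\<close> with \<open>dz\<close> (\<open>zinv_expansion\<close>). All symbols are therefore explicit sums of
  monomials in \<open>z\<close> and its conjugate, with negative exponents allowed and with coefficients in that
  algebra. For the metric functional the term of degree \<open>-2\<close> is the product of the leading terms.
  There \<open>k\<close> commutes with \<open>\<A>\<close> and cancels against \<open>l\<close>, the matrix trace of the Pauli matrices gives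
  \<open>2 V\<^sup>a W\<^sup>a\<close>, and the circle contributes its length (\<open>metric_functional_eq\<close>). For the Einstein
  functional the operator has order \<open>0\<close>. Its two diagonal entries are sums of products
  \<open>c dz g dz\<^sup>-\<^sup>1 l\<close>, and every term of degree \<open>-2\<close> contains an angular factor which is a nonzero power
  of \<open>e\<^sup>i\<^sup>t\<close>. So already the integral over the circle vanishes, before any trace is taken
  (\<open>dz_zinv_symbol_circle\<close>, \<open>einstein_functional_eq\<close>).

  Both computations use a particular symbol and a particular decomposition of an element of that
  algebra. That the result does not depend on them rests on the irrationality of \<open>\<theta>\<close>: the matrix
  elements of an operator in the algebra at distance \<open>r\<close> from the diagonal are almost periodic along the lattice, with frequencies separated by
  \<open>\<theta>\<close>, and averages over large squares recover the coefficients (\<open>almost_periodic_eq_0\<close>).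
  Squares that move to infinity in the direction \<open>\<xi>\<close> give the uniqueness of the homogeneous
  components at \<open>\<xi>\<close> (\<open>has_symbol_unique\<close>), and squares at the origin that the factorised trace is
  well defined (\<open>tau_ot_Lmul\<close>).
\<close>

section \<open>The algebra of rapidly decreasing sequences\<close>

lemma nct_eqI: "(\<And>n. coeff a n = coeff b n) \<Longrightarrow> a = b"
  by (simp add: coeff_inject[symmetric] fun_eq_iff)

lemma coeff_minus: "coeff (a - b) n = coeff a n - coeff b n"
  by (simp only: minus_nct_def plus_nct.rep_eq uminus_nct.rep_eq) simp

lemma coeff_sum: "coeff (sum f A) n = (\<Sum>x\<in>A. coeff (f x) n)"
  by (induction A rule: infinite_finite_induct) (auto simp: zero_nct.rep_eq plus_nct.rep_eq)

lemmas coeff_simps [simp] =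
  zero_nct.rep_eq plus_nct.rep_eq uminus_nct.rep_eq cscale.rep_eq coeff_minus coeff_sum U.rep_eq
  delta.rep_eq

lemma cscale_simps [simp]:
  "cscale c 0 = 0" "cscale 0 a = 0" "cscale 1 a = a" "cscale c (cscale d a) = cscale (c * d) a"
  by (rule nct_eqI; simp)+

lemma cscale_add_right: "cscale c (a + b) = cscale c a + cscale c b"
  by (rule nct_eqI) (simp add: algebra_simps)

lemma cscale_add_left: "cscale (c + d) a = cscale c a + cscale d a"
  by (rule nct_eqI) (simp add: algebra_simps)

lemma cscale_diff_right: "cscale c (a - b) = cscale c a - cscale c b"
  by (rule nct_eqI) (simp add: algebra_simps)

lemma cscale_sum_right: "cscale c (sum f A) = (\<Sum>x\<in>A. cscale c (f x))"
  by (rule nct_eqI) (simp add: sum_distrib_left)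

lemma cscale_minus_one: "cscale (-1) a = - a"
  by (rule nct_eqI) simp

lemma wt_pos [simp]: "0 < wt n" and wt_nonneg [simp]: "0 \<le> wt n" and wt_nz [simp]: "wt n \<noteq> 0"
  using wt_ge_1[of n] by linarith+

lemma wt_zero [simp]: "wt 0 = 1"
  by (simp add: wt_def emb_def vec_eq_iff norm_vec_def L2_set_def)

lemma wt_triangle: "wt (p - q) \<le> wt (p - m) * wt (m - q)"
  using wt_add[of "p - m" "m - q"] by simp

lemma coeff_decay:
  obtains C where "0 \<le> C" "\<And>n. wt n ^ s * norm (coeff a n) \<le> C"
proof -
  obtain C where C: "\<And>n. wt n ^ s * norm (coeff a n) \<le> C"
    using coeff[of a] by auto
  moreover have "0 \<le> C"
    by (rule order_trans[OF _ C[of 0]]) simp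
  ultimately show ?thesis using that by blast
qed

lemma norm_cocycle [simp]: "norm (cocycle \<theta> m n) = 1"
  by (simp add: cocycle_def)

text \<open>Peetre's inequality moves the weight centred at \<open>q\<close> onto the two factors. Four spare powers of the
  weight of the left factor make the convolution summable.\<close>

lemma tmult_term_bound:
  assumes A: "\<And>m. wt m ^ (s + 4) * norm (coeff a m) \<le> A"
    and B: "\<And>p. wt (p - q) ^ s * norm (coeff b p) \<le> B"
  shows "wt (p - q) ^ s * norm (cocycle \<theta> m (p - m) * coeff a m * coeff b (p - m))
           \<le> A * B * (1 / wt m ^ 4)"
proof -
  have "wt (p - q) \<le> wt m * wt (p - m - q)"
    using wt_add[of m "p - m - q"] by (simp add: algebra_simps)
  then have "wt (p - q) ^ s \<le> (wt m * wt (p - m - q)) ^ s"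
    by (intro power_mono) auto
  then have "wt (p - q) ^ s * norm (cocycle \<theta> m (p - m) * coeff a m * coeff b (p - m))
      \<le> (wt m * wt (p - m - q)) ^ s * norm (cocycle \<theta> m (p - m) * coeff a m * coeff b (p - m))"
    by (rule mult_right_mono) simp
  also have "\<dots> = (wt m ^ s * norm (coeff a m)) * (wt (p - m - q) ^ s * norm (coeff b (p - m)))"
    by (simp add: norm_mult power_mult_distrib)
  also have "\<dots> \<le> (A * (1 / wt m ^ 4)) * B"
  proof (rule mult_mono)
    show A': "wt m ^ s * norm (coeff a m) \<le> A * (1 / wt m ^ 4)"
      using A[of m] by (simp add: field_simps power_add)
    show "0 \<le> A * (1 / wt m ^ 4)"
      by (rule order_trans[OF _ A']) simp
  qed (use B in auto)
  finally show ?thesis by (simp add: algebra_simps)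
qed

lemma tmult_abs_summable:
  "(\<lambda>m. norm (cocycle \<theta> m (p - m) * coeff a m * coeff b (p - m))) summable_on UNIV"
proof -
  obtain A where A: "0 \<le> A" "\<And>m. wt m ^ (0 + 4) * norm (coeff a m) \<le> A" by (rule coeff_decay[where s = "0 + 4" and a = a]) blast
  obtain B where B: "0 \<le> B" "\<And>m. wt m ^ 0 * norm (coeff b m) \<le> B" by (rule coeff_decay[where s = "0" and a = b]) blast
  have "(\<lambda>m. A * B * (1 / wt m ^ 4)) summable_on UNIV"
    using wt_summable by (rule summable_on_cmult_right)
  then show ?thesis
    by (rule summable_on_comparison_test)
       (use tmult_term_bound[where s = 0 and a = a and b = b and q = 0, OF A(2)] B in auto)
qed

lemmas tmult_summable = abs_summable_summable[OF tmult_abs_summable]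

lemma tmult_bound:
  assumes A: "\<And>m. wt m ^ (s + 4) * norm (coeff a m) \<le> A"
    and B: "\<And>p. wt (p - q) ^ s * norm (coeff b p) \<le> B"
  shows "wt (p - q) ^ s * norm (coeff (tmult \<theta> a b) p) \<le> A * (\<Sum>\<^sub>\<infinity>m. 1 / wt m ^ 4) * B"
proof -
  let ?f = "\<lambda>m. cocycle \<theta> m (p - m) * coeff a m * coeff b (p - m)"
  have "wt (p - q) ^ s * norm (coeff (tmult \<theta> a b) p) \<le> wt (p - q) ^ s * (\<Sum>\<^sub>\<infinity>m. norm (?f m))"
    unfolding tmult.rep_eq by (intro mult_left_mono norm_infsum_bound tmult_abs_summable) simp
  also have "\<dots> = (\<Sum>\<^sub>\<infinity>m. wt (p - q) ^ s * norm (?f m))"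
    by (rule infsum_cmult_right'[symmetric])
  also have "\<dots> \<le> (\<Sum>\<^sub>\<infinity>m. A * B * (1 / wt m ^ 4))"
    using tmult_term_bound[OF A B] tmult_abs_summable wt_summable
    by (intro infsum_mono summable_on_cmult_right) auto
  also have "\<dots> = A * (\<Sum>\<^sub>\<infinity>m. 1 / wt m ^ 4) * B"
    by (subst infsum_cmult_right') simp
  finally show ?thesis .
qed

section \<open>Continuous operators\<close>

definition linear_op :: "(nct \<Rightarrow> nct) \<Rightarrow> bool" where
  "linear_op P \<longleftrightarrow> (\<forall>x y. P (x + y) = P x + P y) \<and> (\<forall>c x. P (cscale c x) = cscale c (P x))"

lemma linear_opI:
  "(\<And>x y. P (x + y) = P x + P y) \<Longrightarrow> (\<And>c x. P (cscale c x) = cscale c (P x)) \<Longrightarrow> linear_op P"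
  by (simp add: linear_op_def)

lemma
  assumes "linear_op P"
  shows linear_op_add: "P (x + y) = P x + P y"
    and linear_op_scale: "P (cscale c x) = cscale c (P x)"
    and linear_op_0: "P 0 = 0"
    and linear_op_diff: "P (x - y) = P x - P y"
    and linear_op_sum: "P (sum f S) = (\<Sum>i\<in>S. P (f i))"
proof -
  show add: "P (x + y) = P x + P y" and scale: "P (cscale c x) = cscale c (P x)" for x y c
    using assms by (auto simp: linear_op_def)
  show 0: "P 0 = 0"
    using scale[of 0 0] by simp
  show "P (x - y) = P x - P y"
    using add[of x "- y"] scale[of "-1" y] by (simp add: cscale_minus_one)
  show "P (sum f S) = (\<Sum>i\<in>S. P (f i))"
    by (induction S rule: infinite_finite_induct) (auto simp: 0 add)
qed

lemma linear_op_comp: "linear_op P \<Longrightarrow> linear_op Q \<Longrightarrow> linear_op (\<lambda>\<psi>. P (Q \<psi>))"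
  by (simp add: linear_op_def)

text \<open>
  The weights are centred at an arbitrary lattice point, and the bound does not depend on it.
  Centred at the index of the argument \<open>U\<^sub>n\<close>, they measure the decay of the matrix
  of \<open>P\<close> away from the diagonal, so the same notion gives continuity and keeps track of
  remainders in symbol expansions.
\<close>

definition local_op :: "(nct \<Rightarrow> nct) \<Rightarrow> bool" where
  "local_op P \<longleftrightarrow> linear_op P \<and> (\<forall>s. \<exists>C\<ge>0. \<forall>q B b. (\<forall>p. wt (p - q) ^ s * norm (coeff b p) \<le> B) \<longrightarrow>
     (\<forall>p. wt (p - q) ^ s * norm (coeff (P b) p) \<le> C * B))"

definition continuous_op :: "(nct \<Rightarrow> nct) \<Rightarrow> bool" where
  "continuous_op P \<longleftrightarrow> linear_op P \<and> (\<forall>s. \<exists>C M. 0 \<le> C \<and> (\<forall>B b. (\<forall>p. wt p ^ M * norm (coeff b p) \<le> B) \<longrightarrow>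
     (\<forall>p. wt p ^ s * norm (coeff (P b) p) \<le> C * B)))"

lemma local_op_linear: "local_op P \<Longrightarrow> linear_op P"
  and continuous_op_linear: "continuous_op P \<Longrightarrow> linear_op P"
  by (simp_all add: local_op_def continuous_op_def)

lemma local_opE:
  assumes "local_op P"
  obtains C where "0 \<le> C" "\<And>q B b p. (\<And>p. wt (p - q) ^ s * norm (coeff b p) \<le> B) \<Longrightarrow>
     wt (p - q) ^ s * norm (coeff (P b) p) \<le> C * B"
  using assms unfolding local_op_def by meson

lemma continuous_opE:
  assumes "continuous_op P"
  obtains C M where "0 \<le> C" "\<And>B b p. (\<And>p. wt p ^ M * norm (coeff b p) \<le> B) \<Longrightarrow>
     wt p ^ s * norm (coeff (P b) p) \<le> C * B"
  using assms unfolding continuous_op_def by meson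

lemma local_opI:
  assumes "linear_op P"
    and "\<And>s. \<exists>C\<ge>0. \<forall>q B b. (\<forall>p. wt (p - q) ^ s * norm (coeff b p) \<le> B) \<longrightarrow>
     (\<forall>p. wt (p - q) ^ s * norm (coeff (P b) p) \<le> C * B)"
  shows "local_op P"
  using assms by (simp add: local_op_def)

lemma continuous_opI:
  assumes "linear_op P"
    and "\<And>s. \<exists>C M. 0 \<le> C \<and> (\<forall>B b p. (\<forall>p. wt p ^ M * norm (coeff b p) \<le> B) \<longrightarrow>
     wt p ^ s * norm (coeff (P b) p) \<le> C * B)"
  shows "continuous_op P"
  unfolding continuous_op_def using assms by meson

lemma local_op_continuous:
  assumes "local_op P" shows "continuous_op P"
proof (rule continuous_opI, goal_cases)
  case (2 s)
  obtain C where "0 \<le> C" "\<And>q B b p. (\<And>p. wt (p - q) ^ s * norm (coeff b p) \<le> B) \<Longrightarrow>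
     wt (p - q) ^ s * norm (coeff (P b) p) \<le> C * B"
    by (rule local_opE[OF assms, where s = s]) blast
  from this(1) this(2)[of 0] show ?case
    by (intro exI[of _ C] exI[of _ s]) auto
qed (use assms local_op_linear in auto)

lemma continuous_op_comp:
  assumes "continuous_op P" "continuous_op Q" shows "continuous_op (\<lambda>\<psi>. P (Q \<psi>))"
proof (rule continuous_opI, goal_cases)
  case (2 s)
  obtain C M where P: "0 \<le> C" "\<And>B b p. (\<And>p. wt p ^ M * norm (coeff b p) \<le> B) \<Longrightarrow>
     wt p ^ s * norm (coeff (P b) p) \<le> C * B"
    by (rule continuous_opE[OF assms(1), where s = s]) blast
  obtain D L where Q: "0 \<le> D" "\<And>B b p. (\<And>p. wt p ^ L * norm (coeff b p) \<le> B) \<Longrightarrow>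
     wt p ^ M * norm (coeff (Q b) p) \<le> D * B"
    by (rule continuous_opE[OF assms(2), where s = M]) blast
  show ?case
    using P Q by (intro exI[of _ "C * D"] exI[of _ L]) (auto simp: mult.assoc)
qed (use assms continuous_op_linear linear_op_comp in auto)

lemma local_op_comp:
  assumes "local_op P" "local_op Q" shows "local_op (\<lambda>\<psi>. P (Q \<psi>))"
proof (rule local_opI, goal_cases)
  case (2 s)
  obtain C where P: "0 \<le> C" "\<And>q B b p. (\<And>p. wt (p - q) ^ s * norm (coeff b p) \<le> B) \<Longrightarrow>
     wt (p - q) ^ s * norm (coeff (P b) p) \<le> C * B"
    by (rule local_opE[OF assms(1), where s = s]) blast
  obtain D where Q: "0 \<le> D" "\<And>q B b p. (\<And>p. wt (p - q) ^ s * norm (coeff b p) \<le> B) \<Longrightarrow>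
     wt (p - q) ^ s * norm (coeff (Q b) p) \<le> D * B"
    by (rule local_opE[OF assms(2), where s = s]) blast
  show ?case
    using P Q by (intro exI[of _ "C * D"]) (auto simp: mult.assoc)
qed (use assms local_op_linear linear_op_comp in auto)

lemma local_op_add:
  assumes "local_op P" "local_op Q" shows "local_op (\<lambda>\<psi>. P \<psi> + Q \<psi>)"
proof (rule local_opI, goal_cases)
  show "linear_op (\<lambda>\<psi>. P \<psi> + Q \<psi>)"
    using assms[THEN local_op_linear]
    by (intro linear_opI) (auto simp: linear_op_add linear_op_scale cscale_add_right)
  case (2 s)
  obtain C where P: "0 \<le> C" "\<And>q B b p. (\<And>p. wt (p - q) ^ s * norm (coeff b p) \<le> B) \<Longrightarrow>
     wt (p - q) ^ s * norm (coeff (P b) p) \<le> C * B"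
    by (rule local_opE[OF assms(1), where s = s]) blast
  obtain D where Q: "0 \<le> D" "\<And>q B b p. (\<And>p. wt (p - q) ^ s * norm (coeff b p) \<le> B) \<Longrightarrow>
     wt (p - q) ^ s * norm (coeff (Q b) p) \<le> D * B"
    by (rule local_opE[OF assms(2), where s = s]) blast
  have "wt (p - q) ^ s * norm (coeff (P b + Q b) p) \<le> (C + D) * B"
    if "\<And>p. wt (p - q) ^ s * norm (coeff b p) \<le> B" for q B b p
  proof -
    have "wt (p - q) ^ s * norm (coeff (P b + Q b) p)
       \<le> wt (p - q) ^ s * (norm (coeff (P b) p) + norm (coeff (Q b) p))"
      by (intro mult_left_mono) (auto simp: norm_triangle_ineq)
    with P(2)[OF that, of p] Q(2)[OF that, of p] show ?thesis
      by (simp add: algebra_simps)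
  qed
  with P(1) Q(1) show ?case
    by (intro exI[of _ "C + D"]) auto
qed

lemma continuous_op_add:
  assumes "continuous_op P" "continuous_op Q" shows "continuous_op (\<lambda>\<psi>. P \<psi> + Q \<psi>)"
proof (rule continuous_opI, goal_cases)
  show "linear_op (\<lambda>\<psi>. P \<psi> + Q \<psi>)"
    using assms[THEN continuous_op_linear]
    by (intro linear_opI) (auto simp: linear_op_add linear_op_scale cscale_add_right)
  case (2 s)
  obtain C M where P: "0 \<le> C" "\<And>B b p. (\<And>p. wt p ^ M * norm (coeff b p) \<le> B) \<Longrightarrow>
     wt p ^ s * norm (coeff (P b) p) \<le> C * B"
    by (rule continuous_opE[OF assms(1), where s = s]) blast
  obtain D L where Q: "0 \<le> D" "\<And>B b p. (\<And>p. wt p ^ L * norm (coeff b p) \<le> B) \<Longrightarrow>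
     wt p ^ s * norm (coeff (Q b) p) \<le> D * B"
    by (rule continuous_opE[OF assms(2), where s = s]) blast
  have "wt p ^ s * norm (coeff (P b + Q b) p) \<le> (C + D) * B"
    if *: "\<And>p. wt p ^ (M + L) * norm (coeff b p) \<le> B" for B b p
  proof -
    have "wt p ^ M * norm (coeff b p) \<le> wt p ^ (M + L) * norm (coeff b p)"
      "wt p ^ L * norm (coeff b p) \<le> wt p ^ (M + L) * norm (coeff b p)" for p
      using wt_ge_1[of p] by (auto intro!: mult_right_mono power_increasing)
    then have M: "wt p ^ M * norm (coeff b p) \<le> B" and L: "wt p ^ L * norm (coeff b p) \<le> B" for p
      using * by (meson order_trans)+
    have "wt p ^ s * norm (coeff (P b + Q b) p)
       \<le> wt p ^ s * (norm (coeff (P b) p) + norm (coeff (Q b) p))"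
      by (intro mult_left_mono) (auto simp: norm_triangle_ineq)
    with P(2)[OF M, of p] Q(2)[OF L, of p] show ?thesis
      by (simp add: algebra_simps)
  qed
  with P(1) Q(1) show ?case
    by (intro exI[of _ "C + D"] exI[of _ "M + L"]) auto
qed

lemma finite_wt_le: "finite {n. wt n \<le> R}"
proof -
  have "{n. wt n \<le> R} \<subseteq> (\<lambda>(i, j). vector [i, j]) ` ({-\<lceil>R\<rceil>..\<lceil>R\<rceil>} \<times> {-\<lceil>R\<rceil>..\<lceil>R\<rceil>})"
  proof
    fix n :: "int^2" assume "n \<in> {n. wt n \<le> R}"
    then have "\<bar>real_of_int (n $ a)\<bar> \<le> R" for a
      using component_le_norm_cart[of "emb n" a] by (simp add: wt_def emb_def)
    then have "n $ a \<in> {-\<lceil>R\<rceil>..\<lceil>R\<rceil>}" for a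
      using abs_le_D1[of "real_of_int (n $ a)" R] abs_le_D2[of "real_of_int (n $ a)" R]
      by (auto simp: le_ceiling_iff) linarith+
    moreover have "n = vector [n $ 1, n $ 2]"
      by (simp add: vec_eq_iff forall_2)
    ultimately show "n \<in> (\<lambda>(i, j). vector [i, j]) ` ({-\<lceil>R\<rceil>..\<lceil>R\<rceil>} \<times> {-\<lceil>R\<rceil>..\<lceil>R\<rceil>})"
      by (intro image_eqI[of _ _ "(n $ 1, n $ 2)"]) auto
  qed
  then show ?thesis by (rule finite_subset) auto
qed

text \<open>Cutting \<open>\<psi>\<close> off outside a large ball is small in every seminorm, at the price of one more power of
  the weight. So the \<open>U\<^sub>n\<close> span a dense subspace, and an operator is given by its matrix.\<close>

lemma continuous_op_has_sum:
  assumes P: "continuous_op P"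
  shows "((\<lambda>n. coeff \<psi> n * coeff (P (U n)) p) has_sum coeff (P \<psi>) p) UNIV"
  unfolding has_sum_def
proof (rule tendstoI)
  note lin = continuous_op_linear[OF P]
  fix e :: real assume e: "0 < e"
  obtain C M where C: "0 \<le> C" "\<And>B b p. (\<And>p. wt p ^ M * norm (coeff b p) \<le> B) \<Longrightarrow>
     wt p ^ 0 * norm (coeff (P b) p) \<le> C * B"
    by (rule continuous_opE[OF P, where s = 0]) blast
  obtain D where D: "0 \<le> D" "\<And>n. wt n ^ Suc M * norm (coeff \<psi> n) \<le> D"
    by (rule coeff_decay[where s = "Suc M" and a = \<psi>]) blast
  \<comment> \<open>outside the ball of radius \<open>R\<close> the spare power of the weight is worth a factor \<open>1/R\<close>\<close>
  define R where "R = C * D / e + 1"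
  have R: "0 < R" "C * (D / R) < e"
    using C D e by (auto simp: R_def field_simps add_pos_nonneg)
  have "dist (\<Sum>n\<in>F. coeff \<psi> n * coeff (P (U n)) p) (coeff (P \<psi>) p) < e"
    if F: "finite F" "{n. wt n \<le> R} \<subseteq> F" for F
  proof -
    define \<phi> where "\<phi> = \<psi> - (\<Sum>n\<in>F. cscale (coeff \<psi> n) (U n))"
    have \<phi>: "coeff \<phi> q = (if q \<in> F then 0 else coeff \<psi> q)" for q
      using F(1) by (simp add: \<phi>_def if_distrib cong: if_cong)
    have "wt q ^ M * norm (coeff \<phi> q) \<le> D / R" for q
    proof (cases "q \<in> F")
      case False
      then have "R \<le> wt q" using F(2) by force
      then have "wt q ^ M * norm (coeff \<psi> q) * R \<le> wt q ^ M * norm (coeff \<psi> q) * wt q"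
        by (intro mult_left_mono) auto
      also have "\<dots> \<le> D"
        using D(2)[of q] by (simp add: mult_ac)
      finally show ?thesis using False R(1) by (simp add: \<phi> pos_le_divide_eq)
    qed (use D R in \<open>auto simp: \<phi>\<close>)
    from C(2)[OF this, of p] have "norm (coeff (P \<phi>) p) < e"
      using R(2) by simp
    moreover have "coeff (P \<phi>) p = coeff (P \<psi>) p - (\<Sum>n\<in>F. coeff \<psi> n * coeff (P (U n)) p)"
      by (simp add: \<phi>_def linear_op_diff[OF lin] linear_op_sum[OF lin] linear_op_scale[OF lin])
    ultimately show ?thesis
      by (simp add: dist_norm norm_minus_commute)
  qed
  then show "\<forall>\<^sub>F F in finite_subsets_at_top UNIV.
      dist (\<Sum>n\<in>F. coeff \<psi> n * coeff (P (U n)) p) (coeff (P \<psi>) p) < e"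
    by (intro eventually_finite_subsets_at_top[THEN iffD2] exI[of _ "{n. wt n \<le> R}"])
       (use finite_wt_le in auto)
qed

lemma continuous_op_eqI:
  assumes "continuous_op P" "continuous_op Q" "\<And>n. P (U n) = Q (U n)"
  shows "P \<psi> = Q \<psi>"
proof (rule nct_eqI)
  fix p
  show "coeff (P \<psi>) p = coeff (Q \<psi>) p"
    using continuous_op_has_sum[OF assms(1), of \<psi> p] continuous_op_has_sum[OF assms(2), of \<psi> p]
    by (simp add: assms(3) has_sum_unique)
qed

section \<open>Left and right multiplication\<close>

text \<open>Reversing the order of a product amounts to replacing \<open>\<theta>\<close> by \<open>-\<theta>\<close>, so right multiplications
  inherit all properties of left multiplications.\<close>

lemma Rmul_eq_Lmul: "Rmul \<theta> b = Lmul (- \<theta>) b"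
proof (rule ext, rule nct_eqI)
  fix \<psi> n
  have "(\<Sum>\<^sub>\<infinity>m. cocycle \<theta> m (n - m) * coeff \<psi> m * coeff b (n - m))
      = (\<Sum>\<^sub>\<infinity>m. cocycle \<theta> (n - m) (n - (n - m)) * coeff \<psi> (n - m) * coeff b (n - (n - m)))"
    by (rule infsum_reindex_bij_betw[symmetric, where g = "\<lambda>m. n - m"])
       (rule bij_betwI[where g = "\<lambda>m. n - m"]; simp)
  also have "\<dots> = (\<Sum>\<^sub>\<infinity>m. cocycle (- \<theta>) m (n - m) * coeff b m * coeff \<psi> (n - m))"
    by (rule infsum_cong) (simp add: cocycle_def algebra_simps)
  finally show "coeff (Rmul \<theta> b \<psi>) n = coeff (Lmul (- \<theta>) b \<psi>) n"
    by (simp add: Rmul_def Lmul_def tmult.rep_eq)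
qed

lemma local_op_Lmul: "local_op (Lmul \<theta> a)"
proof (rule local_opI, goal_cases)
  show "linear_op (Lmul \<theta> a)"
  proof (intro linear_opI nct_eqI; unfold Lmul_def)
    fix x y n
    show "coeff (tmult \<theta> a (x + y)) n = coeff (tmult \<theta> a x + tmult \<theta> a y) n"
      by (simp add: tmult.rep_eq distrib_left infsum_add tmult_summable)
  next
    fix c x n
    have "coeff (tmult \<theta> a (cscale c x)) n = (\<Sum>\<^sub>\<infinity>m. c * (cocycle \<theta> m (n - m) * coeff a m * coeff x (n - m)))"
      by (simp add: tmult.rep_eq mult_ac)
    then show "coeff (tmult \<theta> a (cscale c x)) n = coeff (cscale c (tmult \<theta> a x)) n"
      by (simp add: infsum_cmult_right' tmult.rep_eq)
  qed
  case (2 s)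
  obtain A where A: "0 \<le> A" "\<And>m. wt m ^ (s + 4) * norm (coeff a m) \<le> A"
    by (rule coeff_decay[where s = "s + 4" and a = a]) blast
  show ?case
    unfolding Lmul_def
    using A(1) tmult_bound[OF A(2)]
    by (intro exI[of _ "A * (\<Sum>\<^sub>\<infinity>m. 1 / wt m ^ 4)"]) (auto intro!: mult_nonneg_nonneg infsum_nonneg)
qed

lemma local_op_Rmul: "local_op (Rmul \<theta> b)"
  by (simp add: Rmul_eq_Lmul local_op_Lmul)

lemmas linear_Lmul = local_op_linear[OF local_op_Lmul]
lemmas linear_Rmul = local_op_linear[OF local_op_Rmul]

lemma Lmul_add: "Lmul \<theta> (a + b) \<psi> = Lmul \<theta> a \<psi> + Lmul \<theta> b \<psi>"
  using linear_op_add[OF linear_Rmul, of \<theta> \<psi> a b] by (simp add: Rmul_def Lmul_def)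

lemma Lmul_scale: "Lmul \<theta> (cscale c a) \<psi> = cscale c (Lmul \<theta> a \<psi>)"
  using linear_op_scale[OF linear_Rmul, of \<theta> \<psi> c a] by (simp add: Rmul_def Lmul_def)

lemma cocycle_assoc:
  "cocycle \<theta> l m * cocycle \<theta> (l + m) n = cocycle \<theta> m n * cocycle \<theta> l (m + n)"
  by (simp add: cocycle_def cis_mult algebra_simps)

text \<open>Both sides are continuous in each of the three factors, so it is enough to compare them on
  the \<open>U\<^sub>n\<close>, where associativity is the cocycle identity.\<close>

lemma tmult_assoc: "tmult \<theta> (tmult \<theta> a b) c = tmult \<theta> a (tmult \<theta> b c)"
proof -
  note cont = continuous_op_comp[OF local_op_continuous local_op_continuous]
  note loc = local_op_continuous[OF local_op_Lmul] local_op_continuous[OF local_op_Rmul]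
  have 1: "tmult \<theta> (tmult \<theta> (U l) (U m)) (U n) = tmult \<theta> (U l) (tmult \<theta> (U m) (U n))" for l m n
    using linear_op_scale[OF linear_Lmul, of \<theta> "U l"] Lmul_scale[of \<theta> _ _ "U n"]
    by (simp add: tmult_U Lmul_def cocycle_assoc add.assoc)
  have 2: "tmult \<theta> (tmult \<theta> a (U m)) (U n) = tmult \<theta> a (tmult \<theta> (U m) (U n))" for a m n
    using continuous_op_eqI[OF cont[OF local_op_Rmul local_op_Rmul] loc(2),
        of \<theta> "U n" \<theta> "U m" \<theta> "tmult \<theta> (U m) (U n)" a] 1
    by (simp add: Rmul_def)
  have 3: "tmult \<theta> (tmult \<theta> a b) (U n) = tmult \<theta> a (tmult \<theta> b (U n))" for a b n
    using continuous_op_eqI[OF cont[OF local_op_Rmul local_op_Lmul] cont[OF local_op_Lmul local_op_Rmul],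
        of \<theta> "U n" \<theta> a \<theta> a \<theta> "U n" b] 2
    by (simp add: Rmul_def Lmul_def)
  show ?thesis
    using continuous_op_eqI[OF loc(1) cont[OF local_op_Lmul local_op_Lmul],
        of \<theta> "tmult \<theta> a b" \<theta> a \<theta> b c] 3
    by (simp add: Lmul_def)
qed

lemma tmult_unit [simp]: "tmult \<theta> (U 0) a = a" "tmult \<theta> a (U 0) = a"
proof -
  have id: "continuous_op (\<lambda>\<psi>. \<psi>)"

  proof (rule continuous_opI)
    show "\<exists>C M. 0 \<le> C \<and> (\<forall>B b p. (\<forall>p. wt p ^ M * norm (coeff b p) \<le> B) \<longrightarrow>
        wt p ^ s * norm (coeff b p) \<le> C * B)" for s
      by (intro exI[of _ 1] exI[of _ s]) auto
  qed (simp add: linear_op_def)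
  show "tmult \<theta> (U 0) a = a"
    using continuous_op_eqI[OF local_op_continuous[OF local_op_Lmul] id, of \<theta> "U 0" a]
    by (simp add: Lmul_def tmult_U cocycle_def)
  show "tmult \<theta> a (U 0) = a"
    using continuous_op_eqI[OF local_op_continuous[OF local_op_Rmul] id, of \<theta> "U 0" a]
    by (simp add: Rmul_def tmult_U cocycle_def)
qed

lemma Lmul_Lmul: "Lmul \<theta> a (Lmul \<theta> b \<psi>) = Lmul \<theta> (tmult \<theta> a b) \<psi>"
  and Rmul_Rmul: "Rmul \<theta> a (Rmul \<theta> b \<psi>) = Rmul \<theta> (tmult \<theta> b a) \<psi>"
  and Rmul_Lmul: "Rmul \<theta> b (Lmul \<theta> a \<psi>) = Lmul \<theta> a (Rmul \<theta> b \<psi>)"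
  by (simp_all add: Lmul_def Rmul_def tmult_assoc)

section \<open>The Cauchy--Riemann derivations and their inverses\<close>

definition zeta :: "complex \<Rightarrow> real^2 \<Rightarrow> complex" where
  "zeta e \<xi> = of_real (\<xi> $ 2) + e * of_real (\<xi> $ 1)"

lemma zeta_add: "zeta e (\<xi> + \<eta>) = zeta e \<xi> + zeta e \<eta>"
  and zeta_scaleR: "zeta e (r *\<^sub>R \<xi>) = of_real r * zeta e \<xi>"
  and zeta_0 [simp]: "zeta e 0 = 0"
  by (simp_all add: zeta_def algebra_simps)

lemma emb_add: "emb (m + n) = emb m + emb n" and emb_diff: "emb (m - n) = emb m - emb n"
  and emb_0 [simp]: "emb 0 = 0"
  by (simp_all add: emb_def vec_eq_iff)

lemma zeta_emb_diff: "zeta e (emb p) = zeta e (emb n) + zeta e (emb (p - n))"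
  by (simp flip: zeta_add emb_add)

lemma norm_zeta: assumes "e \<in> {\<i>, -\<i>}" shows "norm (zeta e \<xi>) = norm \<xi>"
proof -
  have "norm (zeta e \<xi>) = sqrt ((\<xi> $ 1)\<^sup>2 + (\<xi> $ 2)\<^sup>2)"
    using assms by (auto simp: zeta_def cmod_def)
  then show ?thesis by (simp add: norm_vec_def L2_set_def sum_2)
qed

lemma zeta_eq_0_iff: "e \<in> {\<i>, -\<i>} \<Longrightarrow> zeta e \<xi> = 0 \<longleftrightarrow> \<xi> = 0"
  by (metis norm_zeta norm_eq_zero)

lemma norm_emb_ge_1: assumes "n \<noteq> 0" shows "1 \<le> norm (emb n)"
proof -
  obtain a where "n $ a \<noteq> 0" using assms by (auto simp: vec_eq_iff)
  then have "1 \<le> \<bar>real_of_int (n $ a)\<bar>" by linarith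
  also have "\<dots> \<le> norm (emb n)"
    using component_le_norm_cart[of "emb n" a] by (simp add: emb_def)
  finally show ?thesis .
qed

lemma emb_eq_0_iff [simp]: "emb n = 0 \<longleftrightarrow> n = 0"
  using norm_emb_ge_1[of n] by fastforce

text \<open>For \<open>e = \<i>\<close> and \<open>e = -\<i>\<close> these are the two entries of the flat Dirac operator.\<close>

definition dz :: "complex \<Rightarrow> nct \<Rightarrow> nct" where
  "dz e \<psi> = delta 2 \<psi> + cscale e (delta 1 \<psi>)"

lemma coeff_dz: "coeff (dz e \<psi>) n = zeta e (emb n) * coeff \<psi> n"
  by (simp add: dz_def zeta_def emb_def algebra_simps)

lemma norm_divide_le: "1 \<le> norm z \<Longrightarrow> norm (a / z) \<le> norm a" for a z :: complex
  using divide_left_mono[of 1 "norm z" "norm a"] by (cases "z = 0") (auto simp: norm_divide)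

text \<open>For \<open>e = \<plusminus>\<i>\<close> the values of \<open>zeta e\<close> on the lattice are Gaussian integers, so that the case
  distinction only excludes the value \<open>0\<close>. For other \<open>e\<close> it keeps the sequence rapidly decreasing.\<close>

lift_definition zinv :: "complex \<Rightarrow> nct \<Rightarrow> nct" is
  "\<lambda>e a n. if 1 \<le> norm (zeta e (emb n)) then a n / zeta e (emb n) else 0"
proof -
  fix e and a :: "int^2 \<Rightarrow> complex" and s :: nat
  assume "\<And>s. \<exists>C. \<forall>n. wt n ^ s * norm (a n) \<le> C"
  then obtain C where C: "\<And>n. wt n ^ s * norm (a n) \<le> C" by meson
  have "wt n ^ s * norm (if 1 \<le> norm (zeta e (emb n)) then a n / zeta e (emb n) else 0) \<le> C" for n
  proof -
    have "norm (if 1 \<le> norm (zeta e (emb n)) then a n / zeta e (emb n) else 0) \<le> norm (a n)"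
      by (simp add: norm_divide_le)
    then have "wt n ^ s * norm (if 1 \<le> norm (zeta e (emb n)) then a n / zeta e (emb n) else 0)
        \<le> wt n ^ s * norm (a n)"
      by (rule mult_left_mono) simp
    with C[of n] show ?thesis by linarith
  qed
  then show "\<exists>C. \<forall>n. wt n ^ s * norm (if 1 \<le> norm (zeta e (emb n)) then a n / zeta e (emb n) else 0) \<le> C"
    by blast
qed

lemma coeff_zinv:
  assumes "e \<in> {\<i>, -\<i>}" shows "coeff (zinv e \<psi>) n = coeff \<psi> n / zeta e (emb n)"
proof (cases "n = 0")
  case False
  then show ?thesis using norm_emb_ge_1[OF False] by (simp add: zinv.rep_eq norm_zeta[OF assms])
qed (simp add: zinv.rep_eq)

lemma dz_zinv:
  assumes "e \<in> {\<i>, -\<i>}" shows "dz e (zinv e \<psi>) = \<psi> - cscale (coeff \<psi> 0) (U 0)"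
  by (rule nct_eqI) (auto simp: coeff_dz coeff_zinv[OF assms] zeta_eq_0_iff[OF assms])

lemma dz_eq_0_imp:
  assumes "e \<in> {\<i>, -\<i>}" "dz e \<psi> = 0" shows "\<psi> = cscale (coeff \<psi> 0) (U 0)"
proof (rule nct_eqI)
  fix n
  have "zeta e (emb n) * coeff \<psi> n = 0"
    using assms(2) coeff_dz[of e \<psi> n] by simp
  then show "coeff \<psi> n = coeff (cscale (coeff \<psi> 0) (U 0)) n"
    by (auto simp: zeta_eq_0_iff[OF assms(1)])
qed

lemma coeff_dz_0 [simp]: "coeff (dz e \<psi>) 0 = 0"
  by (simp add: coeff_dz)

lemma dz_U: "dz e (U n) = cscale (zeta e (emb n)) (U n)"
  by (rule nct_eqI) (auto simp: coeff_dz)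

lemma linear_dz: "linear_op (dz e)"
  by (intro linear_opI nct_eqI) (auto simp: coeff_dz algebra_simps)

lemma continuous_dz: assumes "e \<in> {\<i>, -\<i>}" shows "continuous_op (dz e)"
proof (rule continuous_opI[OF linear_dz], goal_cases)
  case (1 s)
  have "wt p ^ s * norm (coeff (dz e b) p) \<le> B" if "\<And>p. wt p ^ Suc s * norm (coeff b p) \<le> B" for B b p
  proof -
    have "norm (zeta e (emb p)) * (wt p ^ s * norm (coeff b p)) \<le> wt p * (wt p ^ s * norm (coeff b p))"
      by (intro mult_right_mono) (auto simp: norm_zeta[OF assms] wt_def)
    also have "\<dots> \<le> B"
      using that[of p] by (simp add: mult.assoc)
    finally show ?thesis by (simp add: coeff_dz norm_mult mult_ac)
  qed
  then show ?case
    by (intro exI[of _ 1] exI[of _ "Suc s"]) auto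
qed

lemma local_zinv: "local_op (zinv e)"
proof (rule local_opI, goal_cases)
  show "linear_op (zinv e)"
    by (intro linear_opI nct_eqI) (auto simp: zinv.rep_eq add_divide_distrib)
  case (2 s)
  have "wt (p - q) ^ s * norm (coeff (zinv e b) p) \<le> B"
    if "\<And>p. wt (p - q) ^ s * norm (coeff b p) \<le> B" for q B b p
  proof -
    have "norm (coeff (zinv e b) p) \<le> norm (coeff b p)"
      by (simp add: zinv.rep_eq norm_divide_le)
    then have "wt (p - q) ^ s * norm (coeff (zinv e b) p) \<le> wt (p - q) ^ s * norm (coeff b p)"
      by (rule mult_left_mono) simp
    with that[of p] show ?thesis by linarith
  qed
  then show ?case
    by (intro exI[of _ 1]) auto
qed

section \<open>The algebra generated by left and right multiplications\<close>

lemma dz_tmult: "dz e (tmult \<theta> a b) = tmult \<theta> (dz e a) b + tmult \<theta> a (dz e b)"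
proof (rule nct_eqI)
  fix n
  let ?f = "\<lambda>m. cocycle \<theta> m (n - m) * coeff a m * coeff b (n - m)"
  have "coeff (dz e (tmult \<theta> a b)) n = (\<Sum>\<^sub>\<infinity>m. zeta e (emb n) * ?f m)"
    by (simp add: coeff_dz tmult.rep_eq infsum_cmult_right')
  also have "\<dots> = (\<Sum>\<^sub>\<infinity>m. cocycle \<theta> m (n - m) * coeff (dz e a) m * coeff b (n - m)
       + cocycle \<theta> m (n - m) * coeff a m * coeff (dz e b) (n - m))"
  proof (rule infsum_cong)
    fix m
    show "zeta e (emb n) * ?f m = cocycle \<theta> m (n - m) * coeff (dz e a) m * coeff b (n - m)
       + cocycle \<theta> m (n - m) * coeff a m * coeff (dz e b) (n - m)"
      using zeta_emb_diff[of e n m] by (simp add: coeff_dz algebra_simps)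
  qed
  also have "\<dots> = coeff (tmult \<theta> (dz e a) b + tmult \<theta> a (dz e b)) n"
    by (simp add: tmult.rep_eq infsum_add tmult_summable)
  finally show "coeff (dz e (tmult \<theta> a b)) n = coeff (tmult \<theta> (dz e a) b + tmult \<theta> a (dz e b)) n" .
qed

definition ad :: "complex \<Rightarrow> (nct \<Rightarrow> nct) \<Rightarrow> nct \<Rightarrow> nct" where
  "ad e X = (\<lambda>\<psi>. dz e (X \<psi>) - X (dz e \<psi>))"

lemma Ahat_Lmul: "Lmul \<theta> a \<in> Ahat \<theta>" and Ahat_Rmul: "Rmul \<theta> a \<in> Ahat \<theta>"
  by (auto intro: Ahat_A Ahat_Aop simp: Aop_def)

lemma Ahat_comp': "S \<in> Ahat \<theta> \<Longrightarrow> T \<in> Ahat \<theta> \<Longrightarrow> (\<lambda>\<psi>. S (T \<psi>)) \<in> Ahat \<theta>"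
  using Ahat_comp[of S \<theta> T] by (simp add: o_def)

lemma Ahat_zero: "(\<lambda>\<psi>. 0) \<in> Ahat \<theta>"
  using Ahat_scale[OF Ahat_Lmul, where c = 0] by simp

lemma Ahat_sum: "(\<And>i. i \<in> I \<Longrightarrow> T i \<in> Ahat \<theta>) \<Longrightarrow> (\<lambda>\<psi>. \<Sum>i\<in>I. T i \<psi>) \<in> Ahat \<theta>"
  by (induction I rule: infinite_finite_induct) (auto intro: Ahat_zero Ahat_add)

lemma local_op_scale:
  assumes "local_op P" shows "local_op (\<lambda>\<psi>. cscale c (P \<psi>))"
proof (rule local_op_comp[OF _ assms])
  have "wt (p - q) ^ s * norm (c * coeff b p) \<le> norm c * B"
    if "\<And>p. wt (p - q) ^ s * norm (coeff b p) \<le> B" for p q s B b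
    using mult_left_mono[OF that[of p], of "norm c"] by (simp add: norm_mult mult_ac)
  then show "local_op (cscale c)"
    unfolding local_op_def linear_op_def
    by (auto simp: cscale_add_right mult_ac intro!: exI[of _ "norm c"])
qed

lemma Ahat_local: "X \<in> Ahat \<theta> \<Longrightarrow> local_op X"
proof (induction rule: Ahat.induct)
  case (Ahat_comp S T)
  then show ?case by (simp add: o_def local_op_comp)
qed (auto simp: Aop_def local_op_Lmul local_op_Rmul local_op_add local_op_scale)

text \<open>The derivations extend from \<open>\<A>\<close> and \<open>\<A>\<^sup>o\<close> to the algebra they generate as commutators.\<close>

lemma Ahat_ad: "X \<in> Ahat \<theta> \<Longrightarrow> ad e X \<in> Ahat \<theta>"
proof (induction rule: Ahat.induct)
  case (Ahat_A a)
  have "ad e (Lmul \<theta> a) = Lmul \<theta> (dz e a)"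
    by (simp add: ad_def Lmul_def dz_tmult)
  then show ?case by (simp add: Ahat_Lmul)
next
  case (Ahat_Aop T)
  then obtain b where T: "T = Rmul \<theta> b" by (auto simp: Aop_def)
  have "ad e T = Rmul \<theta> (dz e b)"
    by (simp add: T ad_def Rmul_def dz_tmult)
  then show ?case by (simp add: Ahat_Rmul)
next
  case (Ahat_add S T)
  have "ad e (\<lambda>\<psi>. S \<psi> + T \<psi>) = (\<lambda>\<psi>. ad e S \<psi> + ad e T \<psi>)"
    by (auto simp: ad_def linear_op_add[OF linear_dz])
  then show ?case using Ahat_add by (simp add: Ahat.Ahat_add)
next
  case (Ahat_scale T c)
  have "ad e (\<lambda>\<psi>. cscale c (T \<psi>)) = (\<lambda>\<psi>. cscale c (ad e T \<psi>))"
    by (simp add: ad_def linear_op_scale[OF linear_dz] cscale_diff_right)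
  then show ?case using Ahat_scale by (simp add: Ahat.Ahat_scale)
next
  case (Ahat_comp S T)
  have "ad e (S \<circ> T) = (\<lambda>\<psi>. ad e S (T \<psi>) + S (ad e T \<psi>))"
    by (simp add: ad_def o_def linear_op_diff[OF local_op_linear[OF Ahat_local[OF Ahat_comp(1)]]])
  then show ?case
    using Ahat.Ahat_add[OF Ahat_comp'[OF Ahat_comp.IH(1) Ahat_comp.hyps(2)]
        Ahat_comp'[OF Ahat_comp.hyps(1) Ahat_comp.IH(2)]] by (simp only:)
qed

lemma Ahat_ad_pow: "X \<in> Ahat \<theta> \<Longrightarrow> (ad e ^^ j) X \<in> Ahat \<theta>"
  by (induction j) (auto simp: Ahat_ad)

text \<open>In the matrix of \<open>X\<close>, the derivation acts by the distance from the diagonal.\<close>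

lemma coeff_ad_U:
  assumes "linear_op X"
  shows "coeff (ad e X (U n)) p = zeta e (emb (p - n)) * coeff (X (U n)) p"
  using zeta_emb_diff[of e p n]
  by (simp add: ad_def dz_U linear_op_scale[OF assms] coeff_dz algebra_simps)

lemma coeff_ad_pow_U:
  assumes "X \<in> Ahat \<theta>"
  shows "coeff ((ad e ^^ j) X (U n)) p = zeta e (emb (p - n)) ^ j * coeff (X (U n)) p"
proof (induction j)
  case (Suc j)
  have "linear_op ((ad e ^^ j) X)"
    using Ahat_local[OF Ahat_ad_pow[OF assms]] by (rule local_op_linear)
  with Suc show ?case by (simp add: coeff_ad_U)
qed simp

section \<open>Columns of operators\<close>

text \<open>
  A family \<open>E\<close> stands for the columns \<open>E n = P U\<^sub>n\<close> of the matrix of an operator, which is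
  controlled by \<open>\<bar>n\<bar>\<close> to the power \<open>d\<close> with rapid decay away from the diagonal.
\<close>

definition cols_order :: "int \<Rightarrow> (int^2 \<Rightarrow> nct) \<Rightarrow> bool" where
  "cols_order d E \<longleftrightarrow> (\<forall>s. \<exists>C. \<forall>n p. n \<noteq> 0 \<longrightarrow>
     wt (p - n) ^ s * norm (coeff (E n) p) \<le> C * norm (emb n) powi d)"

lemma cols_orderE:
  assumes "cols_order d E"
  obtains C where "0 \<le> C" "\<And>n p. n \<noteq> 0 \<Longrightarrow> wt (p - n) ^ s * norm (coeff (E n) p) \<le> C * norm (emb n) powi d"
proof -
  obtain C where C: "\<And>n p. n \<noteq> 0 \<Longrightarrow> wt (p - n) ^ s * norm (coeff (E n) p) \<le> C * norm (emb n) powi d"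
    using assms unfolding cols_order_def by meson
  have "C * norm (emb n) powi d \<le> \<bar>C\<bar> * norm (emb n) powi d" for n
    by (intro mult_right_mono) auto
  with C have "n \<noteq> 0 \<Longrightarrow> wt (p - n) ^ s * norm (coeff (E n) p) \<le> \<bar>C\<bar> * norm (emb n) powi d" for n p
    using order_trans by blast
  then show ?thesis using that[of "\<bar>C\<bar>"] by simp
qed

lemma cols_orderI:
  assumes "\<And>s. \<exists>C. \<forall>n p. n \<noteq> 0 \<longrightarrow> wt (p - n) ^ s * norm (coeff (E n) p) \<le> C * norm (emb n) powi d"
  shows "cols_order d E"
  using assms by (simp add: cols_order_def)

lemma cols_order_cong:
  "cols_order d E \<Longrightarrow> (\<And>n. n \<noteq> 0 \<Longrightarrow> E n = F n) \<Longrightarrow> cols_order d F"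
  by (simp add: cols_order_def)

lemma cols_order_mono:
  assumes "cols_order d E" "d \<le> d'" shows "cols_order d' E"
proof (rule cols_orderI, goal_cases)
  case (1 s)
  obtain C where C: "0 \<le> C" "\<And>n p. n \<noteq> 0 \<Longrightarrow> wt (p - n) ^ s * norm (coeff (E n) p) \<le> C * norm (emb n) powi d"
    by (rule cols_orderE[OF assms(1), where s = s]) blast
  have "C * norm (emb n) powi d \<le> C * norm (emb n) powi d'" if "n \<noteq> 0" for n
    using C(1) assms(2) norm_emb_ge_1[OF that] by (intro mult_left_mono power_int_increasing) auto
  then show ?case
    using C(2) by (meson order_trans)
qed

lemma cols_order_0: "cols_order d (\<lambda>n. 0)"
  by (auto intro!: cols_orderI exI[of _ 0])

lemma cols_order_add:
  assumes "cols_order d E" "cols_order d F" shows "cols_order d (\<lambda>n. E n + F n)"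
proof (rule cols_orderI, goal_cases)
  case (1 s)
  obtain C where C: "0 \<le> C" "\<And>n p. n \<noteq> 0 \<Longrightarrow> wt (p - n) ^ s * norm (coeff (E n) p) \<le> C * norm (emb n) powi d"
    by (rule cols_orderE[OF assms(1), where s = s]) blast
  obtain D where D: "0 \<le> D" "\<And>n p. n \<noteq> 0 \<Longrightarrow> wt (p - n) ^ s * norm (coeff (F n) p) \<le> D * norm (emb n) powi d"
    by (rule cols_orderE[OF assms(2), where s = s]) blast
  have "wt (p - n) ^ s * norm (coeff (E n + F n) p) \<le> (C + D) * norm (emb n) powi d" if "n \<noteq> 0" for n p
  proof -
    have "wt (p - n) ^ s * norm (coeff (E n + F n) p)
      \<le> wt (p - n) ^ s * (norm (coeff (E n) p) + norm (coeff (F n) p))"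
      by (intro mult_left_mono) (auto simp: norm_triangle_ineq)
    with C(2)[OF that, of p] D(2)[OF that, of p] show ?thesis by (simp add: algebra_simps)
  qed
  then show ?case
    by blast
qed

lemma cols_order_sum:
  "(\<And>i. i \<in> I \<Longrightarrow> cols_order d (E i)) \<Longrightarrow> cols_order d (\<lambda>n. \<Sum>i\<in>I. E i n)"
  by (induction I rule: infinite_finite_induct) (auto simp: cols_order_0 cols_order_add)

lemma cols_order_scale:
  assumes E: "cols_order d E" and g: "\<And>n. n \<noteq> 0 \<Longrightarrow> norm (g n) \<le> B * norm (emb n) powi d'"
  shows "cols_order (d + d') (\<lambda>n. cscale (g n) (E n))"
proof (rule cols_orderI, goal_cases)
  case (1 s)
  obtain C where C: "0 \<le> C" "\<And>n p. n \<noteq> 0 \<Longrightarrow> wt (p - n) ^ s * norm (coeff (E n) p) \<le> C * norm (emb n) powi d"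
    by (rule cols_orderE[OF E, where s = s]) blast
  have "wt (p - n) ^ s * norm (coeff (cscale (g n) (E n)) p) \<le> B * C * norm (emb n) powi (d + d')"
    if n: "n \<noteq> 0" for n p
  proof -
    have "wt (p - n) ^ s * norm (coeff (cscale (g n) (E n)) p)
        = norm (g n) * (wt (p - n) ^ s * norm (coeff (E n) p))"
      by (simp add: norm_mult)
    also have "\<dots> \<le> (B * norm (emb n) powi d') * (C * norm (emb n) powi d)"
      by (intro mult_mono C(2) g n order_trans[OF norm_ge_zero g]) simp
    also have "\<dots> = B * C * norm (emb n) powi (d + d')"
      using n by (simp add: power_int_add)
    finally show ?thesis .
  qed
  then show ?case
    by blast
qed

lemma cols_order_local:
  assumes "local_op P" "cols_order d E" shows "cols_order d (\<lambda>n. P (E n))"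
proof (rule cols_orderI, goal_cases)
  case (1 s)
  obtain C where C: "0 \<le> C" "\<And>n p. n \<noteq> 0 \<Longrightarrow> wt (p - n) ^ s * norm (coeff (E n) p) \<le> C * norm (emb n) powi d"
    by (rule cols_orderE[OF assms(2), where s = s]) blast
  obtain D where D: "0 \<le> D" "\<And>q B b p. (\<And>p. wt (p - q) ^ s * norm (coeff b p) \<le> B) \<Longrightarrow>
     wt (p - q) ^ s * norm (coeff (P b) p) \<le> D * B"
    by (rule local_opE[OF assms(1), where s = s]) blast
  show ?case
    using D(2)[OF C(2)] by (intro exI[of _ "D * C"]) (auto simp: mult.assoc)
qed

lemma cols_order_U: "cols_order 0 U"
  by (auto intro!: cols_orderI exI[of _ 1])

lemma cols_order_dz:
  assumes e: "e \<in> {\<i>, -\<i>}" and E: "cols_order d E" shows "cols_order (d + 1) (\<lambda>n. dz e (E n))"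
proof (rule cols_orderI, goal_cases)
  case (1 s)
  obtain C where C: "0 \<le> C" "\<And>n p. n \<noteq> 0 \<Longrightarrow> wt (p - n) ^ Suc s * norm (coeff (E n) p) \<le> C * norm (emb n) powi d"
    by (rule cols_orderE[OF E, where s = "Suc s"]) blast
  have "wt (p - n) ^ s * norm (coeff (dz e (E n)) p) \<le> C * norm (emb n) powi (d + 1)" if n: "n \<noteq> 0" for n p
  proof -
    have 1: "1 \<le> norm (emb n)" using n by (rule norm_emb_ge_1)
    have "norm (emb p) \<le> norm (emb n) + norm (emb (p - n))"
      using norm_triangle_ineq[of "emb n" "emb (p - n)"] by (simp flip: emb_add)
    also have "\<dots> \<le> norm (emb n) * wt (p - n)"
      using mult_right_mono[OF 1, of "norm (emb (p - n))"] by (simp add: wt_def algebra_simps)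
    finally have "norm (emb p) * (wt (p - n) ^ s * norm (coeff (E n) p))
        \<le> (norm (emb n) * wt (p - n)) * (wt (p - n) ^ s * norm (coeff (E n) p))"
      by (rule mult_right_mono) simp
    also have "\<dots> = norm (emb n) * (wt (p - n) ^ Suc s * norm (coeff (E n) p))"
      by simp
    also have "\<dots> \<le> norm (emb n) * (C * norm (emb n) powi d)"
      using C(2)[OF n, of p] by (rule mult_left_mono) simp
    also have "\<dots> = C * norm (emb n) powi (d + 1)"
      using n by (simp add: power_int_add)
    finally show ?thesis
      by (simp add: coeff_dz norm_mult norm_zeta[OF e] mult_ac)
  qed
  then show ?case
    by blast
qed

text \<open>Off the diagonal \<open>1/\<bar>p\<bar>\<close> may be much larger than \<open>1/\<bar>n\<bar>\<close>, but by no more than a weight of \<open>p - n\<close>.\<close>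

lemma cols_order_zinv:
  assumes e: "e \<in> {\<i>, -\<i>}" and E: "cols_order d E" shows "cols_order (d - 1) (\<lambda>n. zinv e (E n))"
proof (rule cols_orderI, goal_cases)
  case (1 s)
  obtain C where C: "0 \<le> C" "\<And>n p. n \<noteq> 0 \<Longrightarrow> wt (p - n) ^ Suc s * norm (coeff (E n) p) \<le> C * norm (emb n) powi d"
    by (rule cols_orderE[OF E, where s = "Suc s"]) blast
  have "wt (p - n) ^ s * norm (coeff (zinv e (E n)) p) \<le> C * norm (emb n) powi (d - 1)" if n: "n \<noteq> 0" for n p
  proof (cases "p = 0")
    case True
    then show ?thesis using C(1) by (simp add: coeff_zinv[OF e])
  next
    case False
    then have 1: "1 \<le> norm (emb p)" by (rule norm_emb_ge_1)
    have "norm (emb n) \<le> norm (emb p) + norm (emb (p - n))"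
      using norm_triangle_ineq4[of "emb p" "emb (p - n)"] by (simp flip: emb_diff)
    also have "\<dots> \<le> norm (emb p) * wt (p - n)"
      using mult_right_mono[OF 1, of "norm (emb (p - n))"] by (simp add: wt_def algebra_simps)
    finally have "norm (emb n) * (wt (p - n) ^ s * norm (coeff (E n) p))
       \<le> (norm (emb p) * wt (p - n)) * (wt (p - n) ^ s * norm (coeff (E n) p))"
      by (rule mult_right_mono) simp
    also have "\<dots> = norm (emb p) * (wt (p - n) ^ Suc s * norm (coeff (E n) p))"
      by simp
    also have "\<dots> \<le> norm (emb p) * (C * norm (emb n) powi d)"
      using C(2)[OF n, of p] by (rule mult_left_mono) simp
    finally have "wt (p - n) ^ s * norm (coeff (E n) p) / norm (emb p) \<le> C * norm (emb n) powi d / norm (emb n)"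
      using False n by (simp add: field_simps)
    then show ?thesis
      using n by (simp add: coeff_zinv[OF e] norm_divide norm_zeta[OF e] power_int_diff)
  qed
  then show ?case
    by blast
qed

lemma powi_minus_Suc: "x powi (- 1 - int j) = inverse x ^ Suc j" for x :: "'a :: field"
proof -
  have "- 1 - int j = - int (Suc j)" by simp
  then show ?thesis by (simp only: power_int_minus power_int_of_nat power_inverse)
qed

text \<open>The second alternative for \<open>z + w\<close> is the value \<open>inverse 0 = 0\<close> of a Fourier multiplier at the
  origin; it is harmless there because \<open>w = - z\<close> is then far from the diagonal.\<close>

lemma geometric_remainder:
  fixes z w :: complex
  assumes z: "z \<noteq> 0" and zw: "z + w = 0 \<or> 1 \<le> norm (z + w)"
  shows "norm (inverse (z + w) - (\<Sum>j<M. (- 1) ^ j * z powi (- 1 - int j) * w ^ j))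
           \<le> (real M + 1) * (1 + norm w) ^ Suc M * norm z powi (- 1 - int M)"
proof -
  define v where "v = inverse z"
  define x where "x = - (w * v)"
  have "(- 1) ^ j * z powi (- 1 - int j) * w ^ j = v * x ^ j" for j
  proof -
    have "x ^ j = (- 1) ^ j * (w ^ j * v ^ j)"
      by (simp add: x_def power_minus[of "w * v"] power_mult_distrib)
    then show ?thesis by (simp add: powi_minus_Suc v_def)
  qed
  then have sum: "(\<Sum>j<M. (- 1) ^ j * z powi (- 1 - int j) * w ^ j) = v * (\<Sum>j<M. x ^ j)"
    by (simp add: sum_distrib_left)
  have rhs: "norm z powi (- 1 - int M) = norm v ^ Suc M"
    by (simp add: powi_minus_Suc v_def norm_inverse)
  have xM: "norm x ^ M \<le> (1 + norm w) ^ M * norm v ^ M"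
    by (auto simp: x_def norm_mult power_mult_distrib intro!: mult_right_mono power_mono)
  have pos: "0 \<le> (1 + norm w) ^ Suc M * norm v ^ Suc M"
    by simp
  have "norm (inverse (z + w) - v * (\<Sum>j<M. x ^ j))
      \<le> (real M + 1) * ((1 + norm w) ^ Suc M * norm v ^ Suc M)"
  proof (cases "z + w = 0")
    case True
    then have w: "w = - z" by (simp add: add_eq_0_iff)
    then have x: "x = 1" using z by (simp add: x_def v_def)
    have "norm (inverse (z + w) - v * (\<Sum>j<M. x ^ j)) = real M * (norm x ^ M * norm v)"
      by (simp add: True x norm_mult)
    also have "\<dots> \<le> real M * (((1 + norm w) ^ M * norm v ^ M) * norm v)"
      using xM by (intro mult_left_mono mult_right_mono) auto
    also have "\<dots> \<le> real M * ((1 + norm w) ^ Suc M * norm v ^ Suc M)"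
    proof -
      have "(1 + norm w) ^ M \<le> (1 + norm w) ^ Suc M"
        by (rule power_increasing) auto
      then have "(1 + norm w) ^ M * norm v ^ Suc M \<le> (1 + norm w) ^ Suc M * norm v ^ Suc M"
        by (rule mult_right_mono) simp
      then show ?thesis
        by (intro mult_left_mono) (auto simp: mult_ac)
    qed
    also have "\<dots> \<le> (real M + 1) * ((1 + norm w) ^ Suc M * norm v ^ Suc M)"
      using pos by (intro mult_right_mono) auto
    finally show ?thesis .
  next
    case False
    then have x: "1 - x = (z + w) * v" "x \<noteq> 1"
      using z by (auto simp: x_def v_def field_simps add_eq_0_iff2)
    then have geo: "(\<Sum>j<M. x ^ j) = (1 - x ^ M) / (1 - x)"
      by (simp add: sum_gp_strict)
    have iv: "inverse (z + w) = v / (1 - x)"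
      using False z by (simp add: x v_def divide_inverse)
    have "inverse (z + w) - v * (\<Sum>j<M. x ^ j) = v / (1 - x) * x ^ M"
      unfolding geo iv times_divide_eq_right diff_divide_distrib[symmetric] by (simp add: algebra_simps)
    then have "inverse (z + w) - v * (\<Sum>j<M. x ^ j) = inverse (z + w) * x ^ M"
      by (simp add: iv)
    moreover have "norm (inverse (z + w)) \<le> (1 + norm w) * norm v"
    proof -
      have 1: "1 \<le> norm (z + w)" using zw False by simp
      have "norm z \<le> norm (z + w) + norm w"
        using norm_triangle_ineq4[of "z + w" w] by simp
      also have "\<dots> \<le> norm (z + w) * (1 + norm w)"
        using mult_right_mono[OF 1, of "norm w"] by (simp add: algebra_simps)
      finally show ?thesis
        using z False by (simp add: v_def inverse_eq_divide norm_divide divide_simps) (simp add: mult_ac)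
    qed
    ultimately have "norm (inverse (z + w) - v * (\<Sum>j<M. x ^ j))
        \<le> ((1 + norm w) * norm v) * ((1 + norm w) ^ M * norm v ^ M)"
      using xM by (simp add: norm_mult norm_power mult_mono)
    also have "\<dots> = 1 * ((1 + norm w) ^ Suc M * norm v ^ Suc M)"
      by (simp add: mult_ac)
    also have "\<dots> \<le> (real M + 1) * ((1 + norm w) ^ Suc M * norm v ^ Suc M)"
      using pos by (intro mult_right_mono) auto
    finally show ?thesis .
  qed
  then show ?thesis by (simp only: sum rhs mult.assoc[of "real M + 1"])
qed

lemma cols_order_Ahat: "X \<in> Ahat \<theta> \<Longrightarrow> cols_order 0 (\<lambda>n. X (U n))"
  by (rule cols_order_local[OF Ahat_local cols_order_U])

text \<open>
  The symbol of \<open>dz\<^sup>-\<^sup>1 X\<close>. Between the modes \<open>n\<close> and \<open>p\<close> the operator \<open>ad e\<close> is multiplication by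
  the difference \<open>w\<close> of the values of \<open>zeta e\<close>, so the expansion is the geometric series of
  \<open>1 / (z + w)\<close>.
\<close>

lemma zinv_expansion:
  assumes e: "e \<in> {\<i>, -\<i>}" and X: "X \<in> Ahat \<theta>"
  shows "cols_order (- 1 - int M) (\<lambda>n. zinv e (X (U n)) -
     (\<Sum>j<M. cscale ((- 1) ^ j * zeta e (emb n) powi (- 1 - int j)) ((ad e ^^ j) X (U n))))"
    (is "cols_order _ ?E")
proof (rule cols_orderI, goal_cases)
  case (1 s)
  obtain C where C: "0 \<le> C" "\<And>n p. n \<noteq> 0 \<Longrightarrow>
      wt (p - n) ^ (s + Suc M) * norm (coeff (X (U n)) p) \<le> C * norm (emb n) powi 0"
    by (rule cols_orderE[OF cols_order_Ahat[OF X], where s = "s + Suc M"]) blast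
  have "wt (p - n) ^ s * norm (coeff (?E n) p) \<le> (real M + 1) * C * norm (emb n) powi (- 1 - int M)"
    if n: "n \<noteq> 0" for n p
  proof -
    define z w where "z = zeta e (emb n)" and "w = zeta e (emb (p - n))"
    have zw: "zeta e (emb p) = z + w"
      by (simp add: z_def w_def flip: zeta_emb_diff)
    have z: "z \<noteq> 0" using n by (simp add: z_def zeta_eq_0_iff[OF e])
    have zw1: "z + w = 0 \<or> 1 \<le> norm (z + w)"
      using norm_emb_ge_1[of p] by (cases "p = 0") (auto simp: norm_zeta[OF e] simp flip: zw)
    have nw: "1 + norm w = wt (p - n)" and nz: "norm z = norm (emb n)"
      by (auto simp: w_def z_def norm_zeta[OF e] wt_def)
    have "coeff (?E n) p = coeff (X (U n)) p *
        (inverse (z + w) - (\<Sum>j<M. (- 1) ^ j * z powi (- 1 - int j) * w ^ j))"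
      by (simp add: coeff_zinv[OF e] zw coeff_ad_pow_U[OF X] divide_inverse right_diff_distrib
          sum_distrib_left mult_ac flip: z_def w_def)
    then have "wt (p - n) ^ s * norm (coeff (?E n) p) = wt (p - n) ^ s * norm (coeff (X (U n)) p) *
        norm (inverse (z + w) - (\<Sum>j<M. (- 1) ^ j * z powi (- 1 - int j) * w ^ j))"
      by (simp only: norm_mult mult.assoc)
    also have "\<dots> \<le> wt (p - n) ^ s * norm (coeff (X (U n)) p) *
        ((real M + 1) * (1 + norm w) ^ Suc M * norm z powi (- 1 - int M))"
      by (intro mult_left_mono geometric_remainder z zw1) simp
    also have "\<dots> = (wt (p - n) ^ (s + Suc M) * norm (coeff (X (U n)) p)) *
        ((real M + 1) * norm (emb n) powi (- 1 - int M))"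
      by (simp add: nw nz power_add mult_ac)
    also have "\<dots> \<le> C * ((real M + 1) * norm (emb n) powi (- 1 - int M))"
      using C(2)[OF n, of p] by (intro mult_right_mono) auto
    finally show ?thesis by (simp add: mult_ac)
  qed
  then show ?case
    by blast
qed

definition smoothing :: "(int^2 \<Rightarrow> nct) \<Rightarrow> bool" where
  "smoothing E \<longleftrightarrow> (\<forall>d. cols_order d E)"

lemma smoothing_add: "smoothing E \<Longrightarrow> smoothing F \<Longrightarrow> smoothing (\<lambda>n. E n + F n)"
  and smoothing_local: "local_op P \<Longrightarrow> smoothing E \<Longrightarrow> smoothing (\<lambda>n. P (E n))"
  by (simp_all add: smoothing_def cols_order_add cols_order_local)

lemma smoothing_dz:
  assumes "e \<in> {\<i>, -\<i>}" "smoothing E" shows "smoothing (\<lambda>n. dz e (E n))"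
  unfolding smoothing_def
proof
  fix d
  have "cols_order (d - 1) E" using assms(2) by (simp add: smoothing_def)
  then show "cols_order d (\<lambda>n. dz e (E n))" using cols_order_dz[OF assms(1)] by fastforce
qed

text \<open>The row of index \<open>0\<close> moves away from the diagonal and is therefore rapidly decreasing. So the
  rank one operators \<open>\<psi> \<mapsto> coeff (P \<psi>) 0 x\<close> contribute nothing to symbols.\<close>

lemma smoothing_rank_one:
  assumes F: "cols_order d F" shows "smoothing (\<lambda>n. cscale (coeff (F n) 0) x)"
  unfolding smoothing_def
proof (intro allI cols_orderI, goal_cases)
  case (1 d' s)
  \<comment> \<open>\<open>L\<close> powers of the weight of \<open>-n\<close> lower the order from \<open>d\<close> to \<open>d'\<close>\<close>
  define L where "L = nat (d - d')"
  obtain C where C: "0 \<le> C" "\<And>n p. n \<noteq> 0 \<Longrightarrow> wt (p - n) ^ (s + L) * norm (coeff (F n) p) \<le> C * norm (emb n) powi d"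
    by (rule cols_orderE[OF F, where s = "s + L"]) blast
  obtain D where D: "0 \<le> D" "\<And>p. wt p ^ s * norm (coeff x p) \<le> D"
    by (rule coeff_decay[where s = s and a = x]) blast
  have "wt (p - n) ^ s * norm (coeff (cscale (coeff (F n) 0) x) p) \<le> D * C * norm (emb n) powi d'"
    if n: "n \<noteq> 0" for n p
  proof -
    have n0: "0 < norm (emb n)" using norm_emb_ge_1[OF n] by linarith
    have "wt (p - n) ^ s \<le> (wt p * wt (0 - n)) ^ s"
      using wt_triangle[of p n 0] by (intro power_mono) auto
    then have "wt (p - n) ^ s * norm (coeff (cscale (coeff (F n) 0) x) p)
        \<le> (wt p * wt (0 - n)) ^ s * norm (coeff (cscale (coeff (F n) 0) x) p)"
      by (rule mult_right_mono) simp
    also have "\<dots> = (wt p ^ s * norm (coeff x p)) * (wt (0 - n) ^ s * norm (coeff (F n) 0))"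
      by (simp add: norm_mult power_mult_distrib mult_ac)
    also have "\<dots> \<le> D * (C * norm (emb n) powi d')"
    proof (rule mult_mono)
      have "norm (emb n) ^ L \<le> wt (0 - n) ^ L"
        by (intro power_mono) (auto simp: wt_uminus, simp add: wt_def)
      then have "(wt (0 - n) ^ s * norm (coeff (F n) 0)) * norm (emb n) ^ L
          \<le> (wt (0 - n) ^ s * norm (coeff (F n) 0)) * wt (0 - n) ^ L"
        by (intro mult_left_mono) auto
      also have "\<dots> \<le> C * norm (emb n) powi d"
        using C(2)[OF n, of 0] by (simp add: power_add mult_ac)
      finally have "wt (0 - n) ^ s * norm (coeff (F n) 0) \<le> C * norm (emb n) powi (d - int L)"
        using n0 by (simp add: power_int_diff field_simps)
      also have "\<dots> \<le> C * norm (emb n) powi d'"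
        using C(1) norm_emb_ge_1[OF n] by (intro mult_left_mono power_int_increasing) (auto simp: L_def)
      finally show "wt (0 - n) ^ s * norm (coeff (F n) 0) \<le> C * norm (emb n) powi d'" .
    qed (use D in auto)
    finally show ?thesis by (simp add: mult_ac)
  qed
  then show ?case
    by blast
qed

lemma continuous_rank_one:
  assumes P: "continuous_op P" shows "continuous_op (\<lambda>\<psi>. cscale (coeff (P \<psi>) 0) x)"
proof (rule continuous_opI, goal_cases)
  note lin = continuous_op_linear[OF P]
  show "linear_op (\<lambda>\<psi>. cscale (coeff (P \<psi>) 0) x)"
    by (rule linear_opI) (auto simp: linear_op_add[OF lin] linear_op_scale[OF lin] cscale_add_left)
  case (2 s)
  obtain C M where C: "0 \<le> C" "\<And>B b p. (\<And>p. wt p ^ M * norm (coeff b p) \<le> B) \<Longrightarrow>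
     wt p ^ 0 * norm (coeff (P b) p) \<le> C * B"
    by (rule continuous_opE[OF P, where s = 0]) blast
  obtain D where D: "0 \<le> D" "\<And>p. wt p ^ s * norm (coeff x p) \<le> D"
    by (rule coeff_decay[where s = s and a = x]) blast
  have "wt p ^ s * norm (coeff (cscale (coeff (P b) 0) x) p) \<le> (C * D) * B"
    if "\<And>p. wt p ^ M * norm (coeff b p) \<le> B" for B b p
  proof -
    have "wt p ^ s * norm (coeff (cscale (coeff (P b) 0) x) p)
        = norm (coeff (P b) 0) * (wt p ^ s * norm (coeff x p))"
      by (simp add: norm_mult)
    also have "\<dots> \<le> (C * B) * D"
    proof (rule mult_mono)
      show "norm (coeff (P b) 0) \<le> C * B"
        using C(2)[OF that, of 0] by simp
      then show "0 \<le> C * B"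
        by (rule order_trans[OF norm_ge_zero])
    qed (use D in auto)
    finally show ?thesis by (simp add: mult_ac)
  qed
  then show ?case
    using C(1) D(1) by (intro exI[of _ "C * D"] exI[of _ M]) auto
qed

section \<open>Homogeneous symbols\<close>

definition zmon :: "complex \<Rightarrow> complex \<Rightarrow> int \<Rightarrow> int \<Rightarrow> real^2 \<Rightarrow> complex" where
  "zmon e1 e2 a b \<xi> = zeta e1 \<xi> powi a * zeta e2 \<xi> powi b"

lemma zeta_has_derivative: "(zeta e has_derivative zeta e) (at \<xi> within S)"
proof -
  have "linear (zeta e)"
    by (rule linearI) (auto simp: zeta_add zeta_scaleR simp flip: scaleR_conv_of_real)
  then show ?thesis
    by (intro bounded_linear_imp_has_derivative) (simp add: linear_conv_bounded_linear)
qed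

lemma zmon_has_derivative:
  assumes "e1 \<in> {\<i>, -\<i>}" "e2 \<in> {\<i>, -\<i>}" "\<xi> \<noteq> 0"
  shows "(zmon e1 e2 a b has_derivative (\<lambda>h. of_int a * zeta e1 h * zmon e1 e2 (a - 1) b \<xi> +
            of_int b * zeta e2 h * zmon e1 e2 a (b - 1) \<xi>)) (at \<xi>)"
proof -
  have nz: "zeta e1 \<xi> \<noteq> 0" "zeta e2 \<xi> \<noteq> 0"
    using assms by (simp_all add: zeta_eq_0_iff)
  show ?thesis
    unfolding zmon_def
    by (rule derivative_eq_intros zeta_has_derivative nz refl)+ (simp add: algebra_simps)
qed

lemma pd_eq:
  assumes "(f has_derivative D) (at \<xi>)" shows "pd a f \<xi> = D (axis a 1)"
proof -
  have "((\<lambda>t::real. \<xi> + t *\<^sub>R axis a 1) has_derivative (\<lambda>t. t *\<^sub>R axis a 1)) (at 0)"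
    by (auto intro!: derivative_eq_intros)
  moreover have "(f has_derivative D) (at (\<xi> + 0 *\<^sub>R axis a 1))"
    using assms by simp
  ultimately have "((\<lambda>t. f (\<xi> + t *\<^sub>R axis a 1)) has_derivative (\<lambda>t. D (t *\<^sub>R axis a 1))) (at 0)"
    by (rule has_derivative_compose)
  moreover have "D (t *\<^sub>R axis a 1) = t *\<^sub>R D (axis a 1)" for t
    using has_derivative_linear[OF assms] by (rule linear_scale)
  ultimately have "((\<lambda>t. f (\<xi> + t *\<^sub>R axis a 1)) has_vector_derivative D (axis a 1)) (at 0)"
    by (simp add: has_vector_derivative_def)
  then show ?thesis
    unfolding pd_def by (rule vector_derivative_at)
qed

text \<open>The span of the monomials away from the origin. It is closed under partial derivatives, hence made
  of smooth functions.\<close>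

inductive zfun :: "complex \<Rightarrow> complex \<Rightarrow> (real^2 \<Rightarrow> complex) \<Rightarrow> bool" for e1 e2 where
  zfun_zmon: "(\<And>\<xi>. \<xi> \<noteq> 0 \<Longrightarrow> f \<xi> = c * zmon e1 e2 a b \<xi>) \<Longrightarrow> zfun e1 e2 f"
| zfun_add: "zfun e1 e2 f \<Longrightarrow> zfun e1 e2 g \<Longrightarrow> (\<And>\<xi>. \<xi> \<noteq> 0 \<Longrightarrow> h \<xi> = f \<xi> + g \<xi>) \<Longrightarrow> zfun e1 e2 h"

lemma has_derivative_off_zero:
  assumes "(f has_derivative D) (at \<xi>)" "\<xi> \<noteq> 0" "\<And>\<xi>. \<xi> \<noteq> 0 \<Longrightarrow> g \<xi> = f \<xi>"
  shows "(g has_derivative D) (at (\<xi> :: 'a :: real_normed_vector))"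
  by (rule has_derivative_transform_within_open[OF assms(1), of "- {0}"]) (use assms(2,3) in auto)

lemma zfun_differentiable:
  assumes e: "e1 \<in> {\<i>, -\<i>}" "e2 \<in> {\<i>, -\<i>}" and f: "zfun e1 e2 f"
  shows "(\<forall>\<xi>. \<xi> \<noteq> 0 \<longrightarrow> f differentiable (at \<xi>)) \<and> (\<forall>i. zfun e1 e2 (pd i f))"
  using f
proof induction
  case (zfun_zmon f c a b)
  have D: "(f has_derivative (\<lambda>h. c * (of_int a * zeta e1 h * zmon e1 e2 (a - 1) b \<xi> +
            of_int b * zeta e2 h * zmon e1 e2 a (b - 1) \<xi>))) (at \<xi>)" if "\<xi> \<noteq> 0" for \<xi>
    using has_derivative_mult_right[OF zmon_has_derivative[OF e that]] that zfun_zmon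
    by (rule has_derivative_off_zero)
  have "zfun e1 e2 (pd i f)" for i
  proof (rule zfun.zfun_add)
    show "zfun e1 e2 (\<lambda>\<xi>. (c * of_int a * zeta e1 (axis i 1)) * zmon e1 e2 (a - 1) b \<xi>)"
      "zfun e1 e2 (\<lambda>\<xi>. (c * of_int b * zeta e2 (axis i 1)) * zmon e1 e2 a (b - 1) \<xi>)"
      by (rule zfun.zfun_zmon, rule refl)+
  qed (simp add: pd_eq[OF D] algebra_simps)
  with D show ?case unfolding differentiable_def by blast
next
  case (zfun_add f g h)
  have D: "(h has_derivative (\<lambda>x. frechet_derivative f (at \<xi>) x + frechet_derivative g (at \<xi>) x)) (at \<xi>)"
    if "\<xi> \<noteq> 0" for \<xi>
    by (rule has_derivative_off_zero[OF has_derivative_add[OF frechet_derivative_works[THEN iffD1] frechet_derivative_works[THEN iffD1]] that zfun_add(3)])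
       (use zfun_add that in auto)
  have "zfun e1 e2 (pd i h)" for i
  proof (rule zfun.zfun_add)
    show "zfun e1 e2 (pd i f)" "zfun e1 e2 (pd i g)"
      using zfun_add by auto
    show "pd i h \<xi> = pd i f \<xi> + pd i g \<xi>" if "\<xi> \<noteq> 0" for \<xi>
      using zfun_add that pd_eq[OF D[OF that]] by (simp add: pd_eq[OF frechet_derivative_works[THEN iffD1]])
  qed
  with D show ?case unfolding differentiable_def by blast
qed

lemma smooth_zmon:
  assumes e: "e1 \<in> {\<i>, -\<i>}" "e2 \<in> {\<i>, -\<i>}"
  shows "smooth_off_zero (\<lambda>\<xi>. c * zmon e1 e2 a b \<xi>)"
proof -
  have "zfun e1 e2 (foldr pd as (\<lambda>\<xi>. c * zmon e1 e2 a b \<xi>))" for as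
    by (induction as) (auto simp: zfun_differentiable[OF e] intro: zfun_zmon)
  then show ?thesis
    unfolding smooth_off_zero_def differentiable_on_def
    using zfun_differentiable[OF e] by (auto intro: differentiable_at_withinI)
qed

lemma zmon_homogeneous:
  assumes "0 < t" shows "zmon e1 e2 a b (t *\<^sub>R \<xi>) = of_real (t powi (a + b)) * zmon e1 e2 a b \<xi>"
  using assms
  by (simp add: zmon_def zeta_scaleR power_int_mult_distrib power_int_add of_real_power_int)

definition scalar_homogeneous :: "real \<Rightarrow> int \<Rightarrow> (real^2 \<Rightarrow> nct \<Rightarrow> nct) \<Rightarrow> bool" where
  "scalar_homogeneous \<theta> d s \<longleftrightarrow>
     (\<exists>N f T. (\<forall>l<(N::nat). smooth_off_zero (f l) \<and> T l \<in> Ahat \<theta>) \<and>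
        (\<forall>\<xi>. \<xi> \<noteq> 0 \<longrightarrow> (\<forall>\<psi>. s \<xi> \<psi> = (\<Sum>l<N. cscale (f l \<xi>) (T l \<psi>))))) \<and>
     (\<forall>\<xi> t. \<xi> \<noteq> 0 \<longrightarrow> 0 < t \<longrightarrow> (\<forall>\<psi>. s (t *\<^sub>R \<xi>) \<psi> = cscale (of_real (t powi d)) (s \<xi> \<psi>)))"

lemma sum_lessThan_add: "(\<Sum>l<m + n. g l) = (\<Sum>l<m. g l) + (\<Sum>l<n. g (m + l))"
  for g :: "nat \<Rightarrow> 'a :: comm_monoid_add" and m n :: nat
  by (induction n) (auto simp: add.assoc)

lemma scalar_homogeneous_0: "scalar_homogeneous \<theta> d (\<lambda>\<xi> \<psi>. 0)"
  unfolding scalar_homogeneous_def by (auto intro!: exI[of _ 0])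

lemma scalar_homogeneous_add:
  assumes "scalar_homogeneous \<theta> d s1" "scalar_homogeneous \<theta> d s2"
  shows "scalar_homogeneous \<theta> d (\<lambda>\<xi> \<psi>. s1 \<xi> \<psi> + s2 \<xi> \<psi>)"
proof -
  obtain N1 f1 T1 where 1: "\<forall>l<(N1::nat). smooth_off_zero (f1 l) \<and> T1 l \<in> Ahat \<theta>"
      "\<forall>\<xi>. \<xi> \<noteq> 0 \<longrightarrow> (\<forall>\<psi>. s1 \<xi> \<psi> = (\<Sum>l<N1. cscale (f1 l \<xi>) (T1 l \<psi>)))"
    using assms(1) unfolding scalar_homogeneous_def by blast
  obtain N2 f2 T2 where 2: "\<forall>l<(N2::nat). smooth_off_zero (f2 l) \<and> T2 l \<in> Ahat \<theta>"
      "\<forall>\<xi>. \<xi> \<noteq> 0 \<longrightarrow> (\<forall>\<psi>. s2 \<xi> \<psi> = (\<Sum>l<N2. cscale (f2 l \<xi>) (T2 l \<psi>)))"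
    using assms(2) unfolding scalar_homogeneous_def by blast
  let ?f = "\<lambda>l. if l < N1 then f1 l else f2 (l - N1)" and ?T = "\<lambda>l. if l < N1 then T1 l else T2 (l - N1)"
  have "\<forall>l<N1 + N2. smooth_off_zero (?f l) \<and> ?T l \<in> Ahat \<theta>"
    using 1(1) 2(1) by auto
  moreover have "\<forall>\<xi>. \<xi> \<noteq> 0 \<longrightarrow> (\<forall>\<psi>. s1 \<xi> \<psi> + s2 \<xi> \<psi> = (\<Sum>l<N1 + N2. cscale (?f l \<xi>) (?T l \<psi>)))"
    using 1(2) 2(2) by (simp add: sum_lessThan_add)
  moreover have "\<forall>\<xi> t. \<xi> \<noteq> 0 \<longrightarrow> 0 < t \<longrightarrow> (\<forall>\<psi>. s1 (t *\<^sub>R \<xi>) \<psi> + s2 (t *\<^sub>R \<xi>) \<psi>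
      = cscale (of_real (t powi d)) (s1 \<xi> \<psi> + s2 \<xi> \<psi>))"
    using assms unfolding scalar_homogeneous_def by (simp add: cscale_add_right)
  ultimately show ?thesis
    unfolding scalar_homogeneous_def
    by - (intro conjI exI[of _ "N1 + N2"] exI[of _ ?f] exI[of _ ?T]; assumption)
qed

lemma scalar_homogeneous_sum:
  "(\<And>i. i \<in> I \<Longrightarrow> scalar_homogeneous \<theta> d (s i)) \<Longrightarrow> scalar_homogeneous \<theta> d (\<lambda>\<xi> \<psi>. \<Sum>i\<in>I. s i \<xi> \<psi>)"
  by (induction I rule: infinite_finite_induct) (auto simp: scalar_homogeneous_0 scalar_homogeneous_add)

lemma scalar_homogeneous_zmon:
  assumes "e1 \<in> {\<i>, -\<i>}" "e2 \<in> {\<i>, -\<i>}" "T \<in> Ahat \<theta>" "d = a + b"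
  shows "scalar_homogeneous \<theta> d (\<lambda>\<xi> \<psi>. cscale (c * zmon e1 e2 a b \<xi>) (T \<psi>))"
  unfolding scalar_homogeneous_def
proof (intro conjI allI impI)
  show "\<exists>N f Ta. (\<forall>l<N. smooth_off_zero (f l) \<and> Ta l \<in> Ahat \<theta>) \<and>
     (\<forall>\<xi>. \<xi> \<noteq> 0 \<longrightarrow> (\<forall>\<psi>. cscale (c * zmon e1 e2 a b \<xi>) (T \<psi>) = (\<Sum>l<(N::nat). cscale (f l \<xi>) (Ta l \<psi>))))"
    using smooth_zmon[OF assms(1,2)] assms(3)
    by (intro exI[of _ 1] exI[of _ "\<lambda>_ \<xi>. c * zmon e1 e2 a b \<xi>"] exI[of _ "\<lambda>_. T"]) auto
  show "cscale (c * zmon e1 e2 a b (t *\<^sub>R \<xi>)) (T \<psi>) =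
      cscale (complex_of_real (t powi d)) (cscale (c * zmon e1 e2 a b \<xi>) (T \<psi>))" if "0 < t" for \<xi> t \<psi>
    by (simp add: zmon_homogeneous[OF that] assms(4) mult_ac)
qed

text \<open>The scalar analogue of the notion of a symbol, for the diagonal entries of an operator.\<close>

definition scalar_symbol ::
    "real \<Rightarrow> (nct \<Rightarrow> nct) \<Rightarrow> (int \<Rightarrow> real^2 \<Rightarrow> nct \<Rightarrow> nct) \<Rightarrow> bool" where
  "scalar_symbol \<theta> P \<sigma> \<longleftrightarrow> (\<forall>d. scalar_homogeneous \<theta> d (\<sigma> d)) \<and>
     (\<exists>m. (\<forall>d>m. \<forall>\<xi>. \<xi> \<noteq> 0 \<longrightarrow> (\<forall>\<psi>. \<sigma> d \<xi> \<psi> = 0)) \<and>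
       (\<forall>N. cols_order (N - 1) (\<lambda>n. P (U n) - (\<Sum>d=N..m. \<sigma> d (emb n) (U n)))))"

lemma sum_symbol_extend:
  assumes "\<forall>d>m. \<sigma> d = (0 :: 'a :: comm_monoid_add)" "m \<le> m'"
  shows "(\<Sum>d=N..m'. \<sigma> d) = (\<Sum>d=(N::int)..m. \<sigma> d)"
  by (rule sum.mono_neutral_right) (use assms in auto)

lemma scalar_symbolE:
  assumes "scalar_symbol \<theta> P \<sigma>"
  obtains m where "\<And>d \<xi> \<psi>. m < d \<Longrightarrow> \<xi> \<noteq> 0 \<Longrightarrow> \<sigma> d \<xi> \<psi> = 0"
    "\<And>m' N. m \<le> m' \<Longrightarrow> cols_order (N - 1) (\<lambda>n. P (U n) - (\<Sum>d=N..m'. \<sigma> d (emb n) (U n)))"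
proof -
  obtain m where m: "\<forall>d>m. \<forall>\<xi>. \<xi> \<noteq> 0 \<longrightarrow> (\<forall>\<psi>. \<sigma> d \<xi> \<psi> = 0)"
    and E: "\<And>N. cols_order (N - 1) (\<lambda>n. P (U n) - (\<Sum>d=N..m. \<sigma> d (emb n) (U n)))"
    using assms unfolding scalar_symbol_def by blast
  have "cols_order (N - 1) (\<lambda>n. P (U n) - (\<Sum>d=N..m'. \<sigma> d (emb n) (U n)))" if "m \<le> m'" for m' N
  proof (rule cols_order_cong[OF E[of N]])
    fix n :: "int^2" assume "n \<noteq> 0"
    then have "(\<Sum>d=N..m'. \<sigma> d (emb n) (U n)) = (\<Sum>d=N..m. \<sigma> d (emb n) (U n))"
      by (intro sum_symbol_extend) (use m that in auto)
    then show "P (U n) - (\<Sum>d=N..m. \<sigma> d (emb n) (U n)) = P (U n) - (\<Sum>d=N..m'. \<sigma> d (emb n) (U n))"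
      by simp
  qed
  with m show ?thesis using that by blast
qed

lemma scalar_symbol_add:
  assumes "scalar_symbol \<theta> P \<sigma>" "scalar_symbol \<theta> Q \<rho>"
  shows "scalar_symbol \<theta> (\<lambda>\<psi>. P \<psi> + Q \<psi>) (\<lambda>d \<xi> \<psi>. \<sigma> d \<xi> \<psi> + \<rho> d \<xi> \<psi>)"
proof -
  obtain m1 where 1: "\<And>d \<xi> \<psi>. m1 < d \<Longrightarrow> \<xi> \<noteq> 0 \<Longrightarrow> \<sigma> d \<xi> \<psi> = 0"
    "\<And>m' N. m1 \<le> m' \<Longrightarrow> cols_order (N - 1) (\<lambda>n. P (U n) - (\<Sum>d=N..m'. \<sigma> d (emb n) (U n)))"
    by (rule scalar_symbolE[OF assms(1)]) blast
  obtain m2 where 2: "\<And>d \<xi> \<psi>. m2 < d \<Longrightarrow> \<xi> \<noteq> 0 \<Longrightarrow> \<rho> d \<xi> \<psi> = 0"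
    "\<And>m' N. m2 \<le> m' \<Longrightarrow> cols_order (N - 1) (\<lambda>n. Q (U n) - (\<Sum>d=N..m'. \<rho> d (emb n) (U n)))"
    by (rule scalar_symbolE[OF assms(2)]) blast
  define m where "m = max m1 m2"
  have "cols_order (N - 1) (\<lambda>n. P (U n) + Q (U n) - (\<Sum>d=N..m. \<sigma> d (emb n) (U n) + \<rho> d (emb n) (U n)))" for N
    using cols_order_add[OF 1(2)[of m N] 2(2)[of m N]]
    by (simp add: m_def sum.distrib algebra_simps)
  moreover have "\<forall>d>m. \<forall>\<xi>. \<xi> \<noteq> 0 \<longrightarrow> (\<forall>\<psi>. \<sigma> d \<xi> \<psi> + \<rho> d \<xi> \<psi> = 0)"
    using 1(1) 2(1) by (simp add: m_def)
  ultimately show ?thesis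
    using assms unfolding scalar_symbol_def by (auto intro: scalar_homogeneous_add)
qed

lemma scalar_symbol_smoothing:
  assumes "scalar_symbol \<theta> Q \<sigma>" "smoothing (\<lambda>n. P (U n) - Q (U n))"
  shows "scalar_symbol \<theta> P \<sigma>"
proof -
  obtain m where 1: "\<And>d \<xi> \<psi>. m < d \<Longrightarrow> \<xi> \<noteq> 0 \<Longrightarrow> \<sigma> d \<xi> \<psi> = 0"
    "\<And>m' N. m \<le> m' \<Longrightarrow> cols_order (N - 1) (\<lambda>n. Q (U n) - (\<Sum>d=N..m'. \<sigma> d (emb n) (U n)))"
    by (rule scalar_symbolE[OF assms(1)]) blast
  have "cols_order (N - 1) (\<lambda>n. P (U n) - (\<Sum>d=N..m. \<sigma> d (emb n) (U n)))" for N
    using cols_order_add[OF 1(2)[of m N]] assms(2)[unfolded smoothing_def, rule_format, of "N - 1"]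
    by fastforce
  with 1(1) show ?thesis using assms(1) unfolding scalar_symbol_def by blast
qed

text \<open>An asymptotic expansion in descending degrees \<open>m, m - 1, ...\<close> is a symbol. This only translates the
  number \<open>M\<close> of terms into the lowest degree \<open>N\<close>.\<close>

lemma scalar_symbolI:
  assumes hom: "\<And>k. scalar_homogeneous \<theta> (m - int k) (\<tau> k)"
    and exp: "\<And>M. cols_order (m - int M) (\<lambda>n. P (U n) - (\<Sum>k<M. \<tau> k (emb n) (U n)))"
  shows "scalar_symbol \<theta> P (\<lambda>d \<xi> \<psi>. if d \<le> m then \<tau> (nat (m - d)) \<xi> \<psi> else 0)" (is "scalar_symbol _ _ ?\<sigma>")
proof -
  have "scalar_homogeneous \<theta> d (?\<sigma> d)" for d
  proof (cases "d \<le> m")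
    case True
    then show ?thesis using hom[of "nat (m - d)"] by simp
  qed (simp add: scalar_homogeneous_0)
  moreover have "cols_order (N - 1) (\<lambda>n. P (U n) - (\<Sum>d=N..m. ?\<sigma> d (emb n) (U n)))" for N
  proof -
    define M where "M = nat (m - N + 1)"
    have "(\<Sum>d=N..m. ?\<sigma> d (emb n) (U n)) = (\<Sum>k<M. \<tau> k (emb n) (U n))" for n
      by (rule sum.reindex_bij_witness[of _ "\<lambda>k. m - int k" "\<lambda>d. nat (m - d)"]) (auto simp: M_def)
    then show ?thesis
      using cols_order_mono[OF exp[of M], of "N - 1"] by (simp add: M_def)
  qed
  ultimately show ?thesis
    unfolding scalar_symbol_def by (auto intro!: exI[of _ m])
qed

section \<open>Symbols of the composite operators\<close>

text \<open>The component of degree \<open>-2 - k\<close> in the symbol of \<open>c zinv e1 g zinv e2 l\<close>: the index \<open>i\<close> counts the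
  commutators with \<open>dz e2\<close> and \<open>k - i\<close> those with \<open>dz e1\<close>.\<close>

definition zinv2_symbol ::
    "complex \<Rightarrow> complex \<Rightarrow> (nct \<Rightarrow> nct) \<Rightarrow> (nct \<Rightarrow> nct) \<Rightarrow> (nct \<Rightarrow> nct) \<Rightarrow> nat \<Rightarrow> real^2 \<Rightarrow> nct \<Rightarrow> nct" where
  "zinv2_symbol e1 e2 c g l k \<xi> \<psi> = (\<Sum>i\<le>k. cscale ((-1) ^ k * zmon e1 e2 (- 1 - int (k - i)) (- 1 - int i) \<xi>)
     (c ((ad e1 ^^ (k - i)) (\<lambda>\<phi>. g ((ad e2 ^^ i) l \<phi>)) \<psi>)))"

lemma norm_zeta_powi: "e \<in> {\<i>, -\<i>} \<Longrightarrow> norm ((-1) ^ j * zeta e \<xi> powi a) = norm \<xi> powi a"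
  by (simp add: norm_mult norm_power norm_power_int norm_zeta)

text \<open>Expand the right inverse to \<open>M\<close> terms, and the left inverse in the \<open>i\<close>-th of them to \<open>M - i\<close> terms,
  so that all remainders have the same order.\<close>

lemma zinv2_expansion:
  assumes e: "e1 \<in> {\<i>, -\<i>}" "e2 \<in> {\<i>, -\<i>}"
    and A: "c \<in> Ahat \<theta>" "g \<in> Ahat \<theta>" "l \<in> Ahat \<theta>"
  shows "cols_order (- 2 - int M) (\<lambda>n. c (zinv e1 (g (zinv e2 (l (U n))))) -
     (\<Sum>k<M. zinv2_symbol e1 e2 c g l k (emb n) (U n)))"
proof -
  define a where "a = (\<lambda>i n. (-1) ^ i * zeta e2 (emb n) powi (- 1 - int i))"
  define b where "b = (\<lambda>i n. (-1) ^ i * zeta e1 (emb n) powi (- 1 - int i))"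
  define X where "X = (\<lambda>i \<phi>. g ((ad e2 ^^ i) l \<phi>))"
  define F where "F = (\<lambda>n. zinv e2 (l (U n)) - (\<Sum>i<M. cscale (a i n) ((ad e2 ^^ i) l (U n))))"
  define G where "G = (\<lambda>i n. zinv e1 (X i (U n)) - (\<Sum>j<M - i. cscale (b j n) ((ad e1 ^^ j) (X i) (U n))))"
  have X: "X i \<in> Ahat \<theta>" for i
    unfolding X_def by (rule Ahat_comp'[OF A(2) Ahat_ad_pow[OF A(3)]])
  note lc = local_op_linear[OF Ahat_local[OF A(1)]] and lg = local_op_linear[OF Ahat_local[OF A(2)]]
    and lz = local_op_linear[OF local_zinv]
  have F: "cols_order (- 1 - int M) F"
    unfolding F_def a_def by (rule zinv_expansion[OF e(2) A(3)])
  have "cols_order (- 1 - int M - 1) (\<lambda>n. zinv e1 (g (F n)))"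
    by (rule cols_order_zinv[OF e(1) cols_order_local[OF Ahat_local[OF A(2)] F]])
  then have F': "cols_order (- 2 - int M) (\<lambda>n. zinv e1 (g (F n)))"
    by (rule cols_order_mono) simp
  have na: "norm (a i n) \<le> 1 * norm (emb n) powi (- 1 - int i)" for i n
    unfolding a_def norm_zeta_powi[OF e(2)] by simp
  have G: "cols_order (- 2 - int M) (\<lambda>n. cscale (a i n) (G i n))" if "i < M" for i
  proof -
    have "cols_order (- 1 - int (M - i)) (G i)"
      unfolding G_def b_def by (rule zinv_expansion[OF e(1) X])
    then have "cols_order (- 1 - int (M - i) + (- 1 - int i)) (\<lambda>n. cscale (a i n) (G i n))"
      using na by (rule cols_order_scale)
    then show ?thesis
      by (rule cols_order_mono) (use that in simp)
  qed
  have R: "cols_order (- 2 - int M) (\<lambda>n. c (zinv e1 (g (F n)) + (\<Sum>i<M. cscale (a i n) (G i n))))"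
    by (intro cols_order_local[OF Ahat_local[OF A(1)]] cols_order_add F' cols_order_sum G) auto
  have "c (zinv e1 (g (zinv e2 (l (U n))))) - (\<Sum>k<M. zinv2_symbol e1 e2 c g l k (emb n) (U n))
     = c (zinv e1 (g (F n)) + (\<Sum>i<M. cscale (a i n) (G i n)))" for n
  proof -
    have "zinv e1 (g (zinv e2 (l (U n))))
      = zinv e1 (g (F n)) + (\<Sum>i<M. cscale (a i n) (zinv e1 (X i (U n))))"
      by (simp add: F_def X_def linear_op_diff[OF lg] linear_op_sum[OF lg] linear_op_scale[OF lg]
          linear_op_diff[OF lz] linear_op_sum[OF lz] linear_op_scale[OF lz])
    also have "\<dots> = zinv e1 (g (F n)) + (\<Sum>i<M. cscale (a i n) (G i n)) +
       (\<Sum>i<M. \<Sum>j<M - i. cscale (a i n * b j n) ((ad e1 ^^ j) (X i) (U n)))"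
      by (simp add: G_def cscale_diff_right cscale_sum_right sum_subtractf)
    also have "(\<Sum>i<M. \<Sum>j<M - i. cscale (a i n * b j n) ((ad e1 ^^ j) (X i) (U n)))
       = (\<Sum>(i, j)\<in>{(i, j). i + j < M}. cscale (a i n * b j n) ((ad e1 ^^ j) (X i) (U n)))"
      by (subst sum.Sigma) (auto intro!: sum.cong)
    also have "\<dots> = (\<Sum>k<M. \<Sum>i\<le>k. cscale (a i n * b (k - i) n) ((ad e1 ^^ (k - i)) (X i) (U n)))"
      by (rule sum.triangle_reindex)
    also have "\<dots> = (\<Sum>k<M. \<Sum>i\<le>k. cscale ((-1) ^ k * zmon e1 e2 (- 1 - int (k - i)) (- 1 - int i) (emb n))
        ((ad e1 ^^ (k - i)) (X i) (U n)))"
    proof (intro sum.cong refl)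
      fix k i :: nat assume "i \<in> {..k}"
      then have sign: "(-1 :: complex) ^ i * (-1) ^ (k - i) = (-1) ^ k"
        by (simp flip: power_add)
      have "a i n * b (k - i) n = ((-1) ^ i * (-1) ^ (k - i)) * zmon e1 e2 (- 1 - int (k - i)) (- 1 - int i) (emb n)"
        by (simp add: a_def b_def zmon_def)
      then show "cscale (a i n * b (k - i) n) ((ad e1 ^^ (k - i)) (X i) (U n)) =
         cscale ((-1) ^ k * zmon e1 e2 (- 1 - int (k - i)) (- 1 - int i) (emb n)) ((ad e1 ^^ (k - i)) (X i) (U n))"
        by (simp only: sign)
    qed
    finally show ?thesis
      by (simp add: zinv2_symbol_def X_def linear_op_add[OF lc] linear_op_sum[OF lc] linear_op_scale[OF lc])
  qed
  with R show ?thesis by simp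
qed

lemma zinv2_scalar_symbol:
  assumes e: "e1 \<in> {\<i>, -\<i>}" "e2 \<in> {\<i>, -\<i>}"
    and A: "c \<in> Ahat \<theta>" "g \<in> Ahat \<theta>" "l \<in> Ahat \<theta>"
  shows "scalar_symbol \<theta> (\<lambda>\<psi>. c (zinv e1 (g (zinv e2 (l \<psi>)))))
     (\<lambda>d \<xi> \<psi>. if d \<le> - 2 then zinv2_symbol e1 e2 c g l (nat (- 2 - d)) \<xi> \<psi> else 0)"
proof (rule scalar_symbolI)
  show "scalar_homogeneous \<theta> (- 2 - int k) (zinv2_symbol e1 e2 c g l k)" for k
    unfolding zinv2_symbol_def
    by (intro scalar_homogeneous_sum scalar_homogeneous_zmon e Ahat_comp'[OF A(1)] Ahat_ad_pow
        Ahat_comp'[OF A(2)] A(3)) auto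
qed (rule zinv2_expansion[OF e A])

text \<open>The component of degree \<open>-k\<close> in the symbol of \<open>c dz e1 g zinv e2 l\<close>. By the Leibniz rule \<open>dz e1\<close>
  either contributes its symbol or differentiates the coefficient, which lowers the degree by one.\<close>

fun dz_zinv_symbol ::
    "complex \<Rightarrow> complex \<Rightarrow> (nct \<Rightarrow> nct) \<Rightarrow> (nct \<Rightarrow> nct) \<Rightarrow> (nct \<Rightarrow> nct) \<Rightarrow> nat \<Rightarrow> real^2 \<Rightarrow> nct \<Rightarrow> nct" where
  "dz_zinv_symbol e1 e2 c g l 0 \<xi> \<psi> = cscale (1 * zmon e1 e2 1 (- 1) \<xi>) (c (g (l \<psi>)))"
| "dz_zinv_symbol e1 e2 c g l (Suc k) \<xi> \<psi> =
     cscale ((-1) ^ Suc k * zmon e1 e2 1 (- 1 - int (Suc k)) \<xi>) (c (g ((ad e2 ^^ Suc k) l \<psi>))) +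
     cscale ((-1) ^ k * zmon e1 e2 0 (- 1 - int k) \<xi>) (c (ad e1 (\<lambda>\<phi>. g ((ad e2 ^^ k) l \<phi>)) \<psi>))"

lemma dz_zinv_expansion:
  assumes e: "e1 \<in> {\<i>, -\<i>}" "e2 \<in> {\<i>, -\<i>}"
    and A: "c \<in> Ahat \<theta>" "g \<in> Ahat \<theta>" "l \<in> Ahat \<theta>"
  shows "cols_order (0 - int M) (\<lambda>n. c (dz e1 (g (zinv e2 (l (U n))))) -
     (\<Sum>k<M. dz_zinv_symbol e1 e2 c g l k (emb n) (U n)))"
proof -
  define a where "a = (\<lambda>i n. (-1) ^ i * zeta e2 (emb n) powi (- 1 - int i))"
  define X where "X = (\<lambda>i \<phi>. g ((ad e2 ^^ i) l \<phi>))"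
  define F where "F = (\<lambda>M n. zinv e2 (l (U n)) - (\<Sum>i<M. cscale (a i n) ((ad e2 ^^ i) l (U n))))"
  have X: "X i \<in> Ahat \<theta>" for i
    unfolding X_def by (rule Ahat_comp'[OF A(2) Ahat_ad_pow[OF A(3)]])
  note lc = local_op_linear[OF Ahat_local[OF A(1)]] and lg = local_op_linear[OF Ahat_local[OF A(2)]]
  have F: "cols_order (0 - int M) (\<lambda>n. c (dz e1 (g (F M n))))" for M
  proof -
    have "cols_order (- 1 - int M) (F M)"
      unfolding F_def a_def by (rule zinv_expansion[OF e(2) A(3)])
    from cols_order_local[OF Ahat_local[OF A(1)]
          cols_order_dz[OF e(1) cols_order_local[OF Ahat_local[OF A(2)] this]]]
    show ?thesis by simp
  qed
  have na: "norm (a i n) \<le> 1 * norm (emb n) powi (- 1 - int i)" for i n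
    unfolding a_def norm_zeta_powi[OF e(2)] by simp
  have H: "cols_order (0 - int (Suc M)) (\<lambda>n. cscale (a M n) (c (ad e1 (X M) (U n))))" for M
  proof -
    have "cols_order (0 + (- 1 - int M)) (\<lambda>n. cscale (a M n) (c (ad e1 (X M) (U n))))"
      using cols_order_Ahat[OF Ahat_comp'[OF A(1) Ahat_ad[OF X]]] na by (rule cols_order_scale)
    then show ?thesis by (simp add: algebra_simps)
  qed
  have split: "c (dz e1 (g (zinv e2 (l (U n))))) = c (dz e1 (g (F M n))) +
      (\<Sum>i<M. cscale (zeta e1 (emb n) * a i n) (c (X i (U n)))) + (\<Sum>i<M. cscale (a i n) (c (ad e1 (X i) (U n))))" for M n
  proof -
    have dzX: "dz e1 (X i (U n)) = cscale (zeta e1 (emb n)) (X i (U n)) + ad e1 (X i) (U n)" for i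
      using linear_op_scale[OF local_op_linear[OF Ahat_local[OF X[of i]]]] by (simp add: ad_def dz_U)
    have "c (dz e1 (g (zinv e2 (l (U n))))) = c (dz e1 (g (F M n))) + (\<Sum>i<M. cscale (a i n) (c (dz e1 (X i (U n)))))"
      by (simp add: F_def X_def linear_op_diff[OF lg] linear_op_sum[OF lg] linear_op_scale[OF lg]
          linear_op_diff[OF linear_dz] linear_op_sum[OF linear_dz] linear_op_scale[OF linear_dz]
          linear_op_diff[OF lc] linear_op_sum[OF lc] linear_op_scale[OF lc])
    then show ?thesis
      by (simp add: dzX linear_op_add[OF lc] linear_op_scale[OF lc] cscale_add_right sum.distrib mult_ac add.assoc)
  qed
  have zm: "(-1) ^ i * zmon e1 e2 1 (- 1 - int i) (emb n) = zeta e1 (emb n) * a i n"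
    "(-1) ^ i * zmon e1 e2 0 (- 1 - int i) (emb n) = a i n" for i n
    by (simp_all add: zmon_def a_def mult_ac)
  have sym: "(\<Sum>k<Suc M. dz_zinv_symbol e1 e2 c g l k (emb n) (U n)) =
      (\<Sum>i<Suc M. cscale (zeta e1 (emb n) * a i n) (c (X i (U n)))) + (\<Sum>i<M. cscale (a i n) (c (ad e1 (X i) (U n))))" for M n
  proof (induction M)
    case 0
    show ?case using zm(1)[of 0 n] by (simp add: X_def)
  next
    case (Suc M)
    have "dz_zinv_symbol e1 e2 c g l (Suc M) (emb n) (U n) =
       cscale (zeta e1 (emb n) * a (Suc M) n) (c (X (Suc M) (U n))) + cscale (a M n) (c (ad e1 (X M) (U n)))"
      by (simp only: dz_zinv_symbol.simps zm X_def)
    with Suc show ?case by (simp only: sum.lessThan_Suc[of _ "Suc M"] sum.lessThan_Suc[of _ M]) (simp add: algebra_simps)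
  qed
  show ?thesis
  proof (cases M)
    case 0
    then show ?thesis using F[of 0] by (simp add: F_def)
  next
    case (Suc M')
    show ?thesis
      unfolding Suc by (rule cols_order_cong[OF cols_order_add[OF F H]])
       (simp only: split[of _ "Suc M'"] sym, simp)
  qed
qed

lemma dz_zinv_scalar_symbol:
  assumes e: "e1 \<in> {\<i>, -\<i>}" "e2 \<in> {\<i>, -\<i>}"
    and A: "c \<in> Ahat \<theta>" "g \<in> Ahat \<theta>" "l \<in> Ahat \<theta>"
  shows "scalar_symbol \<theta> (\<lambda>\<psi>. c (dz e1 (g (zinv e2 (l \<psi>)))))
     (\<lambda>d \<xi> \<psi>. if d \<le> 0 then dz_zinv_symbol e1 e2 c g l (nat (0 - d)) \<xi> \<psi> else 0)"
proof (rule scalar_symbolI)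
  show "scalar_homogeneous \<theta> (0 - int k) (dz_zinv_symbol e1 e2 c g l k)" for k
  proof (cases k)
    case 0
    have "scalar_homogeneous \<theta> (0 - int 0) (\<lambda>\<xi> \<psi>. dz_zinv_symbol e1 e2 c g l 0 \<xi> \<psi>)"
      unfolding dz_zinv_symbol.simps
      by (intro scalar_homogeneous_zmon e Ahat_comp'[OF A(1)] Ahat_comp'[OF A(2)] A(3)) auto
    then show ?thesis unfolding 0 .
  next
    case (Suc k')
    have "scalar_homogeneous \<theta> (0 - int (Suc k')) (\<lambda>\<xi> \<psi>. dz_zinv_symbol e1 e2 c g l (Suc k') \<xi> \<psi>)"
      unfolding dz_zinv_symbol.simps
      by (intro scalar_homogeneous_add scalar_homogeneous_zmon e Ahat_comp'[OF A(1)] Ahat_comp'[OF A(2)]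
          Ahat_ad Ahat_ad_pow A(3)) auto
    then show ?thesis unfolding Suc .
  qed
qed (rule dz_zinv_expansion[OF e A])

section \<open>Almost periodic columns\<close>

definition symp :: "int^2 \<Rightarrow> int^2 \<Rightarrow> real" where
  "symp m n = real_of_int (m $ 1 * n $ 2 - m $ 2 * n $ 1)"

lemma symp_simps: "symp (a + b) n = symp a n + symp b n" "symp (a - b) n = symp a n - symp b n"
  "symp n (a + b) = symp n a + symp n b" "symp n (a - b) = symp n a - symp n b"
  "symp 0 n = 0" "symp n 0 = 0" "symp n n = 0"
  by (auto simp: symp_def algebra_simps)

lemma geometric_average_tendsto_0:
  assumes \<theta>: "\<theta> \<notin> \<rat>" and j: "j \<noteq> (0::int)"
  shows "(\<lambda>K. (\<Sum>m<K. cis (2 * pi * \<theta> * real_of_int j * real m)) / of_nat K) \<longlonglongrightarrow> 0"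
proof -
  let ?S = "\<lambda>K. \<Sum>m<K. cis (2 * pi * \<theta> * real_of_int j * real m)"
  define w where "w = cis (2 * pi * \<theta> * real_of_int j)"
  have w1: "w \<noteq> 1"
  proof
    assume "w = 1"
    then have "cos (2 * pi * \<theta> * real_of_int j) = 1"
      by (simp add: w_def complex_eq_iff)
    then obtain i :: int where "2 * pi * \<theta> * real_of_int j = real_of_int i * 2 * pi"
      unfolding cos_one_2pi_int by (auto simp: mult_ac)
    then have "\<theta> = real_of_int i / real_of_int j"
      using j by (simp add: field_simps)
    with \<theta> show False by auto
  qed
  have bound: "norm (?S K / of_nat K) \<le> 2 / norm (1 - w) * (1 / real K)"
    for K
  proof -
    have "cis (2 * pi * \<theta> * real_of_int j * real m) = w ^ m" for m
      unfolding w_def Complex.DeMoivre by (rule arg_cong[where f = cis]) simp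
    then have "?S K = (\<Sum>m<K. w ^ m)"
      by simp
    also have "\<dots> = (1 - w ^ K) / (1 - w)"
      using w1 by (simp add: sum_gp_strict)
    finally have eq: "?S K = (1 - w ^ K) / (1 - w)" .
    have "norm (1 - w ^ K) \<le> 2"
      using norm_triangle_ineq4[of 1 "w ^ K"] by (simp add: w_def norm_power)
    then have "norm ((1 - w ^ K) / (1 - w)) \<le> 2 / norm (1 - w)"
      by (simp add: norm_divide divide_right_mono)
    then have "norm ((1 - w ^ K) / (1 - w)) / real K \<le> 2 / norm (1 - w) / real K"
      by (rule divide_right_mono) simp
    then show ?thesis
      unfolding eq norm_divide[of _ "of_nat K"] by simp
  qed
  have "(\<lambda>K. 2 / norm (1 - w) * (1 / real K)) \<longlonglongrightarrow> 0"
    by (intro tendsto_mult_right_zero lim_1_over_n)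
  with always_eventually[OF allI[OF bound]] show ?thesis
    by (rule Lim_null_comparison)
qed

definition square :: "nat \<Rightarrow> (int^2) set" where
  "square K = (\<lambda>(i, j). vector [int i, int j]) ` ({..<K} \<times> {..<K})"

lemma sum_square: "(\<Sum>m\<in>square K. f m) = (\<Sum>i<K. \<Sum>j<K. f (vector [int i, int j]))"
proof -
  have "inj_on (\<lambda>(i, j). vector [int i, int j] :: int^2) ({..<K} \<times> {..<K})"
    by (auto simp: inj_on_def vec_eq_iff forall_2)
  then show ?thesis
    by (simp add: square_def sum.reindex sum.cartesian_product case_prod_unfold)
qed

lemma card_square: "card (square K) = K\<^sup>2"
  using sum_square[of "\<lambda>_. 1 :: nat" K] by (simp add: power2_eq_square)

lemma square_average_tendsto_0:
  assumes \<theta>: "\<theta> \<notin> \<rat>" and r: "r \<noteq> 0"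
  shows "(\<lambda>K. norm (\<Sum>m\<in>square K. cis (2 * pi * \<theta> * symp r m)) / real K ^ 2) \<longlonglongrightarrow> 0"
proof -
  let ?g = "\<lambda>j K. norm ((\<Sum>m<K. cis (2 * pi * \<theta> * real_of_int j * real m)) / of_nat K)"
  have eq: "norm (\<Sum>m\<in>square K. cis (2 * pi * \<theta> * symp r m)) / real K ^ 2 = ?g (- (r $ 2)) K * ?g (r $ 1) K" for K
  proof -
    have "(\<Sum>m\<in>square K. cis (2 * pi * \<theta> * symp r m)) =
      (\<Sum>i<K. \<Sum>j<K. cis (2 * pi * \<theta> * real_of_int (- (r $ 2)) * real i) * cis (2 * pi * \<theta> * real_of_int (r $ 1) * real j))"
      by (simp add: sum_square symp_def cis_mult algebra_simps)
    also have "\<dots> = (\<Sum>i<K. cis (2 * pi * \<theta> * real_of_int (- (r $ 2)) * real i)) *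
        (\<Sum>j<K. cis (2 * pi * \<theta> * real_of_int (r $ 1) * real j))"
      by (simp only: sum_product)
    finally show ?thesis
      by (simp add: norm_mult norm_divide power2_eq_square)
  qed
  have bound: "?g j K \<le> 1" for j K
  proof -
    have "norm (\<Sum>m<K. cis (2 * pi * \<theta> * real_of_int j * real m)) \<le> (\<Sum>m<K. 1)"
      by (rule sum_norm_le) simp
    then show ?thesis by (simp add: norm_divide divide_le_eq)
  qed
  obtain j where j: "j \<noteq> 0" "\<And>K. ?g (- (r $ 2)) K * ?g (r $ 1) K \<le> ?g j K"
  proof (cases "r $ 1 = 0")
    case True
    then have "- (r $ 2) \<noteq> 0" using r by (auto simp: vec_eq_iff forall_2)
    moreover have "?g (- (r $ 2)) K * ?g (r $ 1) K \<le> ?g (- (r $ 2)) K * 1" for K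
      by (intro mult_left_mono bound) simp
    ultimately show ?thesis
      by (intro that[of "- (r $ 2)"]) (simp_all only: mult_1_right not_False_eq_True)
  next
    case False
    moreover have "?g (- (r $ 2)) K * ?g (r $ 1) K \<le> 1 * ?g (r $ 1) K" for K
      by (intro mult_right_mono bound) simp
    ultimately show ?thesis
      by (intro that[of "r $ 1"]) (simp_all only: mult_1_left not_False_eq_True)
  qed
  show ?thesis
    unfolding eq
    by (rule Lim_null_comparison[OF always_eventually tendsto_norm_zero[OF geometric_average_tendsto_0[OF \<theta> j(1)]]])
       (use j(2) in \<open>auto simp: norm_mult norm_divide\<close>)
qed

text \<open>
  An absolutely convergent almost periodic function that tends to zero along the translates \<open>\<nu> t + m\<close>
  of every lattice point \<open>m\<close> vanishes: averaging over large squarees around \<open>\<nu> t\<close> extracts its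
  coefficients, since \<open>\<theta>\<close> is irrational.
\<close>

lemma almost_periodic_eq_0:
  assumes \<theta>: "\<theta> \<notin> \<rat>" and c: "(\<lambda>q. norm (c q)) summable_on UNIV"
    and F: "\<And>m. (\<lambda>t. \<Sum>\<^sub>\<infinity>q. c q * cis (2 * pi * \<theta> * symp q (\<nu> t + m))) \<longlonglongrightarrow> 0"
  shows "c r = 0"
proof (rule ccontr)
  assume "c r \<noteq> 0"
  define \<epsilon> where "\<epsilon> = norm (c r) / 4"
  have \<epsilon>: "0 < \<epsilon>" using \<open>c r \<noteq> 0\<close> by (simp add: \<epsilon>_def)
  let ?e = "\<lambda>q n. cis (2 * pi * \<theta> * symp q n)"
  let ?F = "\<lambda>n. \<Sum>\<^sub>\<infinity>q. c q * ?e q n"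
  obtain Q where Q: "finite Q" "dist (\<Sum>q\<in>Q. norm (c q)) (\<Sum>\<^sub>\<infinity>q. norm (c q)) \<le> \<epsilon>"
    using infsum_finite_approximation[OF c \<epsilon>] by blast
  \<comment> \<open>finitely many frequencies, including \<open>r\<close>, account for the function up to \<open>\<epsilon>\<close>\<close>
  define Q' where "Q' = insert r Q"
  have Q': "finite Q'" "r \<in> Q'" using Q by (auto simp: Q'_def)
  have summ: "(\<lambda>q. c q * ?e q n) summable_on S" for n S
    by (rule abs_summable_summable, rule summable_on_subset_banach[OF _ subset_UNIV]) (use c in \<open>simp add: norm_mult\<close>)
  have c': "(\<lambda>q. norm (c q)) summable_on S" for S
    by (rule summable_on_subset_banach[OF c subset_UNIV])
  have tail: "norm (?F n - (\<Sum>q\<in>Q'. c q * ?e q n)) \<le> \<epsilon>" for n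
  proof -
    have "?F n = (\<Sum>q\<in>Q'. c q * ?e q n) + (\<Sum>\<^sub>\<infinity>q\<in>-Q'. c q * ?e q n)"
      using infsum_Un_disjoint[OF summ[of n Q'] summ[of n "- Q'"]] Q' by (simp add: Compl_partition)
    moreover have "norm (\<Sum>\<^sub>\<infinity>q\<in>-Q'. c q * ?e q n) \<le> (\<Sum>\<^sub>\<infinity>q\<in>-Q'. norm (c q))"
      using norm_infsum_bound[of "\<lambda>q. c q * ?e q n" "- Q'"] c' by (simp add: norm_mult)
    moreover have "(\<Sum>\<^sub>\<infinity>q. norm (c q)) = (\<Sum>q\<in>Q'. norm (c q)) + (\<Sum>\<^sub>\<infinity>q\<in>-Q'. norm (c q))"
      using infsum_Un_disjoint[OF c'[of Q'] c'[of "- Q'"]] Q' by (simp add: Compl_partition)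
    moreover have "(\<Sum>q\<in>Q. norm (c q)) \<le> (\<Sum>q\<in>Q'. norm (c q))"
      unfolding Q'_def by (rule sum_mono2) (use Q in auto)
    ultimately show ?thesis using Q(2) by (simp add: dist_real_def)
  qed
  have "(\<lambda>K. \<Sum>q\<in>Q' - {r}. norm (c q) * (norm (\<Sum>m\<in>square K. ?e (q - r) m) / real K ^ 2))
      \<longlonglongrightarrow> (\<Sum>q\<in>Q' - {r}. norm (c q) * 0)"
    by (intro tendsto_sum tendsto_mult tendsto_const square_average_tendsto_0[OF \<theta>]) auto
  then have "\<forall>\<^sub>F K in sequentially. (\<Sum>q\<in>Q' - {r}. norm (c q) * (norm (\<Sum>m\<in>square K. ?e (q - r) m) / real K ^ 2)) < \<epsilon>"
    by (rule order_tendstoD(2)) (use \<epsilon> in simp)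
  moreover have "\<forall>\<^sub>F K in sequentially. 0 < (K::nat)" by (rule eventually_gt_at_top)
  ultimately have "\<forall>\<^sub>F K in sequentially. 0 < K \<and> (\<Sum>q\<in>Q' - {r}. norm (c q) * (norm (\<Sum>m\<in>square K. ?e (q - r) m) / real K ^ 2)) < \<epsilon>"
    by eventually_elim auto
  \<comment> \<open>a square so large that the averages of the other frequencies are negligible\<close>
  then obtain K where K: "0 < K"
    "(\<Sum>q\<in>Q' - {r}. norm (c q) * (norm (\<Sum>m\<in>square K. ?e (q - r) m) / real K ^ 2)) < \<epsilon>"
    using eventually_happens'[OF sequentially_bot] by blast
  have "(\<lambda>t. \<Sum>m\<in>square K. norm (?F (\<nu> t + m))) \<longlonglongrightarrow> (\<Sum>m\<in>square K. 0)"
    by (intro tendsto_sum tendsto_norm_zero F)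
  then have "\<forall>\<^sub>F t in sequentially. (\<Sum>m\<in>square K. norm (?F (\<nu> t + m))) < \<epsilon>"
    by (rule order_tendstoD(2)) (use \<epsilon> in simp)
  \<comment> \<open>and a position of that square where the function itself is negligible\<close>
  then obtain t where t: "(\<Sum>m\<in>square K. norm (?F (\<nu> t + m))) < \<epsilon>"
    using eventually_happens'[OF sequentially_bot] by blast
  have pointwise: "c r = ?F n * ?e (- r) n - (?F n - (\<Sum>q\<in>Q'. c q * ?e q n)) * ?e (- r) n - (\<Sum>q\<in>Q' - {r}. c q * ?e (q - r) n)" for n
  proof -
    have "?e q n * ?e (- r) n = ?e (q - r) n" for q
      by (simp add: cis_mult symp_def algebra_simps)
    then have "(\<Sum>q\<in>Q'. c q * ?e q n) * ?e (- r) n = (\<Sum>q\<in>Q'. c q * ?e (q - r) n)"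
      by (simp only: sum_distrib_right mult.assoc)
    also have "\<dots> = c r + (\<Sum>q\<in>Q' - {r}. c q * ?e (q - r) n)"
      using Q' by (simp add: sum.remove symp_simps)
    finally show ?thesis by (simp add: algebra_simps)
  qed
  have "real K ^ 2 * norm (c r) = norm (\<Sum>m\<in>square K. c r)"
    by (simp add: card_square norm_mult norm_power)
  also have "(\<Sum>m\<in>square K. c r) = (\<Sum>m\<in>square K. ?F (\<nu> t + m) * ?e (- r) (\<nu> t + m))
      - (\<Sum>m\<in>square K. (?F (\<nu> t + m) - (\<Sum>q\<in>Q'. c q * ?e q (\<nu> t + m))) * ?e (- r) (\<nu> t + m))
      - (\<Sum>m\<in>square K. \<Sum>q\<in>Q' - {r}. c q * ?e (q - r) (\<nu> t + m))"
    unfolding sum_subtractf[symmetric] by (rule sum.cong[OF refl pointwise])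
  also have "norm \<dots> \<le> (\<Sum>m\<in>square K. norm (?F (\<nu> t + m))) + real K ^ 2 * \<epsilon>
     + real K ^ 2 * (\<Sum>q\<in>Q' - {r}. norm (c q) * (norm (\<Sum>m\<in>square K. ?e (q - r) m) / real K ^ 2))"
    (is "norm (?A - ?B - ?C) \<le> ?a + ?b + ?c")
  proof -
    have "norm ?A \<le> ?a"
      by (rule sum_norm_le) (simp add: norm_mult)
    moreover have "norm ?B \<le> (\<Sum>m\<in>square K. \<epsilon>)"
      by (rule sum_norm_le) (simp add: norm_mult tail)
    then have "norm ?B \<le> ?b"
      by (simp add: card_square)
    moreover have "norm ?C \<le> ?c"
    proof -
      have "?C = (\<Sum>q\<in>Q' - {r}. c q * (?e (q - r) (\<nu> t) * (\<Sum>m\<in>square K. ?e (q - r) m)))"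
        by (subst sum.swap) (simp add: symp_simps(3) distrib_left sum_distrib_left cis_mult)
      also have "norm \<dots> \<le> (\<Sum>q\<in>Q' - {r}. norm (c q) * norm (\<Sum>m\<in>square K. ?e (q - r) m))"
        by (rule sum_norm_le) (simp add: norm_mult)
      also have "\<dots> = ?c"
        using K(1) by (simp add: sum_distrib_left)
      finally show ?thesis .
    qed
    ultimately show ?thesis
      using norm_triangle_ineq4[of "?A - ?B" ?C] norm_triangle_ineq4[of ?A ?B] by linarith
  qed
  also have "\<dots> \<le> real K ^ 2 * \<epsilon> + real K ^ 2 * \<epsilon> + real K ^ 2 * \<epsilon>"
  proof -
    have "1 \<le> real K ^ 2" using K(1) by simp
    then have "\<epsilon> \<le> real K ^ 2 * \<epsilon>" using mult_right_mono[of 1 "real K ^ 2" \<epsilon>] \<epsilon> by simp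
    moreover have "?c \<le> real K ^ 2 * \<epsilon>" using K by (intro mult_left_mono) auto
    ultimately show ?thesis using t by linarith
  qed
  finally have "real K ^ 2 * norm (c r) \<le> real K ^ 2 * (3 * \<epsilon>)" by (simp add: algebra_simps)
  then have "norm (c r) \<le> 3 * \<epsilon>" using K(1) by simp
  with \<epsilon> show False by (simp add: \<epsilon>_def)
qed

text \<open>As \<open>\<A>\<close> and \<open>\<A>\<^sup>o\<close> commute, their products \<open>a b\<^sup>o\<close> span the algebra.\<close>

inductive_set LR_span :: "real \<Rightarrow> (nct \<Rightarrow> nct) set" for \<theta> where
  LR: "(\<lambda>\<psi>. Lmul \<theta> a (Rmul \<theta> b \<psi>)) \<in> LR_span \<theta>"
| LR_add: "S \<in> LR_span \<theta> \<Longrightarrow> T \<in> LR_span \<theta> \<Longrightarrow> (\<lambda>\<psi>. S \<psi> + T \<psi>) \<in> LR_span \<theta>"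

lemma LR_span_comp_LR:
  assumes "S \<in> LR_span \<theta>" shows "(\<lambda>\<psi>. S (Lmul \<theta> a (Rmul \<theta> b \<psi>))) \<in> LR_span \<theta>"
  using assms
proof induction
  case (LR c d)
  have "(\<lambda>\<psi>. Lmul \<theta> c (Rmul \<theta> d (Lmul \<theta> a (Rmul \<theta> b \<psi>)))) =
      (\<lambda>\<psi>. Lmul \<theta> (tmult \<theta> c a) (Rmul \<theta> (tmult \<theta> b d) \<psi>))"
    by (simp add: Rmul_Lmul Lmul_Lmul Rmul_Rmul)
  then show ?case by (simp add: LR_span.LR)
next
  case (LR_add S T)
  from LR_span.LR_add[OF LR_add.IH] show ?case .
qed

lemma LR_span_linear: "T \<in> LR_span \<theta> \<Longrightarrow> linear_op T"
proof (induction rule: LR_span.induct)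
  case (LR a b)
  show ?case by (rule linear_op_comp[OF linear_Lmul linear_Rmul])
next
  case (LR_add S T)
  then show ?case
    by (intro linear_opI) (auto simp: linear_op_add linear_op_scale cscale_add_right)
qed

lemma LR_span_comp:
  assumes "T \<in> LR_span \<theta>" "S \<in> LR_span \<theta>" shows "(\<lambda>\<psi>. S (T \<psi>)) \<in> LR_span \<theta>"
  using assms
proof induction
  case (LR a b)
  then show ?case by (rule LR_span_comp_LR)
next
  case (LR_add T T')
  have "(\<lambda>\<psi>. S (T \<psi> + T' \<psi>)) = (\<lambda>\<psi>. S (T \<psi>) + S (T' \<psi>))"
    by (simp add: linear_op_add[OF LR_span_linear[OF LR_add.prems]])
  with LR_span.LR_add[OF LR_add.IH(1)[OF LR_add.prems] LR_add.IH(2)[OF LR_add.prems]]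
  show ?case by (simp only:)
qed

lemma Lmul_unit [simp]: "Lmul \<theta> (U 0) \<psi> = \<psi>" and Rmul_unit [simp]: "Rmul \<theta> (U 0) \<psi> = \<psi>"
  by (simp_all add: Lmul_def Rmul_def)

lemma Ahat_LR_span: "X \<in> Ahat \<theta> \<Longrightarrow> X \<in> LR_span \<theta>"
proof (induction rule: Ahat.induct)
  case (Ahat_A a)
  show ?case using LR[of \<theta> a "U 0"] by simp
next
  case (Ahat_Aop T)
  then obtain b where "T = Rmul \<theta> b" by (auto simp: Aop_def)
  then show ?case using LR[of \<theta> "U 0" b] by simp
next
  case (Ahat_scale T c)
  have "(\<lambda>\<psi>. Lmul \<theta> (cscale c (U 0)) (Rmul \<theta> (U 0) (T \<psi>))) \<in> LR_span \<theta>"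
    by (rule LR_span_comp[OF Ahat_scale.IH LR])
  then show ?case by (simp add: Lmul_scale)
next
  case (Ahat_comp S T)
  then show ?case using LR_span_comp by (simp add: o_def)
qed (auto intro: LR_add)

text \<open>Up to a phase, the entry at distance \<open>r\<close> from the diagonal is an almost periodic function of \<open>n\<close>. The
  coefficient of frequency \<open>0\<close> on the diagonal is \<open>tau a * tau b\<close>.\<close>

lemma coeff_LR_U:
  "coeff (Lmul \<theta> a (Rmul \<theta> b (U n))) (n + r) =
     cis (pi * \<theta> * symp n r) * (\<Sum>\<^sub>\<infinity>q. (cis (pi * \<theta> * symp q r) * coeff a q * coeff b (r - q)) * cis (2 * pi * \<theta> * symp q n))"
proof -
  have R: "coeff (Rmul \<theta> b (U n)) p = cocycle \<theta> n (p - n) * coeff b (p - n)" for p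
  proof -
    have "(\<Sum>\<^sub>\<infinity>m. cocycle \<theta> m (p - m) * coeff (U n) m * coeff b (p - m))
        = (\<Sum>\<^sub>\<infinity>m\<in>{n}. cocycle \<theta> m (p - m) * coeff (U n) m * coeff b (p - m))"
      by (rule infsum_cong_neutral) auto
    then show ?thesis by (simp add: Rmul_def tmult.rep_eq)
  qed
  have term_eq: "cocycle \<theta> q (n + r - q) * coeff a q * coeff (Rmul \<theta> b (U n)) (n + r - q) =
      cis (pi * \<theta> * symp n r) * ((cis (pi * \<theta> * symp q r) * coeff a q * coeff b (r - q)) * cis (2 * pi * \<theta> * symp q n))" for q
  proof -
    have "cocycle \<theta> q (n + r - q) * cocycle \<theta> n (r - q) =
        cis (pi * \<theta> * symp n r) * (cis (pi * \<theta> * symp q r) * cis (2 * pi * \<theta> * symp q n))"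
      by (simp add: cocycle_def symp_def cis_mult algebra_simps)
    moreover have "n + r - q - n = r - q" by simp
    ultimately show ?thesis by (simp add: R mult_ac)
  qed
  show ?thesis
    unfolding Lmul_def tmult.rep_eq term_eq by (rule infsum_cmult_right')
qed

lemma LR_coefficients_summable:
  "(\<lambda>q. norm (cis (pi * \<theta> * symp q r) * coeff a q * coeff b (r - q))) summable_on UNIV"
  using tmult_abs_summable[of 0 r a b] by (simp add: norm_mult)

lemma abs_summable_mult_cis:
  "(\<lambda>q. norm (c q)) summable_on S \<Longrightarrow> (\<lambda>q. c q * cis (x q)) summable_on S"
  by (rule abs_summable_summable) (simp add: norm_mult)

lemma Ahat_almost_periodic:
  assumes "X \<in> Ahat \<theta>"
  obtains c where "(\<lambda>q. norm (c q)) summable_on UNIV"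
    "\<And>n. coeff (X (U n)) (n + r) = cis (pi * \<theta> * symp n r) * (\<Sum>\<^sub>\<infinity>q. c q * cis (2 * pi * \<theta> * symp q n))"
proof -
  have "\<exists>c. (\<lambda>q. norm (c q)) summable_on UNIV \<and> (\<forall>n. coeff (X (U n)) (n + r) =
      cis (pi * \<theta> * symp n r) * (\<Sum>\<^sub>\<infinity>q. c q * cis (2 * pi * \<theta> * symp q n)))"
    using Ahat_LR_span[OF assms]
  proof induction
    case (LR a b)
    show ?case
      by (intro exI[of _ "\<lambda>q. cis (pi * \<theta> * symp q r) * coeff a q * coeff b (r - q)"] conjI allI
          LR_coefficients_summable coeff_LR_U)
  next
    case (LR_add S T)
    then obtain c d where c: "(\<lambda>q. norm (c q)) summable_on UNIV" "\<forall>n. coeff (S (U n)) (n + r) =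
          cis (pi * \<theta> * symp n r) * (\<Sum>\<^sub>\<infinity>q. c q * cis (2 * pi * \<theta> * symp q n))"
      and d: "(\<lambda>q. norm (d q)) summable_on UNIV" "\<forall>n. coeff (T (U n)) (n + r) =
          cis (pi * \<theta> * symp n r) * (\<Sum>\<^sub>\<infinity>q. d q * cis (2 * pi * \<theta> * symp q n))"
      by blast
    have "(\<lambda>q. norm (c q + d q)) summable_on UNIV"
      by (rule summable_on_comparison_test[OF summable_on_add[OF c(1) d(1)]]) (auto simp: norm_triangle_ineq)
    moreover have "\<forall>n. coeff (S (U n) + T (U n)) (n + r) =
          cis (pi * \<theta> * symp n r) * (\<Sum>\<^sub>\<infinity>q. (c q + d q) * cis (2 * pi * \<theta> * symp q n))"
      using c(2) d(2) by (simp add: distrib_right distrib_left infsum_add abs_summable_mult_cis c(1) d(1))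
    ultimately show ?case by (intro exI[of _ "\<lambda>q. c q + d q"] conjI)
  qed
  then show ?thesis using that by blast
qed

lemma Ahat_eq_0I:
  assumes \<theta>: "\<theta> \<notin> \<rat>" and X: "X \<in> Ahat \<theta>"
    and lim: "\<And>m r. (\<lambda>t. coeff (X (U (\<nu> t + m))) (\<nu> t + m + r)) \<longlonglongrightarrow> 0"
  shows "X \<psi> = 0"
proof -
  have "coeff (X (U n)) p = 0" for n p
  proof -
    obtain c where c: "(\<lambda>q. norm (c q)) summable_on UNIV"
      "\<And>m. coeff (X (U m)) (m + (p - n)) =
        cis (pi * \<theta> * symp m (p - n)) * (\<Sum>\<^sub>\<infinity>q. c q * cis (2 * pi * \<theta> * symp q m))"
      by (rule Ahat_almost_periodic[OF X, where r = "p - n"]) blast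
    have "c q = 0" for q
    proof (rule almost_periodic_eq_0[OF \<theta> c(1)])
      fix m
      have "(\<lambda>t. norm (coeff (X (U (\<nu> t + m))) (\<nu> t + m + (p - n)))) \<longlonglongrightarrow> 0"
        using lim by (rule tendsto_norm_zero)
      then show "(\<lambda>t. \<Sum>\<^sub>\<infinity>q. c q * cis (2 * pi * \<theta> * symp q (\<nu> t + m))) \<longlonglongrightarrow> 0"
        unfolding c(2) norm_mult by (simp add: tendsto_norm_zero_iff)
    qed
    then show ?thesis using c(2)[of n] by simp
  qed
  then have "X (U n) = 0" for n by (intro nct_eqI) simp
  then show ?thesis
    using continuous_op_eqI[OF local_op_continuous[OF Ahat_local[OF X]]
        local_op_continuous[OF Ahat_local[OF Ahat_zero]]] by simp
qed

lemma has_sum_finite_sum: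
  fixes f :: "'i \<Rightarrow> 'b \<Rightarrow> 'c :: topological_comm_monoid_add"
  shows "(\<And>i. (f i has_sum s i) A) \<Longrightarrow> ((\<lambda>x. \<Sum>i\<in>I. f i x) has_sum (\<Sum>i\<in>I. s i)) A"
  by (induction I rule: infinite_finite_induct) (auto intro: has_sum_add)

text \<open>The factorised trace is the mean value of the diagonal matrix elements, hence well defined.\<close>

lemma tau_ot_Lmul:
  assumes \<theta>: "\<theta> \<notin> \<rat>" shows "tau_ot \<theta> (Lmul \<theta> a) = tau a"
  unfolding tau_ot_def
proof (rule the_equality)
  show "\<exists>N a' b. Lmul \<theta> a = (\<lambda>\<psi>. \<Sum>i<(N::nat). Lmul \<theta> (a' i) (Rmul \<theta> (b i) \<psi>)) \<and>
      tau a = (\<Sum>i<N. tau (a' i) * tau (b i))"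
    by (intro exI[of _ 1] exI[of _ "\<lambda>_. a"] exI[of _ "\<lambda>_. U 0"]) (simp add: tau_def)
  fix c
  assume "\<exists>N a' b. Lmul \<theta> a = (\<lambda>\<psi>. \<Sum>i<(N::nat). Lmul \<theta> (a' i) (Rmul \<theta> (b i) \<psi>)) \<and>
      c = (\<Sum>i<N. tau (a' i) * tau (b i))"
  then obtain N :: nat and a' b where rep: "Lmul \<theta> a = (\<lambda>\<psi>. \<Sum>i<N. Lmul \<theta> (a' i) (Rmul \<theta> (b i) \<psi>))"
    and c: "c = (\<Sum>i<N. tau (a' i) * tau (b i))" by blast
  define C where "C = (\<lambda>a b q. cis (pi * \<theta> * symp q 0) * coeff a q * coeff b (0 - q))"
  have S: "(\<lambda>q. norm (C a b q)) summable_on UNIV" for a b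
    unfolding C_def by (rule LR_coefficients_summable)
  note S' = abs_summable_mult_cis[OF S]
  have U: "coeff (Lmul \<theta> a (Rmul \<theta> b (U n))) n = (\<Sum>\<^sub>\<infinity>q. C a b q * cis (2 * pi * \<theta> * symp q n))" for a b n
    using coeff_LR_U[of \<theta> a b n 0] by (simp add: C_def symp_simps)
  have "(\<Sum>i<N. C (a' i) (b i) 0) - C a (U 0) 0 = 0"
  proof (rule almost_periodic_eq_0[OF \<theta>, where c = "\<lambda>q. (\<Sum>i<N. C (a' i) (b i) q) - C a (U 0) q" and \<nu> = "\<lambda>_. 0"])
    have "(\<lambda>q. (\<Sum>i<N. norm (C (a' i) (b i) q)) + norm (C a (U 0) q)) summable_on UNIV"
      by (intro summable_on_add S has_sum_imp_summable[OF has_sum_finite_sum[OF has_sum_infsum[OF S]]])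
    then show "(\<lambda>q. norm ((\<Sum>i<N. C (a' i) (b i) q) - C a (U 0) q)) summable_on UNIV"
      by (rule summable_on_comparison_test)
         (auto intro!: order_trans[OF norm_triangle_ineq4] add_mono norm_sum)
    have "(\<Sum>\<^sub>\<infinity>q. ((\<Sum>i<N. C (a' i) (b i) q) - C a (U 0) q) * cis (2 * pi * \<theta> * symp q n)) = 0" for n
    proof (rule infsumI)
      have H: "((\<lambda>q. C a b q * cis (2 * pi * \<theta> * symp q n)) has_sum coeff (Lmul \<theta> a (Rmul \<theta> b (U n))) n) UNIV" for a b
        unfolding U by (rule has_sum_infsum[OF S'])
      have "((\<lambda>q. (\<Sum>i<N. C (a' i) (b i) q * cis (2 * pi * \<theta> * symp q n)) + - (C a (U 0) q * cis (2 * pi * \<theta> * symp q n)))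
        has_sum (\<Sum>i<N. coeff (Lmul \<theta> (a' i) (Rmul \<theta> (b i) (U n))) n) + - coeff (Lmul \<theta> a (Rmul \<theta> (U 0) (U n))) n) UNIV"
        by (intro has_sum_add has_sum_finite_sum has_sum_uminusI H)
      moreover have "(\<Sum>i<N. coeff (Lmul \<theta> (a' i) (Rmul \<theta> (b i) (U n))) n) = coeff (Lmul \<theta> a (U n)) n"
        by (simp only: fun_cong[OF rep]) simp
      ultimately show "((\<lambda>q. ((\<Sum>i<N. C (a' i) (b i) q) - C a (U 0) q) * cis (2 * pi * \<theta> * symp q n)) has_sum 0) UNIV"
        by (simp add: left_diff_distrib sum_distrib_right)
    qed
    then show "(\<lambda>t. \<Sum>\<^sub>\<infinity>q. ((\<Sum>i<N. C (a' i) (b i) q) - C a (U 0) q) * cis (2 * pi * \<theta> * symp q (0 + m))) \<longlonglongrightarrow> 0" for m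
      by simp
  qed
  then show "c = tau a"
    by (simp add: c C_def tau_def symp_simps)
qed

section \<open>Uniqueness of symbols\<close>

text \<open>Lattice points going to infinity in the direction \<open>u\<close>.\<close>

definition ray :: "real^2 \<Rightarrow> nat \<Rightarrow> int^2" where
  "ray u t = (\<chi> a. \<lfloor>real t * u $ a\<rfloor>)"

lemma ray_direction_tendsto: "(\<lambda>t. (1 / real t) *\<^sub>R emb (ray u t + m)) \<longlonglongrightarrow> u"
proof (rule vec_tendstoI)
  fix a
  have "(\<lambda>t. ((1 / real t) *\<^sub>R emb (ray u t + m)) $ a - u $ a) \<longlonglongrightarrow> 0"
  proof (rule Lim_null_comparison)
    show "\<forall>\<^sub>F t in sequentially. norm (((1 / real t) *\<^sub>R emb (ray u t + m)) $ a - u $ a)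
        \<le> (1 + \<bar>real_of_int (m $ a)\<bar>) * (1 / real t)"
      using eventually_gt_at_top[of 0]
    proof eventually_elim
      case (elim t)
      have "\<bar>real_of_int (\<lfloor>real t * u $ a\<rfloor> + m $ a) - real t * u $ a\<bar> \<le> 1 + \<bar>real_of_int (m $ a)\<bar>"
        using floor_correct[of "real t * u $ a"] by linarith
      then have "\<bar>real_of_int (\<lfloor>real t * u $ a\<rfloor> + m $ a) - real t * u $ a\<bar> / real t \<le> (1 + \<bar>real_of_int (m $ a)\<bar>) / real t"
        by (rule divide_right_mono) simp
      moreover have "((1 / real t) *\<^sub>R emb (ray u t + m)) $ a - u $ a = (real_of_int (\<lfloor>real t * u $ a\<rfloor> + m $ a) - real t * u $ a) / real t"
        using elim by (simp add: emb_def ray_def diff_divide_distrib)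
      ultimately show ?case
        by (simp add: abs_divide)
    qed
    show "(\<lambda>t. (1 + \<bar>real_of_int (m $ a)\<bar>) * (1 / real t)) \<longlonglongrightarrow> 0"
      by (intro tendsto_mult_right_zero lim_1_over_n)
  qed
  then show "(\<lambda>t. ((1 / real t) *\<^sub>R emb (ray u t + m)) $ a) \<longlonglongrightarrow> u $ a"
    by (rule LIM_zero_cancel)
qed

lemma ray_limits:
  assumes u: "norm u = 1"
  shows "\<forall>\<^sub>F t in sequentially. ray u t + m \<noteq> 0"
    and "(\<lambda>t. 1 / norm (emb (ray u t + m))) \<longlonglongrightarrow> 0"
    and "(\<lambda>t. (1 / norm (emb (ray u t + m))) *\<^sub>R emb (ray u t + m)) \<longlonglongrightarrow> u"
proof -
  let ?x = "\<lambda>t. (1 / real t) *\<^sub>R emb (ray u t + m)"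
  have n: "(\<lambda>t. norm (?x t)) \<longlonglongrightarrow> 1"
    using tendsto_norm[OF ray_direction_tendsto[of u m]] u by simp
  then have "\<forall>\<^sub>F t in sequentially. 0 < norm (?x t)"
    by (rule order_tendstoD(1)) simp
  then show nz: "\<forall>\<^sub>F t in sequentially. ray u t + m \<noteq> 0"
    by eventually_elim auto
  have "(\<lambda>t. (1 / real t) * inverse (norm (?x t))) \<longlonglongrightarrow> 0 * inverse 1"
    by (intro tendsto_mult lim_1_over_n tendsto_inverse n) simp
  then have "(\<lambda>t. (1 / real t) * inverse (norm (?x t))) \<longlonglongrightarrow> 0" by simp
  then show "(\<lambda>t. 1 / norm (emb (ray u t + m))) \<longlonglongrightarrow> 0"
  proof (rule Lim_transform_eventually)
    show "\<forall>\<^sub>F t in sequentially. (1 / real t) * inverse (norm (?x t)) = 1 / norm (emb (ray u t + m))"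
      using eventually_gt_at_top[of 0] by eventually_elim (simp add: field_simps)
  qed
  have "(\<lambda>t. inverse (norm (?x t)) *\<^sub>R ?x t) \<longlonglongrightarrow> inverse 1 *\<^sub>R u"
    by (intro tendsto_scaleR tendsto_inverse n ray_direction_tendsto) simp
  then have "(\<lambda>t. inverse (norm (?x t)) *\<^sub>R ?x t) \<longlonglongrightarrow> u" by simp
  then show "(\<lambda>t. (1 / norm (emb (ray u t + m))) *\<^sub>R emb (ray u t + m)) \<longlonglongrightarrow> u"
  proof (rule Lim_transform_eventually)
    show "\<forall>\<^sub>F t in sequentially. inverse (norm (?x t)) *\<^sub>R ?x t = (1 / norm (emb (ray u t + m))) *\<^sub>R emb (ray u t + m)"
      using eventually_gt_at_top[of 0] by eventually_elim (simp add: field_simps)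
  qed
qed

text \<open>Matrix entries of a symbol at \<open>\<xi>\<close>, which depend continuously on \<open>\<xi>\<close> uniformly in the column.\<close>

definition continuous_entry :: "real \<Rightarrow> (real^2 \<Rightarrow> nct \<Rightarrow> nct) \<Rightarrow> real^2 \<Rightarrow> bool" where
  "continuous_entry \<theta> Y u \<longleftrightarrow> Y u \<in> Ahat \<theta> \<and>
     (\<exists>h. (h \<longlongrightarrow> (0::real)) (nhds u) \<and> (\<forall>\<eta> n p. norm (coeff (Y \<eta> (U n) - Y u (U n)) p) \<le> h \<eta>))"

lemma continuous_entry_diff:
  assumes "continuous_entry \<theta> Y u" "continuous_entry \<theta> Z u"
  shows "continuous_entry \<theta> (\<lambda>\<eta> \<psi>. Y \<eta> \<psi> - Z \<eta> \<psi>) u"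
proof -
  obtain g where g: "(g \<longlongrightarrow> 0) (nhds u)" "\<And>\<eta> n p. norm (coeff (Y \<eta> (U n) - Y u (U n)) p) \<le> g \<eta>"
    and Y: "Y u \<in> Ahat \<theta>"
    using assms(1) unfolding continuous_entry_def by blast
  obtain h where h: "(h \<longlongrightarrow> 0) (nhds u)" "\<And>\<eta> n p. norm (coeff (Z \<eta> (U n) - Z u (U n)) p) \<le> h \<eta>"
    and Z: "Z u \<in> Ahat \<theta>"
    using assms(2) unfolding continuous_entry_def by blast
  have "((\<lambda>\<eta>. g \<eta> + h \<eta>) \<longlongrightarrow> 0) (nhds u)"
    using tendsto_add[OF g(1) h(1)] by simp
  moreover have "norm (coeff ((Y \<eta> (U n) - Z \<eta> (U n)) - (Y u (U n) - Z u (U n))) p) \<le> g \<eta> + h \<eta>" for \<eta> n p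
  proof -
    have "coeff ((Y \<eta> (U n) - Z \<eta> (U n)) - (Y u (U n) - Z u (U n))) p
        = coeff (Y \<eta> (U n) - Y u (U n)) p - coeff (Z \<eta> (U n) - Z u (U n)) p"
      by simp
    also have "norm \<dots> \<le> g \<eta> + h \<eta>"
      by (rule order_trans[OF norm_triangle_ineq4 add_mono[OF g(2) h(2)]])
    finally show ?thesis .
  qed
  moreover have "(\<lambda>\<psi>. Y u \<psi> - Z u \<psi>) \<in> Ahat \<theta>"
    using Ahat_add[OF Y Ahat_scale[OF Z, of "-1"]] by (simp add: cscale_minus_one)
  ultimately show ?thesis
    unfolding continuous_entry_def by (intro conjI exI[of _ "\<lambda>\<eta>. g \<eta> + h \<eta>"]) auto
qed

text \<open>Along a lattice ray in the direction \<open>u\<close> the entries of \<open>Y u\<close> tend to zero, hence vanish by almost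
  periodicity.\<close>

lemma continuous_entry_eq_0:
  assumes \<theta>: "\<theta> \<notin> \<rat>" and u: "norm u = 1" and Y: "continuous_entry \<theta> Y u"
    and small: "\<And>n p. n \<noteq> 0 \<Longrightarrow> norm (coeff (Y ((1 / norm (emb n)) *\<^sub>R emb n) (U n)) p) \<le> C * (1 / norm (emb n))"
  shows "Y u \<psi> = 0"
proof -
  obtain h where h: "(h \<longlongrightarrow> 0) (nhds u)" "\<And>\<eta> n p. norm (coeff (Y \<eta> (U n) - Y u (U n)) p) \<le> h \<eta>"
    and Yu: "Y u \<in> Ahat \<theta>"
    using Y unfolding continuous_entry_def by blast
  show ?thesis
  proof (rule Ahat_eq_0I[OF \<theta> Yu, where \<nu> = "ray u"])
    fix m r
    let ?n = "\<lambda>t. ray u t + m" and ?\<eta> = "\<lambda>t. (1 / norm (emb (ray u t + m))) *\<^sub>R emb (ray u t + m)"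
    show "(\<lambda>t. coeff (Y u (U (?n t))) (?n t + r)) \<longlonglongrightarrow> 0"
    proof (rule Lim_null_comparison)
      show "\<forall>\<^sub>F t in sequentially. norm (coeff (Y u (U (?n t))) (?n t + r)) \<le> C * (1 / norm (emb (?n t))) + h (?\<eta> t)"
        using ray_limits(1)[OF u, of m]
      proof eventually_elim
        case (elim t)
        have "norm (coeff (Y u (U (?n t))) (?n t + r)) \<le> norm (coeff (Y (?\<eta> t) (U (?n t))) (?n t + r))
            + norm (coeff (Y (?\<eta> t) (U (?n t)) - Y u (U (?n t))) (?n t + r))"
          using norm_triangle_sub[of "coeff (Y u (U (?n t))) (?n t + r)" "coeff (Y (?\<eta> t) (U (?n t))) (?n t + r)"]
          by (simp add: norm_minus_commute)
        also have "\<dots> \<le> C * (1 / norm (emb (?n t))) + h (?\<eta> t)"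
          by (intro add_mono small elim h(2))
        finally show ?case .
      qed
      have "(\<lambda>t. h (?\<eta> t)) \<longlonglongrightarrow> 0"
        by (rule filterlim_compose[OF h(1) ray_limits(3)[OF u]])
      with tendsto_mult_right_zero[OF ray_limits(2)[OF u, of m], of C]
      show "(\<lambda>t. C * (1 / norm (emb (?n t))) + h (?\<eta> t)) \<longlonglongrightarrow> 0"
        using tendsto_add by fastforce
    qed
  qed
qed

lemma homogeneous_symbol_entries:
  assumes s: "homogeneous_symbol \<theta> d s"
  obtains Y where "\<And>\<xi> \<psi> i. \<xi> \<noteq> 0 \<Longrightarrow> s \<xi> \<psi> $ i = (\<Sum>j\<in>UNIV. Y i j \<xi> (\<psi> $ j))"
    "\<And>i j u. u \<noteq> 0 \<Longrightarrow> continuous_entry \<theta> (Y i j) u"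
proof -
  obtain N f T where fT: "\<And>l. l < (N::nat) \<Longrightarrow> smooth_off_zero (f l)" "\<And>l. l < N \<Longrightarrow> T l \<in> M2Ahat \<theta>"
    and s: "\<And>\<xi> \<psi> i. \<xi> \<noteq> 0 \<Longrightarrow> s \<xi> \<psi> $ i = (\<Sum>l<N. cscale (f l \<xi>) (T l \<psi> $ i))"
    using s unfolding homogeneous_symbol_def by blast
  have "\<exists>M. T l = (\<lambda>\<psi>. \<chi> i. \<Sum>j\<in>UNIV. M i j (\<psi> $ j)) \<and> (\<forall>i j. M i j \<in> Ahat \<theta>)" if "l < N" for l
    using fT(2)[OF that] unfolding M2Ahat_def by blast
  then have "\<forall>l\<in>{..<N}. \<exists>M. T l = (\<lambda>\<psi>. \<chi> i. \<Sum>j\<in>UNIV. M i j (\<psi> $ j)) \<and> (\<forall>i j. M i j \<in> Ahat \<theta>)"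
    by blast
  from bchoice[OF this] obtain M where "\<forall>l\<in>{..<N}. T l = (\<lambda>\<psi>. \<chi> i. \<Sum>j\<in>UNIV. M l i j (\<psi> $ j)) \<and> (\<forall>i j. M l i j \<in> Ahat \<theta>)"
    by (elim exE)
  then have M: "\<And>l. l < N \<Longrightarrow> T l = (\<lambda>\<psi>. \<chi> i. \<Sum>j\<in>UNIV. M l i j (\<psi> $ j))"
    "\<And>l i j. l < N \<Longrightarrow> M l i j \<in> Ahat \<theta>"
    by blast+
  define Y where "Y = (\<lambda>i j \<xi> \<phi>. \<Sum>l<N. cscale (f l \<xi>) (M l i j \<phi>))"
  have "s \<xi> \<psi> $ i = (\<Sum>j\<in>UNIV. Y i j \<xi> (\<psi> $ j))" if "\<xi> \<noteq> 0" for \<xi> \<psi> i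
  proof -
    have "s \<xi> \<psi> $ i = (\<Sum>l<N. cscale (f l \<xi>) (\<Sum>j\<in>UNIV. M l i j (\<psi> $ j)))"
      using s[OF that] M(1) by simp
    also have "\<dots> = (\<Sum>j\<in>UNIV. Y i j \<xi> (\<psi> $ j))"
      unfolding Y_def cscale_sum_right by (rule sum.swap)
    finally show ?thesis .
  qed
  moreover have "continuous_entry \<theta> (Y i j) u" if u: "u \<noteq> 0" for i j u
  proof -
    have "\<exists>B. \<forall>n p. norm (coeff (M l i j (U n)) p) \<le> B" if l: "l < N" for l
    proof -
      obtain B where B: "0 \<le> B" "\<And>q C b p. (\<And>p. wt (p - q) ^ 0 * norm (coeff b p) \<le> C) \<Longrightarrow>
          wt (p - q) ^ 0 * norm (coeff (M l i j b) p) \<le> B * C"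
        by (rule local_opE[OF Ahat_local[OF M(2)[OF l, of i j]], where s = 0]) blast
      have "norm (coeff (M l i j (U n)) p) \<le> B * 1" for n p
        using B(2)[of 0 "U n" 1 p] by simp
      then show ?thesis by blast
    qed
    then obtain B where B: "\<And>l n p. l < N \<Longrightarrow> norm (coeff (M l i j (U n)) p) \<le> B l"
      by metis
    define h where "h = (\<lambda>\<eta>. \<Sum>l<N. norm (f l \<eta> - f l u) * B l)"
    have "isCont (f l) u" if "l < N" for l
    proof -
      have "foldr pd [] (f l) differentiable_on (- {0})"
        using fT(1)[OF that] unfolding smooth_off_zero_def by blast
      then have "continuous_on (- {0}) (f l)"
        using differentiable_imp_continuous_on by simp
      then show ?thesis using u by (simp add: continuous_on_eq_continuous_at open_Compl)
    qed
    then have "((\<lambda>\<eta>. \<Sum>l<N. norm (f l \<eta> - f l u) * B l) \<longlongrightarrow> (\<Sum>l<N. norm (f l u - f l u) * B l)) (nhds u)"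
      by (intro tendsto_intros) (auto simp: isCont_def tendsto_at_iff_tendsto_nhds)
    then have "(h \<longlongrightarrow> 0) (nhds u)" by (simp add: h_def)
    moreover have "norm (coeff (Y i j \<eta> (U n) - Y i j u (U n)) p) \<le> h \<eta>" for \<eta> n p
    proof -
      have "coeff (Y i j \<eta> (U n) - Y i j u (U n)) p = (\<Sum>l<N. (f l \<eta> - f l u) * coeff (M l i j (U n)) p)"
        by (simp add: Y_def left_diff_distrib sum_subtractf)
      also have "norm \<dots> \<le> h \<eta>"
        unfolding h_def by (rule sum_norm_le) (auto simp: norm_mult intro!: mult_left_mono B)
      finally show ?thesis .
    qed
    moreover have "Y i j u \<in> Ahat \<theta>"
      unfolding Y_def by (intro Ahat_sum Ahat_scale M(2)) auto
    ultimately show ?thesis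
      unfolding continuous_entry_def by blast
  qed
  ultimately show ?thesis by (rule that)
qed

text \<open>Rescaling by homogeneity to the unit circle, a difference of order \<open>d - 1\<close> becomes one of order
  \<open>1/\<bar>n\<bar>\<close>.\<close>

lemma homogeneous_symbol_eqI:
  assumes \<theta>: "\<theta> \<notin> \<rat>" and s: "homogeneous_symbol \<theta> d s" "homogeneous_symbol \<theta> d s'"
    and small: "\<And>n i j p. n \<noteq> 0 \<Longrightarrow>
      norm (coeff ((s (emb n) (axis j (U n)) - s' (emb n) (axis j (U n))) $ i) p) \<le> C * norm (emb n) powi (d - 1)"
    and \<xi>: "\<xi> \<noteq> 0"
  shows "s \<xi> \<psi> = s' \<xi> \<psi>"
proof -
  obtain Y where Y: "\<And>\<xi> \<psi> i. \<xi> \<noteq> 0 \<Longrightarrow> s \<xi> \<psi> $ i = (\<Sum>j\<in>UNIV. Y i j \<xi> (\<psi> $ j))"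
    "\<And>i j u. u \<noteq> 0 \<Longrightarrow> continuous_entry \<theta> (Y i j) u"
    by (rule homogeneous_symbol_entries[OF s(1)]) blast
  obtain Z where Z: "\<And>\<xi> \<psi> i. \<xi> \<noteq> 0 \<Longrightarrow> s' \<xi> \<psi> $ i = (\<Sum>j\<in>UNIV. Z i j \<xi> (\<psi> $ j))"
    "\<And>i j u. u \<noteq> 0 \<Longrightarrow> continuous_entry \<theta> (Z i j) u"
    by (rule homogeneous_symbol_entries[OF s(2)]) blast
  define u where "u = (1 / norm \<xi>) *\<^sub>R \<xi>"
  have u: "norm u = 1" "u \<noteq> 0" "\<xi> = norm \<xi> *\<^sub>R u"
    using \<xi> by (auto simp: u_def)
  have scale: "s (t *\<^sub>R \<xi>) \<psi> $ i = cscale (of_real (t powi d)) (s \<xi> \<psi> $ i)"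
    "s' (t *\<^sub>R \<xi>) \<psi> $ i = cscale (of_real (t powi d)) (s' \<xi> \<psi> $ i)" if "\<xi> \<noteq> 0" "0 < t" for \<xi> t \<psi> i
    using s[unfolded homogeneous_symbol_def, THEN conjunct2] that by blast+
  have ax: "(\<Sum>k\<in>UNIV. W i k \<eta> (axis j \<phi> $ k)) = W i j \<eta> \<phi>"
    if W: "\<And>k. W i k \<eta> 0 = 0" for W :: "2 \<Rightarrow> 2 \<Rightarrow> real^2 \<Rightarrow> nct \<Rightarrow> nct" and i j \<eta> \<phi>
  proof -
    have "(\<Sum>k\<in>UNIV. W i k \<eta> (axis j \<phi> $ k)) = (\<Sum>k\<in>UNIV. if k = j then W i j \<eta> \<phi> else 0)"
      by (rule sum.cong) (auto simp: axis_def W)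
    then show ?thesis by simp
  qed
  have Y0: "Y i j \<eta> 0 = 0" "Z i j \<eta> 0 = 0" if "\<eta> \<noteq> 0" for i j \<eta>
    using Y(2)[OF that, of i j] Z(2)[OF that, of i j] unfolding continuous_entry_def
    by (auto dest!: Ahat_local local_op_linear linear_op_0)
  have "Y i j u \<phi> - Z i j u \<phi> = 0" for i j \<phi>
  proof (rule continuous_entry_eq_0[OF \<theta> u(1) continuous_entry_diff[OF Y(2) Z(2)], where C = C])
    fix n p assume n: "(n :: int^2) \<noteq> 0"
    define t \<eta> where "t = norm (emb n)" and "\<eta> = (1 / norm (emb n)) *\<^sub>R emb n"
    have t: "0 < t" "\<eta> \<noteq> 0" "emb n = t *\<^sub>R \<eta>"
      using n by (auto simp: t_def \<eta>_def)
    have eq: "(s (emb n) (axis j (U n)) - s' (emb n) (axis j (U n))) $ i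
       = cscale (of_real (t powi d)) (Y i j \<eta> (U n) - Z i j \<eta> (U n))"
      by (simp add: t(3) scale[OF t(2,1)] Y(1)[OF t(2)] Z(1)[OF t(2)] ax Y0[OF t(2)] cscale_diff_right)
    have "norm (of_real (t powi d) * coeff (Y i j \<eta> (U n) - Z i j \<eta> (U n)) p) \<le> C * t powi (d - 1)"
      using small[OF n, of j i p] unfolding eq cscale.rep_eq t_def .
    then have "t powi d * norm (coeff (Y i j \<eta> (U n) - Z i j \<eta> (U n)) p) \<le> C * t powi (d - 1)"
      using t(1) by (simp add: norm_mult norm_power_int)
    also have "\<dots> = t powi d * (C * (1 / t))"
      using t(1) by (simp add: power_int_diff)
    finally have "norm (coeff (Y i j \<eta> (U n) - Z i j \<eta> (U n)) p) \<le> C * (1 / t)"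
      by (rule mult_left_le_imp_le) (use t(1) in simp)
    then show "norm (coeff (Y i j ((1 / norm (emb n)) *\<^sub>R emb n) (U n) - Z i j ((1 / norm (emb n)) *\<^sub>R emb n) (U n)) p)
        \<le> C * (1 / norm (emb n))"
      unfolding t_def \<eta>_def .
  qed (use u in auto)
  then have "s u \<psi> = s' u \<psi>"
    by (simp add: vec_eq_iff Y(1)[OF u(2)] Z(1)[OF u(2)])
  then show ?thesis
    using scale[OF u(2), of "norm \<xi>"] \<xi> by (subst (1 2) u(3)) (simp add: vec_eq_iff)
qed

text \<open>By descending induction on the degree: once all higher components agree, those of degree \<open>e\<close> differ by
  the remainders of order \<open>e - 1\<close>.\<close>

lemma has_symbol_unique:
  assumes \<theta>: "\<theta> \<notin> \<rat>" and "has_symbol \<theta> P \<sigma>" "has_symbol \<theta> P \<sigma>'" "\<xi> \<noteq> 0"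
  shows "\<sigma> d \<xi> \<psi> = \<sigma>' d \<xi> \<psi>"
proof -
  let ?B = "\<lambda>\<sigma> N m C. \<forall>n i j p. n \<noteq> 0 \<longrightarrow> norm (coeff ((P (axis j (U n)) -
      (\<Sum>d=N..m. \<sigma> d (emb n) (axis j (U n)))) $ i) p) \<le> C * norm (emb n) powi (N - 1)"
  have E: "\<exists>m. (\<forall>d>m. \<forall>\<xi>. \<xi> \<noteq> 0 \<longrightarrow> (\<forall>\<psi>. \<sigma> d \<xi> \<psi> = 0)) \<and> (\<forall>m'\<ge>m. \<forall>N. \<exists>C. ?B \<sigma> N m' C)"
    if \<sigma>: "has_symbol \<theta> P \<sigma>" for \<sigma>
  proof -
    obtain m where m: "\<forall>d>m. \<forall>\<xi>. \<xi> \<noteq> 0 \<longrightarrow> (\<forall>\<psi>. \<sigma> d \<xi> \<psi> = 0)"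
      and B: "\<forall>N. \<forall>s::nat. \<exists>C. \<forall>n i j p. n \<noteq> 0 \<longrightarrow> wt (p - n) ^ s *
        norm (coeff ((P (axis j (U n)) - (\<Sum>d=N..m. \<sigma> d (emb n) (axis j (U n)))) $ i) p) \<le> C * norm (emb n) powi (N - 1)"
      using \<sigma> unfolding has_symbol_def by (elim conjE exE) (rule that)
    have ext: "(\<Sum>d=N..m'. \<sigma> d (emb n) \<psi>) = (\<Sum>d=N..m. \<sigma> d (emb n) \<psi>)" if "m \<le> m'" "n \<noteq> 0" for m' N n \<psi>
      by (rule sum_symbol_extend) (use m that in auto)
    show ?thesis
    proof (intro exI[of _ m] conjI m allI impI)
      fix m' N assume m': "m \<le> m'"
      obtain C where C: "\<forall>n i j p. n \<noteq> 0 \<longrightarrow> wt (p - n) ^ 0 *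
        norm (coeff ((P (axis j (U n)) - (\<Sum>d=N..m. \<sigma> d (emb n) (axis j (U n)))) $ i) p) \<le> C * norm (emb n) powi (N - 1)"
        using B[THEN spec, of N, THEN spec, of 0] by (elim exE) (rule that)
      show "\<exists>C. ?B \<sigma> N m' C"
      proof (intro exI[of _ C] allI impI)
        fix n i j p assume n: "(n :: int^2) \<noteq> 0"
        show "norm (coeff ((P (axis j (U n)) - (\<Sum>d=N..m'. \<sigma> d (emb n) (axis j (U n)))) $ i) p) \<le> C * norm (emb n) powi (N - 1)"
          using C[THEN spec, THEN spec, THEN spec, THEN spec, THEN mp, OF n, of p j i]
          unfolding ext[OF m' n] by simp
      qed
    qed
  qed
  obtain m1 where 1: "\<forall>d>m1. \<forall>\<xi>. \<xi> \<noteq> 0 \<longrightarrow> (\<forall>\<psi>. \<sigma> d \<xi> \<psi> = 0)"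
    "\<forall>m'\<ge>m1. \<forall>N. \<exists>C. ?B \<sigma> N m' C"
    using E[OF assms(2)] by (elim exE conjE) (rule that)
  obtain m2 where 2: "\<forall>d>m2. \<forall>\<xi>. \<xi> \<noteq> 0 \<longrightarrow> (\<forall>\<psi>. \<sigma>' d \<xi> \<psi> = 0)"
    "\<forall>m'\<ge>m2. \<forall>N. \<exists>C. ?B \<sigma>' N m' C"
    using E[OF assms(3)] by (elim exE conjE) (rule that)
  define m where "m = max m1 m2"
  have "\<forall>\<xi> \<psi>. \<xi> \<noteq> 0 \<longrightarrow> \<sigma> (m - int k) \<xi> \<psi> = \<sigma>' (m - int k) \<xi> \<psi>" for k
  proof (induction k rule: less_induct)
    case (less k)
    define e where "e = m - int k"
    have "\<exists>C. ?B \<sigma> e m C"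
      by (rule 1(2)[THEN spec, THEN mp, THEN spec]) (simp add: m_def)
    then obtain C1 where "?B \<sigma> e m C1"
      by (elim exE)
    note C1 = this[rule_format]
    have "\<exists>C. ?B \<sigma>' e m C"
      by (rule 2(2)[THEN spec, THEN mp, THEN spec]) (simp add: m_def)
    then obtain C2 where "?B \<sigma>' e m C2"
      by (elim exE)
    note C2 = this[rule_format]
    have "\<sigma> e \<xi> \<psi> = \<sigma>' e \<xi> \<psi>" if "\<xi> \<noteq> 0" for \<xi> \<psi>
    proof (rule homogeneous_symbol_eqI[OF \<theta> _ _ _ that, where s = "\<sigma> e" and s' = "\<sigma>' e" and d = e and C = "C2 + C1"])
      show "homogeneous_symbol \<theta> e (\<sigma> e)"
        by (rule assms(2)[unfolded has_symbol_def, THEN conjunct2, THEN conjunct1, THEN spec])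
      show "homogeneous_symbol \<theta> e (\<sigma>' e)"
        by (rule assms(3)[unfolded has_symbol_def, THEN conjunct2, THEN conjunct1, THEN spec])
      fix n i j p assume n: "(n :: int^2) \<noteq> 0"
      let ?a = "axis j (U n) :: nct^2"
      have IH: "\<sigma> d (emb n) ?a = \<sigma>' d (emb n) ?a" if "d \<in> {e<..m}" for d
      proof -
        have "nat (m - d) < k" "m - int (nat (m - d)) = d"
          using that unfolding e_def by auto
        with less[of "nat (m - d)"] n show ?thesis by simp
      qed
      have split: "{e..m} = insert e {e<..m}" by (auto simp: e_def)
      have S: "(\<Sum>d=e..m. \<rho> d (emb n) ?a) = \<rho> e (emb n) ?a + (\<Sum>d\<in>{e<..m}. \<rho> d (emb n) ?a)"
        for \<rho> :: "int \<Rightarrow> real^2 \<Rightarrow> nct^2 \<Rightarrow> nct^2"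
        unfolding split by (rule sum.insert) auto
      have "(\<Sum>d\<in>{e<..m}. \<sigma> d (emb n) ?a) = (\<Sum>d\<in>{e<..m}. \<sigma>' d (emb n) ?a)"
        by (rule sum.cong[OF refl IH])
      then have "coeff ((\<sigma> e (emb n) ?a - \<sigma>' e (emb n) ?a) $ i) p =
          coeff ((P ?a - (\<Sum>d=e..m. \<sigma>' d (emb n) ?a)) $ i) p - coeff ((P ?a - (\<Sum>d=e..m. \<sigma> d (emb n) ?a)) $ i) p"
        by (simp add: S)
      also have "norm \<dots> \<le> (C2 + C1) * norm (emb n) powi (e - 1)"
        unfolding distrib_right by (rule order_trans[OF norm_triangle_ineq4 add_mono[OF C2[OF n] C1[OF n]]])
      finally show "norm (coeff ((\<sigma> e (emb n) ?a - \<sigma>' e (emb n) ?a) $ i) p) \<le> (C2 + C1) * norm (emb n) powi (e - 1)" .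
    qed
    then show ?case by (simp add: e_def)
  qed
  from this[of "nat (m - d)"] show ?thesis
    using 1(1) 2(1) \<open>\<xi> \<noteq> 0\<close> by (cases "d \<le> m") (auto simp: m_def)
qed

lemma wodzicki_eq:
  assumes "\<theta> \<notin> \<rat>" "has_symbol \<theta> P \<sigma>"
  shows "wodzicki \<theta> P = 1 / (4 * pi) * tau_ot \<theta> (circle_integral (\<lambda>\<xi>. mtrace (\<sigma> (-2) \<xi>)))"
proof -
  have S: "has_symbol \<theta> P (symbol_of \<theta> P)"
    unfolding symbol_of_def by (rule someI[where P = "has_symbol \<theta> P", OF assms(2)])
  have nz: "(vector [cos t, sin t] :: real^2) \<noteq> 0" for t :: real
  proof
    assume "(vector [cos t, sin t] :: real^2) = 0"
    then have "cos t = 0" "sin t = 0" by (simp_all add: vec_eq_iff forall_2)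
    then show False using sin_cos_squared_add[of t] by simp
  qed
  have "mtrace (symbol_of \<theta> P (-2) (vector [cos t, sin t])) = mtrace (\<sigma> (-2) (vector [cos t, sin t]))" for t
    by (rule arg_cong[where f = mtrace]) (rule ext, rule has_symbol_unique[OF assms(1) S assms(2) nz])
  then have "circle_integral (\<lambda>\<xi>. mtrace (symbol_of \<theta> P (-2) \<xi>)) = circle_integral (\<lambda>\<xi>. mtrace (\<sigma> (-2) \<xi>))"
    by (simp add: circle_integral_def fun_eq_iff)
  then show ?thesis by (simp add: wodzicki_def)
qed

section \<open>Diagonal operators\<close>

lemma scalar_homogeneous_at_0:
  assumes "scalar_homogeneous \<theta> d s" "\<xi> \<noteq> 0" shows "s \<xi> 0 = 0"
proof -
  obtain N f T where T: "\<forall>l<(N::nat). smooth_off_zero (f l) \<and> T l \<in> Ahat \<theta>"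
    "\<forall>\<xi>. \<xi> \<noteq> 0 \<longrightarrow> (\<forall>\<psi>. s \<xi> \<psi> = (\<Sum>l<N. cscale (f l \<xi>) (T l \<psi>)))"
    using assms(1) unfolding scalar_homogeneous_def by blast
  have "T l 0 = 0" if "l < N" for l
    using T(1) that by (auto intro: linear_op_0 local_op_linear Ahat_local)
  then show ?thesis using T(2) assms(2) by simp
qed

lemma axis_M2Ahat:
  assumes "T \<in> Ahat \<theta>" shows "(\<lambda>\<psi>. axis i (T (\<psi> $ i))) \<in> M2Ahat \<theta>"
  unfolding M2Ahat_def
proof (intro CollectI exI conjI allI)
  let ?M = "\<lambda>a b. if a = i \<and> b = i then T else (\<lambda>_. 0)"
  show "(\<lambda>\<psi>. axis i (T (\<psi> $ i))) = (\<lambda>\<psi>. \<chi> a. \<Sum>b\<in>UNIV. ?M a b (\<psi> $ b))"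
    by (rule ext) (auto simp: vec_eq_iff axis_def if_distrib[where f = "\<lambda>f. f _"] cong: if_cong)
  show "?M a b \<in> Ahat \<theta>" for a b
    using assms Ahat_zero by simp
qed

lemma homogeneous_symbol_diag:
  assumes "\<And>i. scalar_homogeneous \<theta> d (s i)"
  shows "homogeneous_symbol \<theta> d (\<lambda>\<xi> \<psi>. \<chi> i. s i \<xi> (\<psi> $ i))"
proof -
  obtain N1 f1 T1 where 1: "\<forall>l<(N1::nat). smooth_off_zero (f1 l) \<and> T1 l \<in> Ahat \<theta>"
      "\<forall>\<xi>. \<xi> \<noteq> 0 \<longrightarrow> (\<forall>\<psi>. s 1 \<xi> \<psi> = (\<Sum>l<N1. cscale (f1 l \<xi>) (T1 l \<psi>)))"
    using assms[of 1] unfolding scalar_homogeneous_def by blast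
  obtain N2 f2 T2 where 2: "\<forall>l<(N2::nat). smooth_off_zero (f2 l) \<and> T2 l \<in> Ahat \<theta>"
      "\<forall>\<xi>. \<xi> \<noteq> 0 \<longrightarrow> (\<forall>\<psi>. s 2 \<xi> \<psi> = (\<Sum>l<N2. cscale (f2 l \<xi>) (T2 l \<psi>)))"
    using assms[of 2] unfolding scalar_homogeneous_def by blast
  let ?f = "\<lambda>l. if l < N1 then f1 l else f2 (l - N1)"
  let ?T = "\<lambda>l. if l < N1 then (\<lambda>\<psi>. axis 1 (T1 l (\<psi> $ 1))) else (\<lambda>\<psi>. axis 2 (T2 (l - N1) (\<psi> $ 2)))"
  have "\<forall>l<N1 + N2. smooth_off_zero (?f l) \<and> ?T l \<in> M2Ahat \<theta>"
    using 1(1) 2(1) by (auto intro: axis_M2Ahat)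
  moreover have "\<forall>\<xi>. \<xi> \<noteq> 0 \<longrightarrow> (\<forall>\<psi> i. (\<chi> i. s i \<xi> (\<psi> $ i)) $ i = (\<Sum>l<N1 + N2. cscale (?f l \<xi>) (?T l \<psi> $ i)))"
    using 1(2) 2(2) by (simp add: sum_lessThan_add forall_2 axis_def)
  moreover have "\<forall>\<xi> t. \<xi> \<noteq> 0 \<longrightarrow> 0 < t \<longrightarrow> (\<forall>\<psi> i. (\<chi> i. s i (t *\<^sub>R \<xi>) (\<psi> $ i)) $ i
      = cscale (of_real (t powi d)) ((\<chi> i. s i \<xi> (\<psi> $ i)) $ i))"
    using assms[unfolded scalar_homogeneous_def, THEN conjunct2] by simp
  ultimately show ?thesis
    unfolding homogeneous_symbol_def
    by - (intro conjI exI[of _ "N1 + N2"] exI[of _ ?f] exI[of _ ?T]; assumption)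
qed

lemma has_symbol_diag:
  assumes P: "\<And>i. continuous_op (P i)" and \<sigma>: "\<And>i. scalar_symbol \<theta> (P i) (\<sigma> i)"
  shows "has_symbol \<theta> (\<lambda>\<psi>. \<chi> i. P i (\<psi> $ i)) (\<lambda>d \<xi> \<psi>. \<chi> i. \<sigma> i d \<xi> (\<psi> $ i))"
  unfolding has_symbol_def
proof (intro conjI allI)
  let ?entry = "\<lambda>N m n i j p. norm (coeff (((\<chi> i. P i (axis j (U n) $ i)) - (\<Sum>d=N..m. \<chi> i. \<sigma> i d (emb n) (axis j (U n) $ i))) $ i) p)"
  let ?scalar = "\<lambda>N m n i p. norm (coeff (P i (U n) - (\<Sum>d=N..m. \<sigma> i d (emb n) (U n))) p)"
  have hom: "scalar_homogeneous \<theta> d (\<sigma> i d)" for i d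
    using \<sigma>[of i] unfolding scalar_symbol_def by blast
  then show "homogeneous_symbol \<theta> d (\<lambda>\<xi> \<psi>. \<chi> i. \<sigma> i d \<xi> (\<psi> $ i))" for d
    by (rule homogeneous_symbol_diag)
  have P0: "P i 0 = 0" for i
    by (rule linear_op_0[OF continuous_op_linear[OF P]])
  show "((\<lambda>(n, j). coeff (\<psi> $ j) n * coeff ((\<chi> i. P i (axis j (U n) $ i)) $ i) p) has_sum
      coeff ((\<chi> i. P i (\<psi> $ i)) $ i) p) UNIV" for \<psi> i p
  proof -
    have "((\<lambda>(n, j). coeff (\<psi> $ j) n * coeff (P i (axis j (U n) $ i)) p) has_sum coeff (P i (\<psi> $ i)) p) (range (\<lambda>n. (n, i)))"
      using continuous_op_has_sum[OF P[of i], of "\<psi> $ i" p]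
      by (subst has_sum_reindex) (auto simp: inj_on_def o_def)
    also have "?this \<longleftrightarrow> ((\<lambda>(n, j). coeff (\<psi> $ j) n * coeff (P i (axis j (U n) $ i)) p) has_sum coeff (P i (\<psi> $ i)) p) UNIV"
      by (rule has_sum_cong_neutral) (auto simp: axis_def P0 image_def)
    finally show ?thesis by simp
  qed
  obtain m1 where 1: "\<And>d \<xi> \<psi>. m1 < d \<Longrightarrow> \<xi> \<noteq> 0 \<Longrightarrow> \<sigma> 1 d \<xi> \<psi> = 0"
    "\<And>m' N. m1 \<le> m' \<Longrightarrow> cols_order (N - 1) (\<lambda>n. P 1 (U n) - (\<Sum>d=N..m'. \<sigma> 1 d (emb n) (U n)))"
    by (rule scalar_symbolE[OF \<sigma>[of 1]]) blast
  obtain m2 where 2: "\<And>d \<xi> \<psi>. m2 < d \<Longrightarrow> \<xi> \<noteq> 0 \<Longrightarrow> \<sigma> 2 d \<xi> \<psi> = 0"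
    "\<And>m' N. m2 \<le> m' \<Longrightarrow> cols_order (N - 1) (\<lambda>n. P 2 (U n) - (\<Sum>d=N..m'. \<sigma> 2 d (emb n) (U n)))"
    by (rule scalar_symbolE[OF \<sigma>[of 2]]) blast
  define m where "m = max m1 m2"
  show "\<exists>m. (\<forall>d>m. \<forall>\<xi>. \<xi> \<noteq> 0 \<longrightarrow> (\<forall>\<psi>. (\<chi> i. \<sigma> i d \<xi> (\<psi> $ i)) = 0)) \<and>
      (\<forall>N s. \<exists>C. \<forall>n i j p. n \<noteq> 0 \<longrightarrow> wt (p - n) ^ s *
         ?entry N m n i j p
         \<le> C * norm (emb n) powi (N - 1))"
  proof (intro exI[of _ m] conjI allI impI)
    show "(\<chi> i. \<sigma> i d \<xi> (\<psi> $ i)) = 0" if "m < d" "\<xi> \<noteq> 0" for d \<xi> and \<psi> :: "nct^2"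
      using 1(1)[of d \<xi>] 2(1)[of d \<xi>] that by (simp add: vec_eq_iff forall_2 m_def)
    fix N and s :: nat
    have "cols_order (N - 1) (\<lambda>n. P i (U n) - (\<Sum>d=N..m. \<sigma> i d (emb n) (U n)))" for i
      using 1(2)[of m N] 2(2)[of m N] exhaust_2[of i] by (auto simp: m_def)
    then have "\<exists>C\<ge>0. \<forall>n p. n \<noteq> 0 \<longrightarrow> wt (p - n) ^ s *
        ?scalar N m n i p \<le> C * norm (emb n) powi (N - 1)" for i
      by (rule cols_orderE[where s = s]) blast
    then obtain C where C: "\<And>i. 0 \<le> C i" "\<And>i n p. n \<noteq> 0 \<Longrightarrow> wt (p - n) ^ s *
        ?scalar N m n i p \<le> C i * norm (emb n) powi (N - 1)"
      by metis
    have C12: "C i \<le> C 1 + C 2" for i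
      using C(1)[of 1] C(1)[of 2] exhaust_2[of i] by auto
    have "wt (p - n) ^ s *
         ?entry N m n i j p
         \<le> (C 1 + C 2) * norm (emb n) powi (N - 1)" if n: "n \<noteq> 0" for n p i j
    proof (cases "i = j")
      case True
      have "wt (p - n) ^ s * ?scalar N m n i p
          \<le> (C 1 + C 2) * norm (emb n) powi (N - 1)"
        by (rule order_trans[OF C(2)[OF n] mult_right_mono[OF C12]]) simp
      then show ?thesis by (simp add: True axis_def)
    next
      case False
      then have "axis j (U n) $ i = 0" by (simp add: axis_def)
      then show ?thesis
        using C(1) n by (simp add: P0 scalar_homogeneous_at_0[OF hom])
    qed
    then show "\<exists>C. \<forall>n i j p. n \<noteq> 0 \<longrightarrow> wt (p - n) ^ s *
         ?entry N m n i j p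
         \<le> C * norm (emb n) powi (N - 1)"
      by blast
  qed
qed

section \<open>Integrals over the circle\<close>

lemma zeta_circle: "e \<in> {\<i>, -\<i>} \<Longrightarrow> zeta e (vector [cos t, sin t]) = e * cis (- (Im e * t))"
  by (auto simp: zeta_def complex_eq_iff)

text \<open>On the circle \<open>zmon e1 e2 a b\<close> is a constant times \<open>cis (- j t)\<close> with the integer \<open>j\<close> of the hypothesis.\<close>

lemma zmon_circle_has_integral_0:
  assumes e: "e1 \<in> {\<i>, -\<i>}" "e2 \<in> {\<i>, -\<i>}" and ab: "of_int a * Im e1 + of_int b * Im e2 = real_of_int j" "j \<noteq> 0"
  shows "((\<lambda>t. c * zmon e1 e2 a b (vector [cos t, sin t]) * x) has_integral 0) {0..2*pi}"
proof -
  define A where "A = c * e1 powi a * e2 powi b * x"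
  have eq: "c * zmon e1 e2 a b (vector [cos t, sin t]) * x = A * cis (- (real_of_int j * t))" for t
  proof -
    have "zmon e1 e2 a b (vector [cos t, sin t]) = e1 powi a * e2 powi b * (cis (- (of_int a * Im e1 * t)) * cis (- (of_int b * Im e2 * t)))"
      by (simp add: zmon_def zeta_circle[OF e(1)] zeta_circle[OF e(2)] power_int_mult_distrib cis_power_int mult_ac)
    also have "cis (- (of_int a * Im e1 * t)) * cis (- (of_int b * Im e2 * t)) = cis (- (real_of_int j * t))"
      unfolding cis_mult by (simp add: algebra_simps flip: ab(1))
    finally show ?thesis by (simp add: A_def mult_ac)
  qed
  define F where "F = (\<lambda>t::real. \<i> * A / of_int j * cis (- (real_of_int j * t)))"
  have "(F has_vector_derivative A * cis (- (real_of_int j * t))) (at t within {0..2*pi})" for t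
    using ab(2) unfolding F_def has_vector_derivative_complex_iff[symmetric]
    by (auto intro!: derivative_eq_intros has_vector_derivative_mult_right simp: has_vector_derivative_complex_iff
        field_simps)
  then have "((\<lambda>t. A * cis (- (real_of_int j * t))) has_integral (F (2 * pi) - F 0)) {0..2*pi}"
    by (intro fundamental_theorem_of_calculus) auto
  moreover have "cis (- (real_of_int j * (2 * pi))) = 1"
    using cis_multiple_2pi[of "- real_of_int j"] by (simp add: mult_ac)
  then have "F (2 * pi) - F 0 = 0"
    by (simp add: F_def)
  ultimately show ?thesis by (simp add: eq)
qed

section \<open>The inverse square of the rescaled Dirac operator\<close>

definition gsign :: "2 \<Rightarrow> complex" where
  "gsign i = (if i = 1 then \<i> else - \<i>)"

lemma gsign: "gsign i \<in> {\<i>, -\<i>}" "- gsign i \<in> {\<i>, -\<i>}"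
  by (auto simp: gsign_def)

lemma gns_inner_eq: "gns_inner \<theta> \<phi> \<psi> = (\<Sum>\<^sub>\<infinity>m. cnj (coeff \<phi> m) * coeff \<psi> m)"
proof -
  have "gns_inner \<theta> \<phi> \<psi> = (\<Sum>\<^sub>\<infinity>m. cnj (coeff \<phi> (- m)) * coeff \<psi> (- m))"
    by (simp add: gns_inner_def tau_def tmult.rep_eq star.rep_eq cocycle_def)
  also have "\<dots> = (\<Sum>\<^sub>\<infinity>m. cnj (coeff \<phi> m) * coeff \<psi> m)"
    by (rule infsum_reindex_bij_betw[where g = uminus]) (rule bij_betwI[where g = uminus]; simp)
  finally show ?thesis .
qed

lemma star_ops: "star (a + b) = star a + star b" "star (cscale c a) = cscale (cnj c) (star a)"
  "star (U 0) = U 0"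
  by (rule nct_eqI; simp add: star.rep_eq neg_equal_0_iff_equal)+

lemma gns_inner_sesquilinear:
  "gns_inner \<theta> (a + b) c = gns_inner \<theta> a c + gns_inner \<theta> b c"
  "gns_inner \<theta> a (b + c) = gns_inner \<theta> a b + gns_inner \<theta> a c"
  "gns_inner \<theta> (cscale z a) b = cnj z * gns_inner \<theta> a b"
  "gns_inner \<theta> a (cscale z b) = z * gns_inner \<theta> a b"
  using Lmul_add[of \<theta> "star a" "star b" c] Lmul_scale[of \<theta> "cnj z" "star a" b]
    linear_op_add[OF linear_Lmul, of \<theta> "star a" b c] linear_op_scale[OF linear_Lmul, of \<theta> "star a" z b]
  by (simp_all add: gns_inner_def tau_def star_ops Lmul_def)

lemma gns_inner_cnj: "cnj (gns_inner \<theta> a b) = gns_inner \<theta> b a"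
  by (simp add: gns_inner_eq mult.commute flip: infsum_cnj)

lemma gns_inner_nonzero: assumes "a \<noteq> 0" shows "gns_inner \<theta> a a \<noteq> 0"
proof
  assume 0: "gns_inner \<theta> a a = 0"
  obtain n where n: "coeff a n \<noteq> 0"
    using assms nct_eqI[of a 0] by auto
  have "(\<lambda>m. cocycle \<theta> m (0 - m) * coeff (star a) m * coeff a (0 - m)) summable_on UNIV"
    by (rule tmult_summable)
  then have "((\<lambda>m. cnj (coeff a m) * coeff a m) \<circ> uminus) summable_on UNIV"
    by (simp add: star.rep_eq cocycle_def o_def)
  then have "(\<lambda>m. cnj (coeff a m) * coeff a m) summable_on UNIV"
    by (subst (asm) summable_on_reindex[symmetric]) auto
  then have "((\<lambda>m. cnj (coeff a m) * coeff a m) has_sum 0) UNIV"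
    using 0 by (simp add: has_sum_iff gns_inner_eq)
  then have "((\<lambda>m. Re (cnj (coeff a m) * coeff a m)) has_sum Re 0) UNIV"
    by (rule has_sum_Re)
  moreover have "Re (cnj z * z) = norm z ^ 2" for z
    unfolding cmod_power2 by (simp add: power2_eq_square)
  ultimately have "((\<lambda>m. norm (coeff a m) ^ 2) has_sum 0) UNIV"
    by simp
  then have "norm (coeff a n) ^ 2 = 0"
    by (rule nonneg_has_sum_le_0D) auto
  with n show False by simp
qed

text \<open>Polarisation: the quadratic form of \<open>k\<close> has real values.\<close>

lemma positive_op_symmetric:
  assumes pos: "positive_op \<theta> k" and lin: "linear_op k"
  shows "gns_inner \<theta> \<phi> (k \<psi>) = gns_inner \<theta> (k \<phi>) \<psi>"
proof -
  have real: "Im (gns_inner \<theta> x (k x)) = 0" for x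
  proof -
    obtain r where "gns_inner \<theta> x (k x) = complex_of_real r"
      using pos unfolding positive_op_def by blast
    then show ?thesis by simp
  qed
  have "Im (gns_inner \<theta> \<phi> (k \<psi>) + gns_inner \<theta> \<psi> (k \<phi>)) = 0"
    using real[of "\<phi> + \<psi>"] real[of \<phi>] real[of \<psi>]
    by (simp add: linear_op_add[OF lin] gns_inner_sesquilinear)
  moreover have "Re (gns_inner \<theta> \<phi> (k \<psi>) - gns_inner \<theta> \<psi> (k \<phi>)) = 0"
    using real[of "\<phi> + cscale \<i> \<psi>"] real[of \<phi>] real[of \<psi>]
    by (simp add: linear_op_add[OF lin] linear_op_scale[OF lin] gns_inner_sesquilinear)
  ultimately have "gns_inner \<theta> \<phi> (k \<psi>) = cnj (gns_inner \<theta> \<psi> (k \<phi>))"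
    by (simp add: complex_eq_iff)
  then show ?thesis by (simp add: gns_inner_cnj)
qed

text \<open>
  The operators \<open>k\<close> and \<open>l = k\<^sup>-\<^sup>1\<close>. The kernel of the rescaled Dirac operator is spanned, in each
  component, by \<open>h = l U\<^sub>0\<close>, and \<open>h_sym\<close> expresses the inner product with \<open>h\<close>.
\<close>

locale conformal_factor =
  fixes \<theta> :: real and k l :: "nct \<Rightarrow> nct"
  assumes k: "k \<in> Aop \<theta>" and l: "l \<in> Aop \<theta>"
    and kl [simp]: "\<And>\<psi>. k (l \<psi>) = \<psi>" and lk [simp]: "\<And>\<psi>. l (k \<psi>) = \<psi>"
    and h_sym: "\<And>\<psi>. gns_inner \<theta> (l (U 0)) \<psi> = coeff (l \<psi>) 0"
begin

lemma k_Ahat: "k \<in> Ahat \<theta>" and l_Ahat: "l \<in> Ahat \<theta>"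
  using k l by (auto intro: Ahat_Aop)

lemma k_local: "local_op k" and l_local: "local_op l"
  using k_Ahat l_Ahat by (auto intro: Ahat_local)

lemmas k_lin = local_op_linear[OF k_local]
lemmas l_lin = local_op_linear[OF l_local]

lemma k_Lmul: "k (Lmul \<theta> a \<psi>) = Lmul \<theta> a (k \<psi>)"
  using k by (auto simp: Aop_def Rmul_Lmul)

definition h :: nct where "h = l (U 0)"

definition kap :: "nct \<Rightarrow> complex" where "kap \<psi> = coeff (l \<psi>) 0"

definition nu :: complex where "nu = kap h"

lemma nu_nonzero: "nu \<noteq> 0"
proof -
  have "h \<noteq> 0"
  proof
    assume "h = 0"
    then have "k h = 0" using linear_op_0[OF k_lin] by simp
    then have "U 0 = 0" by (simp add: h_def)
    then have "coeff (U 0) 0 = 0" by simp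
    then show False by (simp del: zero_nct.rep_eq)
  qed
  then show ?thesis
    using gns_inner_nonzero[of h \<theta>] h_sym[of h] by (simp add: nu_def kap_def h_def)
qed

lemma kap_linear: "kap (\<psi> - \<phi>) = kap \<psi> - kap \<phi>" "kap (cscale c \<psi>) = c * kap \<psi>"
  by (simp_all add: kap_def linear_op_diff[OF l_lin] linear_op_scale[OF l_lin])

lemma kap_h: "kap (cscale c h) = c * nu"
  by (simp add: kap_linear nu_def)

text \<open>The off-diagonal entries of the rescaled Dirac operator.\<close>

definition t :: "complex \<Rightarrow> nct \<Rightarrow> nct" where "t e \<psi> = k (dz e (k \<psi>))"

lemma t_lin: "linear_op (t e)"
  unfolding t_def by (intro linear_op_comp[OF k_lin] linear_op_comp[OF linear_dz] k_lin)

lemma t_eq_0_iff: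
  assumes e: "e \<in> {\<i>, -\<i>}" shows "t e \<psi> = 0 \<longleftrightarrow> (\<exists>c. \<psi> = cscale c h)"
proof
  assume "t e \<psi> = 0"
  then have "l (t e \<psi>) = 0" by (simp add: linear_op_0[OF l_lin])
  then have "dz e (k \<psi>) = 0" by (simp add: t_def)
  then have "k \<psi> = cscale (coeff (k \<psi>) 0) (U 0)" by (rule dz_eq_0_imp[OF e])
  then have "l (k \<psi>) = cscale (coeff (k \<psi>) 0) h"
    by (metis h_def linear_op_scale[OF l_lin])
  then show "\<exists>c. \<psi> = cscale c h" by auto
next
  assume "\<exists>c. \<psi> = cscale c h"
  then show "t e \<psi> = 0"
    by (auto simp: t_def h_def linear_op_scale[OF k_lin] linear_op_scale[OF linear_dz] dz_U linear_op_0[OF k_lin])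
qed

lemma kap_t [simp]: "kap (t e \<psi>) = 0"
  by (simp add: kap_def t_def)

lemma t_inj:
  assumes e: "e \<in> {\<i>, -\<i>}" and "kap \<psi> = 0" "t e \<psi> = 0" shows "\<psi> = 0"
proof -
  obtain c where "\<psi> = cscale c h" using assms(3) t_eq_0_iff[OF e] by blast
  with assms(2) nu_nonzero show ?thesis by (simp add: kap_h)
qed

text \<open>The projection along \<open>h\<close>, and the solution \<open>Q e \<psi>\<close> of \<open>t (-e) (t e \<phi>) = proj \<psi>\<close> orthogonal to \<open>h\<close>.
  The factors of \<open>k dz k\<^sup>2 dz k\<close> are inverted one by one. A derivation can be inverted only on elements
  with vanishing coefficient at \<open>0\<close>, and \<open>Q2\<close> uses up the constant of integration of \<open>Q1\<close> for that.\<close>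

definition proj :: "nct \<Rightarrow> nct" where
  "proj \<psi> = \<psi> - cscale (coeff (l \<psi>) 0) (cscale (1 / nu) h)"

definition Q1 :: "complex \<Rightarrow> nct \<Rightarrow> nct" where
  "Q1 e \<psi> = zinv (- e) (l (proj \<psi>))"

definition Q2 :: "complex \<Rightarrow> nct \<Rightarrow> nct" where
  "Q2 e \<psi> = l (l (Q1 e \<psi>)) - cscale (coeff (l (l (Q1 e \<psi>))) 0) (cscale (1 / nu) (l (l (U 0))))"

definition Q3 :: "complex \<Rightarrow> nct \<Rightarrow> nct" where
  "Q3 e \<psi> = l (zinv e (Q2 e \<psi>))"

definition Q :: "complex \<Rightarrow> nct \<Rightarrow> nct" where
  "Q e \<psi> = proj (Q3 e \<psi>)"

lemma kap_proj [simp]: "kap (proj \<psi>) = 0"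
  using nu_nonzero by (simp add: proj_def kap_linear kap_h flip: kap_def nu_def)

lemma t_proj: "e \<in> {\<i>, -\<i>} \<Longrightarrow> t e (proj \<psi>) = t e \<psi>"
  using t_eq_0_iff[of e "cscale (coeff (l \<psi>) 0 * (1 / nu)) h"]
  by (auto simp: proj_def linear_op_diff[OF t_lin])

lemma t_Q: assumes e: "e \<in> {\<i>, -\<i>}" shows "t e (Q e \<psi>) = k (Q2 e \<psi>)"
proof -
  have "coeff (Q2 e \<psi>) 0 = 0"
    using nu_nonzero by (simp add: Q2_def nu_def kap_def h_def)
  then show ?thesis
    using e by (simp add: Q_def t_proj) (simp add: t_def Q3_def dz_zinv[OF e])
qed

lemma t_t_Q: assumes e: "e \<in> {\<i>, -\<i>}" shows "t (- e) (t e (Q e \<psi>)) = proj \<psi>"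
proof -
  have e': "- e \<in> {\<i>, -\<i>}" using e by auto
  have "k (k (Q2 e \<psi>)) = Q1 e \<psi> - cscale (coeff (l (l (Q1 e \<psi>))) 0 * (1 / nu)) (U 0)"
    by (simp add: Q2_def linear_op_diff[OF k_lin] linear_op_scale[OF k_lin])
  then have "dz (- e) (k (k (Q2 e \<psi>))) = dz (- e) (Q1 e \<psi>)"
    by (simp add: linear_op_diff[OF linear_dz] linear_op_scale[OF linear_dz] dz_U)
  also have "\<dots> = l (proj \<psi>)"
    using kap_proj[of \<psi>] by (simp add: Q1_def dz_zinv[OF e'] kap_def)
  finally show ?thesis by (simp only: t_Q[OF e]) (simp add: t_def)
qed

lemma dirac_k_eq: "dirac_k k \<psi> = vector [t (- \<i>) (\<psi> $ 2), t \<i> (\<psi> $ 1)]"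
proof -
  have "cscale (- \<i>) (delta 1 (k (\<psi> $ 2))) = - cscale \<i> (delta 1 (k (\<psi> $ 2)))"
    by (rule nct_eqI) simp
  then show ?thesis
    by (simp add: dirac_k_def dirac_def diag_op_def t_def dz_def vec_eq_iff forall_2)
qed

text \<open>The linear functional \<open>kap\<close> is the inner product with \<open>h\<close>, which spans the kernel componentwise.\<close>

lemma orthogonal_kernel_iff:
  "(\<forall>\<eta>. dirac_k k \<eta> = 0 \<longrightarrow> spinor_inner \<theta> \<eta> \<phi> = 0) \<longleftrightarrow> kap (\<phi> $ 1) = 0 \<and> kap (\<phi> $ 2) = 0"
proof -
  have ker: "dirac_k k \<eta> = 0 \<longleftrightarrow> (\<exists>c. \<eta> $ 1 = cscale c h) \<and> (\<exists>c. \<eta> $ 2 = cscale c h)" for \<eta>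
    by (auto simp: dirac_k_eq vec_eq_iff forall_2 t_eq_0_iff)
  have inner: "gns_inner \<theta> (cscale c h) \<psi> = cnj c * kap \<psi>" for c \<psi>
    by (simp add: gns_inner_sesquilinear h_def h_sym kap_def)
  show ?thesis
  proof
    assume *: "\<forall>\<eta>. dirac_k k \<eta> = 0 \<longrightarrow> spinor_inner \<theta> \<eta> \<phi> = 0"
    have "dirac_k k (vector [cscale a h, cscale b h]) = 0" for a b
      by (auto simp: ker)
    with * have "spinor_inner \<theta> (vector [cscale a h, cscale b h]) \<phi> = 0" for a b
      by blast
    then have "cnj a * kap (\<phi> $ 1) + cnj b * kap (\<phi> $ 2) = 0" for a b
      by (simp add: spinor_inner_def sum_2 inner)
    from this[of 1 0] this[of 0 1] show "kap (\<phi> $ 1) = 0 \<and> kap (\<phi> $ 2) = 0" by simp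
  next
    assume "kap (\<phi> $ 1) = 0 \<and> kap (\<phi> $ 2) = 0"
    then show "\<forall>\<eta>. dirac_k k \<eta> = 0 \<longrightarrow> spinor_inner \<theta> \<eta> \<phi> = 0"
      by (auto simp: ker spinor_inner_def sum_2 inner)
  qed
qed

lemma abs_inv_sq_eq: "abs_inv_sq \<theta> (dirac_k k) \<psi> = (\<chi> i. Q (gsign i) (\<psi> $ i))"
  unfolding abs_inv_sq_def orthogonal_kernel_iff
proof (rule the_equality)
  let ?T = "dirac_k k" and ?\<phi> = "\<chi> i. Q (gsign i) (\<psi> $ i)"
  have ii: "\<i> \<in> {\<i>, -\<i>}" "-\<i> \<in> {\<i>, -\<i>}" by auto
  have TT: "?T (?T \<phi>) = vector [t (- \<i>) (t \<i> (\<phi> $ 1)), t \<i> (t (- \<i>) (\<phi> $ 2))]" for \<phi>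
    by (simp add: dirac_k_eq)
  have sol: "?T (?T ?\<phi>) = vector [proj (\<psi> $ 1), proj (\<psi> $ 2)]"
    using t_t_Q[OF ii(1)] t_t_Q[OF ii(2)] by (simp add: TT gsign_def)
  have "?T (\<psi> - vector [proj (\<psi> $ 1), proj (\<psi> $ 2)]) = 0"
    unfolding dirac_k_eq vec_eq_iff forall_2
    by (simp add: linear_op_diff[OF t_lin] t_proj)
  then show "(kap (?\<phi> $ 1) = 0 \<and> kap (?\<phi> $ 2) = 0) \<and> ?T (\<psi> - ?T (?T ?\<phi>)) = 0"
    unfolding sol by (simp add: Q_def)
  fix \<phi>
  assume \<phi>: "(kap (\<phi> $ 1) = 0 \<and> kap (\<phi> $ 2) = 0) \<and> ?T (\<psi> - ?T (?T \<phi>)) = 0"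
  \<comment> \<open>uniqueness: values of \<open>t\<close> are orthogonal to \<open>h\<close>, and \<open>t\<close> is injective on vectors orthogonal to \<open>h\<close>\<close>
  have cube: "x = Q e y" if e: "e \<in> {\<i>, -\<i>}" and x: "kap x = 0" "t e (y - t (- e) (t e x)) = 0" for e x y
  proof -
    have e': "- e \<in> {\<i>, -\<i>}" using e by auto
    have "t (- e) (t e x) = proj y"
    proof -
      have "t e (proj y - t (- e) (t e x)) = 0"
        using x(2) by (simp add: linear_op_diff[OF t_lin] t_proj[OF e])
      then have "proj y - t (- e) (t e x) = 0"
        by (rule t_inj[OF e, rotated]) (simp add: kap_linear)
      then show ?thesis by simp
    qed
    then have "t (- e) (t e x - t e (Q e y)) = 0"
      by (simp add: linear_op_diff[OF t_lin] t_t_Q[OF e])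
    then have "t e x - t e (Q e y) = 0"
      by (rule t_inj[OF e', rotated]) (simp add: kap_linear)
    then have "t e (x - Q e y) = 0"
      by (simp add: linear_op_diff[OF t_lin])
    then have "x - Q e y = 0"
      by (rule t_inj[OF e, rotated]) (simp add: kap_linear x Q_def)
    then show ?thesis by simp
  qed
  have "t (- \<i>) (\<psi> $ 2 - t \<i> (t (- \<i>) (\<phi> $ 2))) = 0" "t \<i> (\<psi> $ 1 - t (- \<i>) (t \<i> (\<phi> $ 1))) = 0"
    using conjunct2[OF \<phi>] by (simp_all add: TT dirac_k_eq[of "\<psi> - _"] vec_eq_iff forall_2)
  then have "\<phi> $ 1 = Q \<i> (\<psi> $ 1)" "\<phi> $ 2 = Q (- \<i>) (\<psi> $ 2)"
    using \<phi> cube[of \<i> "\<phi> $ 1" "\<psi> $ 1"] cube[of "- \<i>" "\<phi> $ 2" "\<psi> $ 2"] by auto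
  then show "\<phi> = ?\<phi>"
    by (simp add: vec_eq_iff forall_2 gsign_def)
qed

text \<open>The projections differ from the identity by rank one operators, which are smoothing. So they do
  not contribute to symbols.\<close>

lemma continuous_proj: "continuous_op proj"
proof -
  have "continuous_op (\<lambda>\<psi>. Lmul \<theta> (U 0) \<psi> + cscale (coeff (l \<psi>) 0) (cscale (- 1 / nu) h))"
    by (intro continuous_op_add local_op_continuous local_op_Lmul continuous_rank_one l_local)
  moreover have "Lmul \<theta> (U 0) \<psi> + cscale (coeff (l \<psi>) 0) (cscale (- 1 / nu) h) = proj \<psi>" for \<psi>
    by (rule nct_eqI) (simp add: proj_def)
  ultimately show ?thesis by simp
qed

lemma continuous_Q1: "continuous_op (Q1 e)"
  unfolding Q1_def
  by (intro continuous_op_comp[OF local_op_continuous[OF local_zinv]]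
      continuous_op_comp[OF local_op_continuous[OF l_local]] continuous_proj)

lemma continuous_Q2: "continuous_op (Q2 e)"
proof -
  have ll: "continuous_op (\<lambda>\<psi>. l (l (Q1 e \<psi>)))"
    by (intro continuous_op_comp[OF local_op_continuous[OF l_local]] continuous_Q1)
  have "continuous_op (\<lambda>\<psi>. l (l (Q1 e \<psi>)) + cscale (coeff (l (l (Q1 e \<psi>))) 0) (cscale (- 1 / nu) (l (l (U 0)))))"
    by (intro continuous_op_add continuous_rank_one ll)
  moreover have "l (l (Q1 e \<psi>)) + cscale (coeff (l (l (Q1 e \<psi>))) 0) (cscale (- 1 / nu) (l (l (U 0)))) = Q2 e \<psi>" for \<psi>
    by (rule nct_eqI) (simp add: Q2_def)
  ultimately show ?thesis by simp
qed

lemma continuous_Q: "continuous_op (Q e)"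
  unfolding Q_def Q3_def
  by (intro continuous_op_comp[OF continuous_proj] continuous_op_comp[OF local_op_continuous[OF l_local]]
      continuous_op_comp[OF local_op_continuous[OF local_zinv]] continuous_Q2)

lemma smoothing_cols_order:
  "smoothing (\<lambda>n. E n - F n) \<Longrightarrow> cols_order d F \<Longrightarrow> cols_order d E"
  using cols_order_add[of d "\<lambda>n. E n - F n" F] by (simp add: smoothing_def)

lemma smoothing_trans:
  "smoothing (\<lambda>n. E n - F n) \<Longrightarrow> smoothing (\<lambda>n. F n - G n) \<Longrightarrow> smoothing (\<lambda>n. E n - G n)"
  using smoothing_add[of "\<lambda>n. E n - F n" "\<lambda>n. F n - G n"] by simp

lemma smoothing_local_diff:
  assumes "local_op P" "smoothing (\<lambda>n. E n - F n)" shows "smoothing (\<lambda>n. P (E n) - P (F n))"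
  using smoothing_local[OF assms] by (simp add: linear_op_diff[OF local_op_linear[OF assms(1)]])

lemma smoothing_proj:
  assumes "cols_order d F" shows "smoothing (\<lambda>n. proj (F n) - F n)"
proof -
  have "smoothing (\<lambda>n. cscale (coeff (l (F n)) 0) (cscale (- 1 / nu) h))"
    by (rule smoothing_rank_one[OF cols_order_local[OF l_local assms]])
  moreover have "cscale (coeff (l (F n)) 0) (cscale (- 1 / nu) h) = proj (F n) - F n" for n
    by (rule nct_eqI) (simp add: proj_def)
  ultimately show ?thesis by simp
qed

lemma smoothing_Q1: "smoothing (\<lambda>n. Q1 e (U n) - zinv (- e) (l (U n)))"
  unfolding Q1_def
  by (rule smoothing_local_diff[OF local_op_comp[OF local_zinv l_local] smoothing_proj[OF cols_order_U]])

lemma cols_order_llQ1: "cols_order 0 (\<lambda>n. l (l (Q1 e (U n))))"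
  by (rule cols_order_local[OF local_op_comp[OF l_local l_local] smoothing_cols_order[OF smoothing_Q1
        cols_order_local[OF local_op_comp[OF local_zinv l_local] cols_order_U]]])

lemma smoothing_Q2: "smoothing (\<lambda>n. Q2 e (U n) - l (l (zinv (- e) (l (U n)))))"
proof (rule smoothing_trans)
  have "smoothing (\<lambda>n. cscale (coeff (l (l (Q1 e (U n)))) 0) (cscale (- 1 / nu) (l (l (U 0)))))"
    by (rule smoothing_rank_one[OF cols_order_llQ1])
  moreover have "cscale (coeff (l (l (Q1 e (U n)))) 0) (cscale (- 1 / nu) (l (l (U 0)))) = Q2 e (U n) - l (l (Q1 e (U n)))" for n
    by (rule nct_eqI) (simp add: Q2_def)
  ultimately show "smoothing (\<lambda>n. Q2 e (U n) - l (l (Q1 e (U n))))" by simp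
  show "smoothing (\<lambda>n. l (l (Q1 e (U n))) - l (l (zinv (- e) (l (U n)))))"
    by (rule smoothing_local_diff[OF local_op_comp[OF l_local l_local] smoothing_Q1])
qed

lemma smoothing_Q: "smoothing (\<lambda>n. Q e (U n) - l (zinv e (l (l (zinv (- e) (l (U n)))))))"
proof (rule smoothing_trans)
  have Q3: "smoothing (\<lambda>n. Q3 e (U n) - l (zinv e (l (l (zinv (- e) (l (U n)))))))"
    unfolding Q3_def by (rule smoothing_local_diff[OF local_op_comp[OF l_local local_zinv] smoothing_Q2])
  then show "smoothing (\<lambda>n. Q3 e (U n) - l (zinv e (l (l (zinv (- e) (l (U n)))))))" .
  have "cols_order 0 (\<lambda>n. Q3 e (U n))"
    by (rule smoothing_cols_order[OF Q3])
       (intro cols_order_local[OF l_local] cols_order_local[OF local_zinv] cols_order_U)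
  then show "smoothing (\<lambda>n. Q e (U n) - Q3 e (U n))"
    unfolding Q_def by (rule smoothing_proj)
qed

lemma smoothing_t_Q:
  assumes "e \<in> {\<i>, -\<i>}" shows "smoothing (\<lambda>n. t e (Q e (U n)) - l (zinv (- e) (l (U n))))"
  using smoothing_local_diff[OF k_local smoothing_Q2[of e]] by (simp add: t_Q[OF assms])

end

section \<open>The two functionals\<close>

context conformal_factor
begin

text \<open>The off-diagonal entries of \<open>V\<^sup>a \<sigma>\<^sup>a\<close>, for \<open>e = \<plusminus>\<i>\<close>.\<close>

definition chiral :: "complex \<Rightarrow> (2 \<Rightarrow> nct) \<Rightarrow> nct" where
  "chiral e V = V 1 + cscale e (V 2)"

lemma one_form_eq:
  "one_form \<theta> k V \<psi> = vector [k (k (Lmul \<theta> (chiral (- \<i>) V) (\<psi> $ 2))), k (k (Lmul \<theta> (chiral \<i> V) (\<psi> $ 1)))]"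
proof -
  have "clifford \<theta> V \<psi> = vector [Lmul \<theta> (chiral (- \<i>) V) (\<psi> $ 2), Lmul \<theta> (chiral \<i> V) (\<psi> $ 1)]"
    by (simp add: clifford_def vec_eq_iff forall_2 sum_2 pauli_def chiral_def Lmul_add Lmul_scale)
  then show ?thesis
    by (simp add: one_form_def diag_op_def vec_eq_iff forall_2)
qed

lemma mtrace_diag: "mtrace (\<lambda>\<psi>. \<chi> i. s i (\<psi> $ i)) \<psi> = (\<Sum>i\<in>UNIV. s i \<psi>)"
  by (simp add: mtrace_def)

text \<open>The product of the two one-forms is diagonal, with these entries for \<open>e = \<plusminus>\<i>\<close>.\<close>

definition metric_coefficient :: "(2 \<Rightarrow> nct) \<Rightarrow> (2 \<Rightarrow> nct) \<Rightarrow> complex \<Rightarrow> nct \<Rightarrow> nct" where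
  "metric_coefficient V W e \<psi> = k (k (Lmul \<theta> (chiral (- e) V) (k (k (Lmul \<theta> (chiral e W) \<psi>)))))"

lemma metric_coefficient_Ahat: "metric_coefficient V W e \<in> Ahat \<theta>"
  unfolding metric_coefficient_def
  by (rule Ahat_comp'[OF k_Ahat] Ahat_comp'[OF Ahat_Lmul] Ahat_Lmul)+

definition metric_symbol :: "(2 \<Rightarrow> nct) \<Rightarrow> (2 \<Rightarrow> nct) \<Rightarrow> complex \<Rightarrow> int \<Rightarrow> real^2 \<Rightarrow> nct \<Rightarrow> nct" where
  "metric_symbol V W e d \<xi> \<psi> = (if d \<le> - 2 then
     zinv2_symbol e (- e) (\<lambda>\<phi>. metric_coefficient V W e (l \<phi>)) (\<lambda>\<phi>. l (l \<phi>)) l (nat (- 2 - d)) \<xi> \<psi> else 0)"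

lemma metric_scalar_symbol:
  assumes e: "e \<in> {\<i>, -\<i>}"
  shows "scalar_symbol \<theta> (\<lambda>\<psi>. metric_coefficient V W e (Q e \<psi>)) (metric_symbol V W e)"
proof -
  have e': "- e \<in> {\<i>, -\<i>}" using e by auto
  show ?thesis
    unfolding metric_symbol_def[abs_def]
    by (rule scalar_symbol_smoothing[OF zinv2_scalar_symbol[OF e e'
            Ahat_comp'[OF metric_coefficient_Ahat l_Ahat] Ahat_comp'[OF l_Ahat l_Ahat] l_Ahat]])
       (rule smoothing_local_diff[OF Ahat_local[OF metric_coefficient_Ahat] smoothing_Q])
qed

text \<open>Leading symbols multiply. Four factors \<open>k\<close> from the one-forms meet four factors \<open>l\<close>, and both commute
  with \<open>\<A>\<close>.\<close>

lemma metric_symbol_circle: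
  assumes e: "e \<in> {\<i>, -\<i>}"
  shows "metric_symbol V W e (- 2) (vector [cos s, sin s]) \<psi> =
    Lmul \<theta> (chiral (- e) V) (Lmul \<theta> (chiral e W) \<psi>)"
proof -
  have e': "- e \<in> {\<i>, -\<i>}" using e by auto
  have "(complex_of_real (cos s))\<^sup>2 + (complex_of_real (sin s))\<^sup>2 = 1"
    by (simp flip: of_real_power of_real_add)
  then have "zeta e (vector [cos s, sin s]) * zeta (- e) (vector [cos s, sin s]) = 1"
    using e by (auto simp: zeta_def algebra_simps power2_eq_square)
  then have "zmon e (- e) (- 1) (- 1) (vector [cos s, sin s]) = 1"
    by (simp add: zmon_def flip: inverse_mult_distrib)
  then show ?thesis
    by (simp add: metric_symbol_def zinv2_symbol_def metric_coefficient_def k_Lmul)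
qed

text \<open>The trace identity for Pauli matrices: the mixed terms \<open>V\<^sup>1 W\<^sup>2\<close> and \<open>V\<^sup>2 W\<^sup>1\<close> cancel.\<close>

lemma chiral_products:
  "(\<Sum>i\<in>UNIV. Lmul \<theta> (chiral (- gsign i) V) (Lmul \<theta> (chiral (gsign i) W) \<psi>)) =
   Lmul \<theta> (cscale 2 (\<Sum>a\<in>UNIV. tmult \<theta> (V a) (W a))) \<psi>"
  by (rule nct_eqI)
     (simp add: sum_2 gsign_def chiral_def Lmul_add Lmul_scale linear_op_add[OF linear_Lmul]
       linear_op_scale[OF linear_Lmul] algebra_simps flip: Lmul_Lmul)

lemma metric_functional_eq:
  assumes \<theta>: "\<theta> \<notin> \<rat>"
  shows "metric_functional \<theta> (dirac_k k) (one_form \<theta> k V) (one_form \<theta> k W)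
           = tau (\<Sum>a\<in>UNIV. tmult \<theta> (V a) (W a))"
proof -
  let ?I = "circle_integral (\<lambda>\<xi>. mtrace (\<lambda>\<psi>. \<chi> i. metric_symbol V W (gsign i) (- 2) \<xi> (\<psi> $ i)))"
  define S where "S = (\<Sum>a\<in>UNIV. tmult \<theta> (V a) (W a))"
  have "one_form \<theta> k V \<circ> one_form \<theta> k W \<circ> abs_inv_sq \<theta> (dirac_k k) =
      (\<lambda>\<psi>. \<chi> i. metric_coefficient V W (gsign i) (Q (gsign i) (\<psi> $ i)))"
    by (rule ext) (simp add: one_form_eq abs_inv_sq_eq vec_eq_iff forall_2 gsign_def metric_coefficient_def)
  moreover have "has_symbol \<theta> (\<lambda>\<psi>. \<chi> i. metric_coefficient V W (gsign i) (Q (gsign i) (\<psi> $ i)))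
      (\<lambda>d \<xi> \<psi>. \<chi> i. metric_symbol V W (gsign i) d \<xi> (\<psi> $ i))"
    by (rule has_symbol_diag[OF continuous_op_comp[OF local_op_continuous[OF Ahat_local[OF metric_coefficient_Ahat]]
            continuous_Q] metric_scalar_symbol[OF gsign(1)]])
  ultimately have W: "metric_functional \<theta> (dirac_k k) (one_form \<theta> k V) (one_form \<theta> k W) =
      1 / (4 * pi) * tau_ot \<theta> (?I)"
    unfolding metric_functional_def by (simp only: wodzicki_eq[OF \<theta>])
  have trace: "mtrace (\<lambda>\<psi>. \<chi> i. metric_symbol V W (gsign i) (- 2) \<xi> (\<psi> $ i)) \<psi> =
      (\<Sum>i\<in>UNIV. metric_symbol V W (gsign i) (- 2) \<xi> \<psi>)" for \<xi> \<psi>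
    by (rule mtrace_diag[of "\<lambda>i. metric_symbol V W (gsign i) (- 2) \<xi>"])
  have "?I \<psi>
      = Lmul \<theta> (cscale (4 * pi) S) \<psi>" for \<psi>
  proof -
    have "?I \<psi>
        = Abs_nct (\<lambda>n. integral {0..2 * pi} (\<lambda>s. coeff (Lmul \<theta> (cscale 2 S) \<psi>) n))"
      unfolding circle_integral_def trace unfolding metric_symbol_circle[OF gsign(1)] chiral_products S_def ..
    also have "\<dots> = Abs_nct (coeff (Lmul \<theta> (cscale (4 * pi) S) \<psi>))"
      by (rule arg_cong[where f = Abs_nct], rule ext) (simp add: Lmul_scale scaleR_conv_of_real)
    finally show ?thesis by (simp add: coeff_inverse)
  qed
  then have "?I
      = Lmul \<theta> (cscale (4 * pi) S)" by (rule ext)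
  then show ?thesis
    by (simp add: W tau_ot_Lmul[OF \<theta>] tau_def S_def)
qed

definition einstein_left :: "(2 \<Rightarrow> nct) \<Rightarrow> complex \<Rightarrow> nct \<Rightarrow> nct" where
  "einstein_left V e \<psi> = k (k (Lmul \<theta> (chiral (- e) V) (k \<psi>)))"

definition einstein_inner :: "(2 \<Rightarrow> nct) \<Rightarrow> complex \<Rightarrow> nct \<Rightarrow> nct" where
  "einstein_inner W e \<psi> = k (k (k (Lmul \<theta> (chiral (- e) W) \<psi>)))"

lemma einstein_Ahat:
  "einstein_left V e \<in> Ahat \<theta>" "einstein_inner W e \<in> Ahat \<theta>"
  unfolding einstein_left_def einstein_inner_def
  by (rule Ahat_comp'[OF k_Ahat] Ahat_comp'[OF Ahat_Lmul] Ahat_Lmul k_Ahat)+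

text \<open>The reason why the Einstein functional vanishes. With \<open>z\<^sub>1 = zeta e1\<close> and \<open>z\<^sub>2 = zeta e2\<close>, the terms of
  degree \<open>-2\<close> of \<open>c dz e1 g zinv e2 l'\<close> have the angular factors \<open>z\<^sub>1 z\<^sub>2\<^sup>-\<^sup>3\<close> and \<open>z\<^sub>2\<^sup>-\<^sup>2\<close>, and neither is
  constant on the circle, whether \<open>z\<^sub>1\<close> equals \<open>z\<^sub>2\<close> or its conjugate.\<close>

lemma dz_zinv_symbol_circle:
  assumes e: "e1 \<in> {\<i>, -\<i>}" "e2 \<in> {\<i>, -\<i>}"
  shows "((\<lambda>s. coeff (dz_zinv_symbol e1 e2 c g l' 2 (vector [cos s, sin s]) \<psi>) n) has_integral 0) {0..2*pi}"
proof -
  have 1: "((\<lambda>s. (-1) ^ Suc 1 * zmon e1 e2 1 (- 1 - int (Suc 1)) (vector [cos s, sin s])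
        * coeff (c (g ((ad e2 ^^ Suc 1) l' \<psi>))) n) has_integral 0) {0..2*pi}"
  proof (rule zmon_circle_has_integral_0[OF e])
    show "of_int 1 * Im e1 + of_int (- 1 - int (Suc 1)) * Im e2 =
        real_of_int ((if e1 = \<i> then 1 else -1) - 3 * (if e2 = \<i> then 1 else -1))"
      using e by auto
  qed auto
  have 2: "((\<lambda>s. (-1) ^ 1 * zmon e1 e2 0 (- 1 - int 1) (vector [cos s, sin s])
        * coeff (c (ad e1 (\<lambda>\<phi>. g ((ad e2 ^^ 1) l' \<phi>)) \<psi>)) n) has_integral 0) {0..2*pi}"
  proof (rule zmon_circle_has_integral_0[OF e])
    show "of_int 0 * Im e1 + of_int (- 1 - int 1) * Im e2 = real_of_int (- 2 * (if e2 = \<i> then 1 else -1))"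
      using e by auto
  qed auto
  have eq: "dz_zinv_symbol e1 e2 c g l' 2 \<xi> \<psi> =
     cscale ((-1) ^ Suc 1 * zmon e1 e2 1 (- 1 - int (Suc 1)) \<xi>) (c (g ((ad e2 ^^ Suc 1) l' \<psi>))) +
     cscale ((-1) ^ 1 * zmon e1 e2 0 (- 1 - int 1) \<xi>) (c (ad e1 (\<lambda>\<phi>. g ((ad e2 ^^ 1) l' \<phi>)) \<psi>))" for \<xi>
  proof -
    have "(2 :: nat) = Suc 1" by simp
    then show ?thesis by (simp only: dz_zinv_symbol.simps)
  qed
  show ?thesis
    using has_integral_add[OF 1 2] unfolding eq plus_nct.rep_eq cscale.rep_eq add_0 .
qed

text \<open>For \<open>e = \<plusminus>\<i>\<close>, the vector \<open>t e (Q e \<psi>)\<close> is a component of \<open>D\<^sub>k|D\<^sub>k|\<^sup>-\<^sup>2\<psi>\<close>. In the first summand the outer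
  Dirac operator of the anticommutator acts after the one-form \<open>w\<close>, in the second one before it.\<close>

definition einstein_entry :: "(2 \<Rightarrow> nct) \<Rightarrow> (2 \<Rightarrow> nct) \<Rightarrow> complex \<Rightarrow> nct \<Rightarrow> nct" where
  "einstein_entry V W e \<psi> = einstein_left V e (dz e (einstein_inner W e (t e (Q e \<psi>))))
     + metric_coefficient V W e (k (dz (- e) (k (t e (Q e \<psi>)))))"

definition einstein_symbol :: "(2 \<Rightarrow> nct) \<Rightarrow> (2 \<Rightarrow> nct) \<Rightarrow> complex \<Rightarrow> int \<Rightarrow> real^2 \<Rightarrow> nct \<Rightarrow> nct" where
  "einstein_symbol V W e d \<xi> \<psi> =
     (if d \<le> 0 then dz_zinv_symbol e (- e) (einstein_left V e) (\<lambda>\<phi>. einstein_inner W e (l \<phi>)) l (nat (0 - d)) \<xi> \<psi> else 0) +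
     (if d \<le> 0 then dz_zinv_symbol (- e) (- e) (\<lambda>\<phi>. metric_coefficient V W e (k \<phi>)) (\<lambda>\<phi>. k (l \<phi>)) l (nat (0 - d)) \<xi> \<psi> else 0)"

lemma einstein_scalar_symbol:
  assumes e: "e \<in> {\<i>, -\<i>}"
  shows "scalar_symbol \<theta> (einstein_entry V W e) (einstein_symbol V W e)"
proof -
  have e': "- e \<in> {\<i>, -\<i>}" using e by auto
  have sm: "smoothing (\<lambda>n. c (dz e1 (g (t e (Q e (U n))))) - c (dz e1 (g (l (zinv (- e) (l (U n)))))))"
    if c: "c \<in> Ahat \<theta>" and g: "g \<in> Ahat \<theta>" and e1: "e1 \<in> {\<i>, -\<i>}" for c g e1
  proof -
    have "smoothing (\<lambda>n. g (t e (Q e (U n))) - g (l (zinv (- e) (l (U n)))))"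
      by (rule smoothing_local_diff[OF Ahat_local[OF g] smoothing_t_Q[OF e]])
    from smoothing_local[OF Ahat_local[OF c] smoothing_dz[OF e1 this]] show ?thesis
      by (simp add: linear_op_diff[OF linear_dz] linear_op_diff[OF local_op_linear[OF Ahat_local[OF c]]])
  qed
  have "scalar_symbol \<theta> (\<lambda>\<psi>. einstein_left V e (dz e (einstein_inner W e (t e (Q e \<psi>)))))
     (\<lambda>d \<xi> \<psi>. if d \<le> 0 then dz_zinv_symbol e (- e) (einstein_left V e) (\<lambda>\<phi>. einstein_inner W e (l \<phi>)) l (nat (0 - d)) \<xi> \<psi> else 0)"
    by (rule scalar_symbol_smoothing[OF dz_zinv_scalar_symbol[OF e e' einstein_Ahat(1)
            Ahat_comp'[OF einstein_Ahat(2) l_Ahat] l_Ahat] sm[OF einstein_Ahat e]])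
  moreover have "scalar_symbol \<theta> (\<lambda>\<psi>. metric_coefficient V W e (k (dz (- e) (k (t e (Q e \<psi>))))))
     (\<lambda>d \<xi> \<psi>. if d \<le> 0 then dz_zinv_symbol (- e) (- e) (\<lambda>\<phi>. metric_coefficient V W e (k \<phi>)) (\<lambda>\<phi>. k (l \<phi>)) l (nat (0 - d)) \<xi> \<psi> else 0)"
    by (rule scalar_symbol_smoothing[OF dz_zinv_scalar_symbol[OF e' e' Ahat_comp'[OF metric_coefficient_Ahat k_Ahat]
            Ahat_comp'[OF k_Ahat l_Ahat] l_Ahat] sm[OF Ahat_comp'[OF metric_coefficient_Ahat k_Ahat] k_Ahat e']])
  ultimately show ?thesis
    unfolding einstein_symbol_def[abs_def] einstein_entry_def[abs_def] by (rule scalar_symbol_add)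
qed

lemma continuous_einstein:
  assumes e: "e \<in> {\<i>, -\<i>}" shows "continuous_op (einstein_entry V W e)"
proof -
  have e': "- e \<in> {\<i>, -\<i>}" using e by auto
  note A = local_op_continuous[OF Ahat_local]
  have k: "continuous_op k" by (rule A[OF k_Ahat])
  have t: "continuous_op (\<lambda>\<psi>. t e (Q e \<psi>))"
    unfolding t_def by (intro continuous_op_comp[OF k] continuous_op_comp[OF continuous_dz[OF e]] continuous_Q)
  show ?thesis
    unfolding einstein_entry_def[abs_def]
    by (intro continuous_op_add continuous_op_comp[OF A[OF einstein_Ahat(1)]] continuous_op_comp[OF A[OF einstein_Ahat(2)]]
        continuous_op_comp[OF continuous_dz[OF e]] continuous_op_comp[OF continuous_dz[OF e']]
        continuous_op_comp[OF A[OF metric_coefficient_Ahat]] continuous_op_comp[OF k] t)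
qed

lemma einstein_functional_eq:
  assumes \<theta>: "\<theta> \<notin> \<rat>"
  shows "einstein_functional \<theta> (dirac_k k) (one_form \<theta> k V) (one_form \<theta> k W) = 0"
proof -
  let ?I = "circle_integral (\<lambda>\<xi>. mtrace (\<lambda>\<psi>. \<chi> i. einstein_symbol V W (gsign i) (- 2) \<xi> (\<psi> $ i)))"
  have "one_form \<theta> k V \<circ> anticomm (dirac_k k) (one_form \<theta> k W) \<circ> dirac_k k \<circ> abs_inv_sq \<theta> (dirac_k k) =
      (\<lambda>\<psi>. \<chi> i. einstein_entry V W (gsign i) (\<psi> $ i))"
    by (rule ext) (simp add: one_form_eq abs_inv_sq_eq vec_eq_iff forall_2 gsign_def metric_coefficient_def
        anticomm_def dirac_k_eq einstein_entry_def einstein_left_def einstein_inner_def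
        linear_op_add[OF linear_Lmul] linear_op_add[OF k_lin] t_def[of _ "k (k _)"] t_def[of _ "t _ _"])
  moreover have "has_symbol \<theta> (\<lambda>\<psi>. \<chi> i. einstein_entry V W (gsign i) (\<psi> $ i))
      (\<lambda>d \<xi> \<psi>. \<chi> i. einstein_symbol V W (gsign i) d \<xi> (\<psi> $ i))"
    by (rule has_symbol_diag[OF continuous_einstein[OF gsign(1)] einstein_scalar_symbol[OF gsign(1)]])
  ultimately have W: "einstein_functional \<theta> (dirac_k k) (one_form \<theta> k V) (one_form \<theta> k W) =
      1 / (4 * pi) * tau_ot \<theta> (?I)"
    unfolding einstein_functional_def by (simp only: wodzicki_eq[OF \<theta>])
  have trace: "mtrace (\<lambda>\<psi>. \<chi> i. einstein_symbol V W (gsign i) (- 2) \<xi> (\<psi> $ i)) \<psi> =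
      (\<Sum>i\<in>UNIV. einstein_symbol V W (gsign i) (- 2) \<xi> \<psi>)" for \<xi> \<psi>
    by (rule mtrace_diag[of "\<lambda>i. einstein_symbol V W (gsign i) (- 2) \<xi>"])
  have degree: "einstein_symbol V W e (- 2) \<xi> \<psi> =
     dz_zinv_symbol e (- e) (einstein_left V e) (\<lambda>\<phi>. einstein_inner W e (l \<phi>)) l 2 \<xi> \<psi> +
     dz_zinv_symbol (- e) (- e) (\<lambda>\<phi>. metric_coefficient V W e (k \<phi>)) (\<lambda>\<phi>. k (l \<phi>)) l 2 \<xi> \<psi>" for e \<xi> \<psi>
    by (simp add: einstein_symbol_def)
  have "?I \<psi> = Lmul \<theta> 0 \<psi>" for \<psi>
  proof -
    have "((\<lambda>s. coeff (\<Sum>i\<in>UNIV. einstein_symbol V W (gsign i) (- 2) (vector [cos s, sin s]) \<psi>) n)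
       has_integral (\<Sum>i\<in>(UNIV :: 2 set). 0 + 0)) {0..2*pi}" for n
      unfolding coeff_sum degree plus_nct.rep_eq
      by (intro has_integral_sum has_integral_add dz_zinv_symbol_circle gsign) simp
    then have "integral {0..2 * pi} (\<lambda>s. coeff (\<Sum>i\<in>UNIV. einstein_symbol V W (gsign i) (- 2) (vector [cos s, sin s]) \<psi>) n) = 0" for n
      by (simp add: integral_unique)
    then have "?I \<psi> = Abs_nct (coeff 0)"
      unfolding circle_integral_def trace zero_nct.rep_eq by (simp only:)
    moreover have "Lmul \<theta> 0 \<psi> = 0"
      using Lmul_scale[of \<theta> 0 0 \<psi>] by simp
    ultimately show ?thesis by (simp only: coeff_inverse)
  qed
  then have "?I = Lmul \<theta> 0"
    by (rule ext)
  then show ?thesis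
    by (simp add: W tau_ot_Lmul[OF \<theta>] tau_def)
qed

end

theorem proposition5p10:
  fixes \<theta> :: real and k :: "nct \<Rightarrow> nct" and V W :: "2 \<Rightarrow> nct"
  assumes irrational: "\<theta> \<notin> \<rat>"
    and k_Aop: "k \<in> Aop \<theta>"
    and k_positive: "positive_op \<theta> k"
    and k_invertible: "\<exists>l\<in>Aop \<theta>. k \<circ> l = id \<and> l \<circ> k = id"
  shows "metric_functional \<theta> (dirac_k k) (one_form \<theta> k V) (one_form \<theta> k W)
           = tau (\<Sum>a\<in>UNIV. tmult \<theta> (V a) (W a)) \<and>
         einstein_functional \<theta> (dirac_k k) (one_form \<theta> k V) (one_form \<theta> k W) = 0"
proof -
  obtain l where l: "l \<in> Aop \<theta>" and "k \<circ> l = id" "l \<circ> k = id"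
    using k_invertible by blast
  then have kl: "k (l \<psi>) = \<psi>" "l (k \<psi>) = \<psi>" for \<psi>
    by (simp_all add: fun_eq_iff)
  have k_lin: "linear_op k"
    using k_Aop by (auto simp: Aop_def linear_Rmul)
  have "gns_inner \<theta> (l (U 0)) \<psi> = coeff (l \<psi>) 0" for \<psi>
  proof -
    have "gns_inner \<theta> (l (U 0)) \<psi> = gns_inner \<theta> (k (l (U 0))) (l \<psi>)"
      using positive_op_symmetric[OF k_positive k_lin, of "l (U 0)" "l \<psi>"] by (simp add: kl)
    then show ?thesis
      by (simp add: kl gns_inner_def star_ops tau_def)
  qed
  with k_Aop l kl interpret conformal_factor \<theta> k l
    by unfold_locales
  show ?thesis
    using metric_functional_eq[OF irrational] einstein_functional_eq[OF irrational] by blast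
qed

end
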